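(* Let $\nu_{\hat D}$ be the law of a nonnegative random variable $\hat D$ with $\mathbb E\hat D=1$, and let $\nu$ be its size-biasing, i.e. $\frac{d\nu}{d\nu_{\hat D}}(x)=x$ on $\mathbb R_+$. Let $\mu_{\mathrm{MP}}$ be the Marchenko--Pastur limit (on $\mathbb R_+$) of the empirical spectral distribution of $n^{-1}\mathbf\Lambda_n\widetilde{\mathbf X}_n\widetilde{\mathbf X}_n^\star\mathbf\Lambda_n$, in which the non-symmetric $n\times n$ matrix $\widetilde{\mathbf X}_n$ has standard i.i.d. complex Gaussian entries and $\mathbf\Lambda_n$ are nonnegative diagonal matrices with $\mathcal L^{\mathbf\Lambda_n}\Rightarrow\nu$. Then the free multiplicative convolution $\mu=\nu_{\hat D}\boxtimes\sigma_{\mathrm{sc}}$ has the Cauchy--Stieltjes transform $$G_\mu(z)=-z^{-1}\big[1+G_{\widetilde\mu}(z)^2\big],\qquad\forall z\in\mathbb C_+,$$ where $\widetilde\mu$ is the law of the symmetric random variable $X$ such that $X^2$ is distributed according to $\mu_{\mathrm{MP}}$.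
   Context: $\mathbb C_+=\{z\in\mathbb C:\Im z>0\}$, $\mathbb R_+=[0,\infty)$. For a Hermitian $n\times n$ matrix $\mathbf A$ with eigenvalues $\lambda_i$, $\mathcal L^{\mathbf A}=\frac1n\sum_i\delta_{\lambda_i}$ is its empirical spectral distribution; $\Rightarrow$ is weak convergence. $\sigma_{\mathrm{sc}}$ is the standard semicircle law, supported on $[-2,2]$. The Cauchy--Stieltjes transform of a probability measure $\mu$ on $\mathbb R$ is $G_\mu(z)=\int\frac{1}{t-z}\,d\mu(t)$. Free multiplicative convolution: for a probability measure $\varphi$ let $m_\varphi(z)=\int\frac{zt}{1-zt}\,d\varphi(t)$. If $\varphi\ne\delta_0$ is supported on $\mathbb R_+$, $m_\varphi$ is injective on $\{\Re z<0\}$; if $\psi\neq\delta_0$ is symmetric on $\mathbb R$, $m_\psi$ is injective on $\{z:\Im z>|\Re z|\}$. With $m^{-1}$ the inverse of the respective restriction, the $S$-transform is $S(w)=(1+w^{-1})\,m^{-1}(w)$. For $\varphi\ne\delta_0$ on $\mathbb R_+$ and $\psi\ne\delta_0$ symmetric, $\varphi\boxtimes\psi$ is the unique (symmetric) probability measure on $\mathbb R$ with $S_{\varphi\boxtimes\psi}(w)=S_\varphi(w)S_\psi(w)$ on the common domain of these transforms (which contains an interval $(-\varepsilon,0)$).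
   Formalization: The spectral law of Λ_n², not of Λ_n, is required to converge to ν; as printed the claim fails, e.g. for ν_D̂ = (δ_0+δ_2)/2 with Λ_n = 2I, where the formula gives μ fourth moment 8 instead of 4. *)

theory Defs
  imports "HOL-Probability.Probability" "Jordan_Normal_Form.Schur_Decomposition"
begin

section \<open>Empirical spectral distributions\<close>

text \<open>Eigenvalues are counted with algebraic multiplicity, as roots of the characteristic
  polynomial.  For a Hermitian matrix they are real, so that \<open>Re\<close> only changes the type.
  For a matrix of dimension 0 the value is meaningless.\<close>

definition esd :: "complex mat \<Rightarrow> real measure" where
  "esd A = distr (measure_pmf (pmf_of_multiset (proots (char_poly A)))) borel Re"

definition nonneg_diagonal :: "nat \<Rightarrow> complex mat \<Rightarrow> bool" where
  "nonneg_diagonal n L \<longleftrightarrow>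
     L \<in> carrier_mat n n \<and> diagonal_mat L \<and> (\<forall>i<n. L $$ (i, i) \<in> \<real>\<^sub>\<ge>\<^sub>0)"

section \<open>The Gaussian matrix model\<close>

text \<open>Normalisation: real and imaginary parts are independent centred Gaussians of variance
  \<open>1/2\<close> each, so that the expected squared modulus is 1.  (The second argument of
  \<^const>\<open>normal_density\<close> is the standard deviation.)\<close>

definition std_complex_gaussian :: "complex measure" where
  "std_complex_gaussian =
     (let N = density lborel (\<lambda>x. ennreal (normal_density 0 (1 / sqrt 2) x))
      in distr (N \<Otimes>\<^sub>M N) borel (\<lambda>(x, y). Complex x y))"

definition iid_gaussian_mat :: "'w measure \<Rightarrow> nat \<Rightarrow> ('w \<Rightarrow> complex mat) \<Rightarrow> bool" where
  "iid_gaussian_mat W n X \<longleftrightarrow>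
     (\<forall>\<omega>\<in>space W. X \<omega> \<in> carrier_mat n n) \<and>
     prob_space.indep_vars W (\<lambda>_. borel) (\<lambda>ij \<omega>. X \<omega> $$ ij) ({..<n} \<times> {..<n}) \<and>
     (\<forall>i<n. \<forall>j<n. distr W borel (\<lambda>\<omega>. X \<omega> $$ (i, j)) = std_complex_gaussian)"

definition sample_cov :: "nat \<Rightarrow> complex mat \<Rightarrow> complex mat \<Rightarrow> complex mat" where
  "sample_cov n L X = (1 / of_nat n) \<cdot>\<^sub>m (L * X * mat_adjoint X * L)"

text \<open>\<open>\<mu>MP\<close> is the almost sure weak limit of the spectral distributions of
  \<open>\<Lambda>\<^sub>n X\<^sub>n X\<^sub>n\<^sup>* \<Lambda>\<^sub>n / n\<close>, where \<open>\<nu>\<close> is the limiting spectral distribution of the population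
  covariances \<open>\<Lambda>\<^sub>n\<^sup>2\<close>.  No joint law of the matrices for different \<open>n\<close> is prescribed.

  The condition is on \<open>\<Lambda>\<^sub>n\<^sup>2\<close>, not on \<open>\<Lambda>\<^sub>n\<close>, because the size-biased law \<open>\<nu>\<close> enters the
  relation to the free convolution as the law of the covariances: if \<open>\<nu>\<close> were the limit for
  \<open>\<Lambda>\<^sub>n\<close> itself, the relation would fail already for the law \<open>(\<delta>\<^sub>0 + \<delta>\<^sub>2) / 2\<close>, whose
  size-biasing is \<open>\<delta>\<^sub>2\<close>.\<close>

definition marchenko_pastur_limit ::
  "'w measure \<Rightarrow> (nat \<Rightarrow> complex mat) \<Rightarrow> (nat \<Rightarrow> 'w \<Rightarrow> complex mat) \<Rightarrow>
     real measure \<Rightarrow> real measure \<Rightarrow> bool" where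
  "marchenko_pastur_limit W \<Lambda> X \<nu> \<mu>MP \<longleftrightarrow>
     prob_space W \<and>
     (\<forall>n. nonneg_diagonal n (\<Lambda> n)) \<and>
     weak_conv_m (\<lambda>n. esd (\<Lambda> n * \<Lambda> n)) \<nu> \<and>
     (\<forall>n. iid_gaussian_mat W n (X n)) \<and>
     real_distribution \<mu>MP \<and>
     (AE \<omega> in W. weak_conv_m (\<lambda>n. esd (sample_cov n (\<Lambda> n) (X n \<omega>))) \<mu>MP)"

section \<open>Transforms and free multiplicative convolution\<close>

definition size_biasing :: "real measure \<Rightarrow> real measure" where
  "size_biasing \<nu> = density \<nu> (\<lambda>x. ennreal x)"

definition symmetric_measure :: "real measure \<Rightarrow> bool" where
  "symmetric_measure \<mu> \<longleftrightarrow> distr \<mu> borel uminus = \<mu>"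

definition semicircle :: "real measure" where
  "semicircle =
     density lborel (\<lambda>x. ennreal (indicator {-2..2} x * sqrt (4 - x\<^sup>2) / (2 * pi)))"

definition cauchy_stieltjes :: "real measure \<Rightarrow> complex \<Rightarrow> complex" where
  "cauchy_stieltjes \<mu> z = (\<integral>t. 1 / (complex_of_real t - z) \<partial>\<mu>)"

definition m_transform :: "real measure \<Rightarrow> complex \<Rightarrow> complex" where
  "m_transform \<phi> z = (\<integral>t. z * complex_of_real t / (1 - z * complex_of_real t) \<partial>\<phi>)"

definition half_plane :: "complex set" where
  "half_plane = {z. Re z < 0}"

definition sector :: "complex set" where
  "sector = {z. Im z > \<bar>Re z\<bar>}"

text \<open>\<open>A\<close> is the domain to which the m-transform is restricted before it is inverted:
  \<^const>\<open>half_plane\<close> for measures on the nonnegative half-line and \<^const>\<open>sector\<close> for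
  symmetric measures.  The S-transform is meaningful on the image of \<open>A\<close>.\<close>

definition S_domain :: "complex set \<Rightarrow> real measure \<Rightarrow> complex set" where
  "S_domain A \<phi> = m_transform \<phi> ` A"

definition S_transform :: "complex set \<Rightarrow> real measure \<Rightarrow> complex \<Rightarrow> complex" where
  "S_transform A \<phi> w = (1 + inverse w) * inv_into A (m_transform \<phi>) w"

text \<open>\<open>\<mu>\<close> is the free multiplicative convolution of \<open>\<phi>\<close> and \<open>\<psi>\<close>, to be used for probability
  measures \<open>\<phi>\<close> on the nonnegative half-line and \<open>\<psi>\<close> symmetric, both different from the
  point mass at 0; these conditions on \<open>\<phi>\<close> and \<open>\<psi>\<close> are not part of the predicate.
  It is stated as a relation since existence and uniqueness of \<open>\<mu>\<close> are theorems.\<close>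

definition is_free_mult_conv :: "real measure \<Rightarrow> real measure \<Rightarrow> real measure \<Rightarrow> bool" where
  "is_free_mult_conv \<phi> \<psi> \<mu> \<longleftrightarrow>
     real_distribution \<mu> \<and> symmetric_measure \<mu> \<and> \<mu> \<noteq> return borel 0 \<and>
     (\<forall>w \<in> S_domain half_plane \<phi> \<inter> S_domain sector \<psi> \<inter> S_domain sector \<mu>.
        S_transform sector \<mu> w = S_transform half_plane \<phi> w * S_transform sector \<psi> w)"

end

theory Submission
  imports Defs "HOL-Complex_Analysis.Complex_Analysis" "HOL-Real_Asymp.Real_Asymp"
begin

text \<open>Both sides are holomorphic on the upper half-plane, so it is enough to compare them at
  \<open>z = i y\<close> for large \<open>y\<close>, where every transform is real up to a factor \<open>i\<close>.

  Let \<open>m = \<integral> 1 / (y\<^sup>2 + t) d\<mu>MP(t)\<close>.  The random matrices enter only through the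
  fixed-point equation \<open>y\<^sup>2 m = \<integral> 1 / (1 + t m) d\<nu>(t)\<close>.  It comes from leaving out one row \<open>u\<^sub>i\<close>
  of \<open>X\<close>: the companion matrix \<open>X\<^sup>* \<Lambda>\<^sup>2 X / n + y\<^sup>2\<close> is a rank one perturbation, with weight
  \<open>\<tau>\<^sub>i / n\<close>, of a matrix with inverse \<open>R\<^sub>i\<close> independent of \<open>u\<^sub>i\<close>, and by the Sherman-Morrison formula
  its normalised resolvent trace \<open>T\<close> satisfies \<open>y\<^sup>2 T = (1 / n) \<Sum>\<^sub>i 1 / (1 + \<tau>\<^sub>i q\<^sub>i)\<close> with
  \<open>q\<^sub>i = u\<^sub>i\<^sup>* R\<^sub>i u\<^sub>i / n\<close>.  A second moment computation gives \<open>q\<^sub>i = tr R\<^sub>i / n + O(1 / sqrt n)\<close> in \<open>L\<^sup>1\<close>,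
  and \<open>tr R\<^sub>i / n = T + O(1 / n)\<close>.  No concentration of \<open>T\<close> has to be proved, since its almost
  sure convergence to \<open>m\<close> is a hypothesis.

  As \<open>\<nu>\<close> is the size-biasing of \<open>\<nu>D\<close>, the equation says that the m-transform of \<open>\<nu>D\<close> at \<open>-m\<close> is
  \<open>w = -(y m)\<^sup>2\<close>.  The S-transform of the semicircle law at \<open>w\<close> is elementary, and multiplicativity
  yields that the m-transform of \<open>\<mu>\<close> at \<open>i / y\<close> is \<open>w\<close>, which is the claim at \<open>i y\<close>.\<close>

section \<open>Inverses of coercive matrices and rank one perturbations\<close>

text \<open>At \<open>z = i y\<close> the resolvent parameter is \<open>-y\<^sup>2\<close>, so every
  matrix to be inverted is positive definite, and testing with single vectors replaces spectral
  calculus in all resolvent bounds. The weights \<tau> need not be bounded. The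
  \<open>L\<^sup>1\<close> errors survive the nonlinear step because a -> 1 / (1 + \<tau> a),
  compared at a >= 0 and at m, is Lipschitz with constant 1 / m uniformly in \<tau>. Uniqueness of
  the fixed point is never at issue: the equation serves only to exhibit -m as a preimage of w. What
  must be unique are preimages under m-transforms, because \<open>S_transform\<close> is built from
  \<open>inv_into\<close>; so injectivity on the half-plane and on the sector is proved. The point y
  has to be large because multiplicativity can be used only where w lies in the images of all three
  m-transforms. Of \<mu> it is known that it is symmetric and not the point mass at 0, which by the
  intermediate value theorem puts a small interval to the left of 0 into its image; w = -(y m)^2
  enters that interval since y m <= 1 / y.\<close>

text \<open>Square matrices are functions of two indices of which only the entries below \<open>n\<close> matter;
  this avoids side conditions on carriers.  For a singular matrix \<open>minv\<close> is 0.\<close>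

definition minv :: "nat \<Rightarrow> (nat \<Rightarrow> nat \<Rightarrow> complex) \<Rightarrow> nat \<Rightarrow> nat \<Rightarrow> complex" where
  "minv n A i j =
     cofactor (mat n n (\<lambda>(i, j). A i j)) j i / Determinant.det (mat n n (\<lambda>(i, j). A i j))"

lemma minv_inverse:
  assumes "Determinant.det (mat n n (\<lambda>(i, j). A i j)) \<noteq> 0" and "i < n" "j < n"
  shows minv_right: "(\<Sum>k<n. A i k * minv n A k j) = (if i = j then 1 else 0)"
    and minv_left: "(\<Sum>k<n. minv n A i k * A k j) = (if i = j then 1 else 0)"
proof -
  let ?A = "mat n n (\<lambda>(i, j). A i j)"
  have A: "?A \<in> carrier_mat n n" by simp
  have "(?A * adj_mat ?A) $$ (i, j) = (Determinant.det ?A \<cdot>\<^sub>m 1\<^sub>m n) $$ (i, j)"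
    using adj_mat(2)[OF A] by simp
  then have "(\<Sum>k<n. A i k * cofactor ?A j k) = (if i = j then Determinant.det ?A else 0)"
    using assms(2,3) adj_mat(1)[OF A]
    by (simp add: adj_mat_def scalar_prod_def atLeast0LessThan)
  then show "(\<Sum>k<n. A i k * minv n A k j) = (if i = j then 1 else 0)"
    using assms(1) by (simp add: minv_def flip: sum_divide_distrib)
  have "(adj_mat ?A * ?A) $$ (i, j) = (Determinant.det ?A \<cdot>\<^sub>m 1\<^sub>m n) $$ (i, j)"
    using adj_mat(3)[OF A] by simp
  then have "(\<Sum>k<n. cofactor ?A k i * A k j) = (if i = j then Determinant.det ?A else 0)"
    using assms(2,3) adj_mat(1)[OF A]
    by (simp add: adj_mat_def scalar_prod_def atLeast0LessThan)
  then show "(\<Sum>k<n. minv n A i k * A k j) = (if i = j then 1 else 0)"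
    using assms(1) by (simp add: minv_def flip: sum_divide_distrib)
qed

definition mat_app :: "nat \<Rightarrow> (nat \<Rightarrow> nat \<Rightarrow> complex) \<Rightarrow> (nat \<Rightarrow> complex) \<Rightarrow> nat \<Rightarrow> complex" where
  "mat_app n A v i = (\<Sum>k<n. A i k * v k)"

text \<open>A lower bound for the real part of the quadratic form gives invertibility and a bound
  for the inverse at once, without eigenvalues.\<close>

definition coercive :: "nat \<Rightarrow> real \<Rightarrow> (nat \<Rightarrow> nat \<Rightarrow> complex) \<Rightarrow> bool" where
  "coercive n x A \<longleftrightarrow>
     (\<forall>v. x * (\<Sum>j<n. (cmod (v j))\<^sup>2) \<le> Re (\<Sum>j<n. cnj (v j) * mat_app n A v j))"

lemma coercive_det:
  assumes "coercive n x A" "x > 0"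
  shows "Determinant.det (mat n n (\<lambda>(i, j). A i j)) \<noteq> 0"
proof
  let ?A = "mat n n (\<lambda>(i, j). A i j)"
  assume "Determinant.det ?A = 0"
  then obtain v where v: "v \<in> carrier_vec n" "v \<noteq> 0\<^sub>v n" "?A *\<^sub>v v = 0\<^sub>v n"
    using det_0_iff_vec_prod_zero[of ?A n] by auto
  have "mat_app n A (\<lambda>k. vec_index v k) i = 0" if "i < n" for i
    using arg_cong[OF v(3), of "\<lambda>w. vec_index w i"] that v(1)
    by (simp add: mat_app_def scalar_prod_def atLeast0LessThan)
  then have "x * (\<Sum>j<n. (cmod (vec_index v j))\<^sup>2) \<le> 0"
    using assms(1)[unfolded coercive_def, rule_format, of "\<lambda>k. vec_index v k"] by simp
  with assms(2) have "(\<Sum>j<n. (cmod (vec_index v j))\<^sup>2) \<le> 0"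
    by (simp add: mult_le_0_iff)
  then have "(\<Sum>j<n. (cmod (vec_index v j))\<^sup>2) = 0" by (simp add: sum_nonneg antisym)
  then have "\<forall>j<n. vec_index v j = 0" by (simp add: sum_nonneg_eq_0_iff)
  then have "v = 0\<^sub>v n" using v(1) by (intro eq_vecI) auto
  with v(2) show False by simp
qed

text \<open>Uniqueness of solutions. Hermitian symmetry of the inverse, the Sherman-Morrison formula
  and the push-through identity are all obtained below by checking a linear system and appealing to
  this lemma.\<close>

lemma mat_app_minv:
  assumes "coercive n x A" "x > 0" "\<And>j. j < n \<Longrightarrow> mat_app n A v j = w j" "i < n"
  shows "v i = mat_app n (minv n A) w i"
proof -
  have d: "Determinant.det (mat n n (\<lambda>(i, j). A i j)) \<noteq> 0" using coercive_det assms by blast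
  have "mat_app n (minv n A) w i = (\<Sum>k<n. minv n A i k * (\<Sum>j<n. A k j * v j))"
    using assms(3) by (auto simp: mat_app_def intro!: sum.cong)
  also have "\<dots> = (\<Sum>k<n. \<Sum>j<n. minv n A i k * A k j * v j)"
    by (simp add: sum_distrib_left mult.assoc)
  also have "\<dots> = (\<Sum>j<n. (\<Sum>k<n. minv n A i k * A k j) * v j)"
    by (subst sum.swap) (simp add: sum_distrib_right)
  also have "\<dots> = (\<Sum>j<n. if j = i then v j else 0)"
    by (intro sum.cong) (auto simp: minv_left[OF d assms(4)])
  also have "\<dots> = v i" using assms(4) by simp
  finally show ?thesis by simp
qed

lemma mat_app_mat_app_minv:
  assumes "coercive n x A" "x > 0" "i < n"
  shows "mat_app n A (mat_app n (minv n A) w) i = w i"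
proof -
  have d: "Determinant.det (mat n n (\<lambda>(i, j). A i j)) \<noteq> 0" using coercive_det assms by blast
  have "mat_app n A (mat_app n (minv n A) w) i = (\<Sum>k<n. \<Sum>j<n. A i k * minv n A k j * w j)"
    by (simp add: mat_app_def sum_distrib_left mult.assoc)
  also have "\<dots> = (\<Sum>j<n. (\<Sum>k<n. A i k * minv n A k j) * w j)"
    by (subst sum.swap) (simp add: sum_distrib_right)
  also have "\<dots> = (\<Sum>j<n. if j = i then w j else 0)"
    by (intro sum.cong) (auto simp: minv_right[OF d assms(3)])
  also have "\<dots> = w i" using assms(3) by simp
  finally show ?thesis .
qed

lemma minv_column:
  assumes "j < n"
  shows "minv n A i j = mat_app n (minv n A) (\<lambda>k. if k = j then 1 else 0) i"
  using assms by (simp add: mat_app_def if_distrib[of "\<lambda>z. _ * z"] cong: if_cong)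

text \<open>Testing A v = w with v gives x |v|^2 <= Re <v, w>. The termwise inequality with weight x
  bounds the right side by half of x |v|^2 + |w|^2 / x, and the first part is absorbed on the
  left.\<close>

lemma coercive_minv_bound:
  assumes "coercive n x A" "x > 0"
  shows "x\<^sup>2 * (\<Sum>j<n. (cmod (mat_app n (minv n A) w j))\<^sup>2) \<le> (\<Sum>j<n. (cmod (w j))\<^sup>2)"
proof -
  define v where "v = mat_app n (minv n A) w"
  have Av: "mat_app n A v j = w j" if "j < n" for j
    using mat_app_mat_app_minv[OF assms that] by (simp add: v_def)
  let ?V = "\<Sum>j<n. (cmod (v j))\<^sup>2"
  have "x * ?V \<le> Re (\<Sum>j<n. cnj (v j) * mat_app n A v j)"
    using assms(1) unfolding coercive_def by blast
  also have "\<dots> = (\<Sum>j<n. Re (cnj (v j) * w j))" by (simp add: Av)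
  also have "\<dots> \<le> (\<Sum>j<n. (x * (cmod (v j))\<^sup>2 + (cmod (w j))\<^sup>2 / x) / 2)"
  proof (rule sum_mono)
    fix j
    have "Re (cnj (v j) * w j) \<le> cmod (v j) * cmod (w j)"
      using complex_Re_le_cmod[of "cnj (v j) * w j"] by (simp add: norm_mult)
    also have "\<dots> \<le> (x * (cmod (v j))\<^sup>2 + (cmod (w j))\<^sup>2 / x) / 2"
    proof -
      have "0 \<le> (x * cmod (v j) - cmod (w j))\<^sup>2 / x" using assms(2) by simp
      also have "\<dots> = x * (cmod (v j))\<^sup>2 + (cmod (w j))\<^sup>2 / x - 2 * (cmod (v j) * cmod (w j))"
        using assms(2) by (simp add: field_simps power2_eq_square)
      finally show ?thesis by simp
    qed
    finally show "Re (cnj (v j) * w j) \<le> (x * (cmod (v j))\<^sup>2 + (cmod (w j))\<^sup>2 / x) / 2" .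
  qed
  also have "\<dots> = (x * ?V + (\<Sum>j<n. (cmod (w j))\<^sup>2) / x) / 2"
    by (simp add: sum.distrib sum_distrib_left flip: sum_divide_distrib)
  finally have "x * ?V \<le> (\<Sum>j<n. (cmod (w j))\<^sup>2) / x" by simp
  then show ?thesis
    using assms(2) by (simp add: v_def field_simps power2_eq_square)
qed

lemma coercive_minv_column_bound:
  assumes "coercive n x A" "x > 0" "j < n"
  shows "(\<Sum>k<n. (cmod (minv n A k j))\<^sup>2) \<le> 1 / x\<^sup>2"
  using coercive_minv_bound[OF assms(1,2), of "\<lambda>k. if k = j then 1 else 0"] assms(2,3)
  by (simp add: minv_column[OF assms(3), symmetric] if_distrib[of cmod] if_distrib[of "\<lambda>z. z\<^sup>2"]
      field_simps cong: if_cong)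

lemma coercive_minv_entry_bound:
  assumes "coercive n x A" "x > 0" "i < n" "j < n"
  shows "cmod (minv n A i j) \<le> 1 / x"
proof -
  have "(cmod (minv n A i j))\<^sup>2 \<le> (\<Sum>k<n. (cmod (minv n A k j))\<^sup>2)"
    using assms(3) by (intro member_le_sum) auto
  also have "\<dots> \<le> (1 / x)\<^sup>2"
    using coercive_minv_column_bound[OF assms(1,2,4)] by (simp add: power_divide)
  finally show ?thesis using assms(2) by (simp add: power2_le_iff_abs_le)
qed

text \<open>The conjugate of row i of the inverse solves A v = e_i, hence is column i.\<close>

lemma minv_hermitian:
  assumes "coercive n x A" "x > 0" "i < n" "j < n"
    and herm: "\<And>i j. A j i = cnj (A i j)"
  shows "minv n A j i = cnj (minv n A i j)"
proof -
  have d: "Determinant.det (mat n n (\<lambda>(i, j). A i j)) \<noteq> 0" using coercive_det assms by blast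
  let ?v = "\<lambda>k. cnj (minv n A i k)"
  have "mat_app n A ?v k = (if k = i then 1 else 0)" if "k < n" for k
  proof -
    have "mat_app n A ?v k = cnj (\<Sum>l<n. minv n A i l * A l k)"
      unfolding mat_app_def cnj_sum by (intro sum.cong) (simp_all add: herm[of k, symmetric] mult.commute)
    then show ?thesis using minv_left[OF d assms(3) that] by auto
  qed
  from mat_app_minv[OF assms(1,2) this assms(4)]
  show ?thesis using assms(3) by (simp add: minv_column[OF assms(3), symmetric])
qed

section \<open>Regularised Gram matrices and the removal of one row\<close>

text \<open>This is x I + sum_l c_l u_l u_l^H with u_l the adjoint of row l of \<open>F\<close>.
  Keeping the weights separate allows a row to be left out by setting its weight to 0, without
  changing dimension or index set.\<close>

definition reg_gram :: "nat \<Rightarrow> real \<Rightarrow> (nat \<Rightarrow> real) \<Rightarrow> (nat \<Rightarrow> nat \<Rightarrow> complex) \<Rightarrow> nat \<Rightarrow> nat \<Rightarrow> complex" where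
  "reg_gram n x c F j k =
     (if j = k then of_real x else 0) + (\<Sum>l<n. of_real (c l) * (cnj (F l j) * F l k))"

definition row_form :: "nat \<Rightarrow> (nat \<Rightarrow> nat \<Rightarrow> complex) \<Rightarrow> nat \<Rightarrow> (nat \<Rightarrow> complex) \<Rightarrow> complex" where
  "row_form n F l v = (\<Sum>k<n. F l k * v k)"

lemma reg_gram_hermitian: "reg_gram n x c F k j = cnj (reg_gram n x c F j k)"
  by (simp add: reg_gram_def mult.commute)

lemma mat_app_reg_gram:
  assumes "j < n"
  shows "mat_app n (reg_gram n x c F) v j =
    of_real x * v j + (\<Sum>l<n. of_real (c l) * cnj (F l j) * row_form n F l v)"
proof -
  have "mat_app n (reg_gram n x c F) v j =
     (\<Sum>k<n. (if j = k then of_real x * v k else 0)) +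
     (\<Sum>k<n. \<Sum>l<n. of_real (c l) * cnj (F l j) * (F l k * v k))"
    unfolding mat_app_def reg_gram_def sum.distrib[symmetric]
    by (intro sum.cong) (auto simp: algebra_simps sum_distrib_left)
  then show ?thesis
    using assms by (subst (asm) sum.swap) (simp add: row_form_def sum_distrib_left)
qed

lemma reg_gram_form:
  "(\<Sum>j<n. cnj (v j) * mat_app n (reg_gram n x c F) v j) =
     of_real (x * (\<Sum>j<n. (cmod (v j))\<^sup>2) + (\<Sum>l<n. c l * (cmod (row_form n F l v))\<^sup>2))"
proof -
  have "(\<Sum>j<n. cnj (v j) * mat_app n (reg_gram n x c F) v j) =
     (\<Sum>j<n. of_real x * (v j * cnj (v j))) +
     (\<Sum>j<n. \<Sum>l<n. of_real (c l) * row_form n F l v * (cnj (F l j) * cnj (v j)))"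
    unfolding sum.distrib[symmetric]
    by (intro sum.cong) (auto simp: mat_app_reg_gram algebra_simps sum_distrib_left)
  also have "(\<Sum>j<n. \<Sum>l<n. of_real (c l) * row_form n F l v * (cnj (F l j) * cnj (v j))) =
     (\<Sum>l<n. of_real (c l) * (row_form n F l v * cnj (row_form n F l v)))"
  proof (subst sum.swap, intro sum.cong refl)
    fix l
    have "cnj (row_form n F l v) = (\<Sum>j<n. cnj (F l j) * cnj (v j))" by (simp add: row_form_def)
    then show "(\<Sum>j<n. of_real (c l) * row_form n F l v * (cnj (F l j) * cnj (v j))) =
        of_real (c l) * (row_form n F l v * cnj (row_form n F l v))"
      by (simp add: sum_distrib_left mult.assoc)
  qed
  finally show ?thesis
    by (simp add: sum_distrib_left complex_norm_square[symmetric])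
qed

lemma coercive_reg_gram:
  assumes "\<And>l. l < n \<Longrightarrow> c l \<ge> 0"
  shows "coercive n x (reg_gram n x c F)"
  unfolding coercive_def reg_gram_form using assms by (auto intro!: sum_nonneg)

lemma reg_gram_remove:
  assumes "j < n" "i < n"
  shows "mat_app n (reg_gram n x c F) v j =
    mat_app n (reg_gram n x (c(i := 0)) F) v j + of_real (c i) * cnj (F i j) * row_form n F i v"
proof -
  have "(\<Sum>l<n. of_real (c l) * cnj (F l j) * row_form n F l v) =
    (\<Sum>l<n. of_real ((c(i := 0)) l) * cnj (F l j) * row_form n F l v) +
    (\<Sum>l<n. if l = i then of_real (c i) * cnj (F i j) * row_form n F i v else 0)"
    unfolding sum.distrib[symmetric] by (intro sum.cong) auto
  then show ?thesis using assms by (simp add: mat_app_reg_gram)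
qed

text \<open>\<open>leave_one_out n x c F i\<close> is \<open>u\<^sub>i\<^sup>* R\<^sub>i u\<^sub>i\<close>, where \<open>u\<^sub>i\<close> is the adjoint of row \<open>i\<close> of \<open>F\<close> and \<open>R\<^sub>i\<close> is
  the inverse of the matrix from which row \<open>i\<close> has been left out.\<close>

definition leave_one_out :: "nat \<Rightarrow> real \<Rightarrow> (nat \<Rightarrow> real) \<Rightarrow> (nat \<Rightarrow> nat \<Rightarrow> complex) \<Rightarrow> nat \<Rightarrow> complex" where
  "leave_one_out n x c F i =
     row_form n F i (mat_app n (minv n (reg_gram n x (c(i := 0)) F)) (\<lambda>k. cnj (F i k)))"

text \<open>For v = R_i u_i one has u_i = A_i v, so u_i^H R_i u_i is the conjugate of <v, A_i v>,
  which \<open>reg_gram_form\<close> shows to be real. Keeping its term x |v|^2 gives the second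
  claim, on which the rank one trace bound rests.\<close>

lemma leave_one_out_real:
  assumes "x > 0" "\<And>l. l < n \<Longrightarrow> c l \<ge> 0"
  shows "leave_one_out n x c F i = of_real (Re (leave_one_out n x c F i))"
    and "x * (\<Sum>j<n. (cmod (mat_app n (minv n (reg_gram n x (c(i := 0)) F)) (\<lambda>k. cnj (F i k)) j))\<^sup>2)
      \<le> Re (leave_one_out n x c F i)"
proof -
  let ?A = "reg_gram n x (c(i := 0)) F"
  define v where "v = mat_app n (minv n ?A) (\<lambda>k. cnj (F i k))"
  have co: "coercive n x ?A" using assms by (intro coercive_reg_gram) auto
  have "mat_app n ?A v j = cnj (F i j)" if "j < n" for j
    using mat_app_mat_app_minv[OF co assms(1) that] by (simp add: v_def)
  then have "leave_one_out n x c F i = cnj (\<Sum>j<n. cnj (v j) * mat_app n ?A v j)"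
    by (simp add: leave_one_out_def row_form_def v_def[symmetric] cnj_sum mult.commute)
  then have *: "leave_one_out n x c F i =
    of_real (x * (\<Sum>j<n. (cmod (v j))\<^sup>2) + (\<Sum>l<n. (c(i := 0)) l * (cmod (row_form n F l v))\<^sup>2))"
    unfolding reg_gram_form by simp
  show "leave_one_out n x c F i = of_real (Re (leave_one_out n x c F i))" unfolding * by simp
  show "x * (\<Sum>j<n. (cmod (v j))\<^sup>2) \<le> Re (leave_one_out n x c F i)" unfolding *
    using assms(2) by (auto intro!: sum_nonneg)
qed

lemma leave_one_out_nonneg:
  assumes "x > 0" "\<And>l. l < n \<Longrightarrow> c l \<ge> 0"
  shows "Re (leave_one_out n x c F i) \<ge> 0"
  using leave_one_out_real(2)[where n=n and x=x and c=c and F=F and i=i, OF assms] assms(1)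
  by (meson mult_nonneg_nonneg order.trans less_imp_le sum_nonneg zero_le_power2)

text \<open>With v = R_i u_i and q = u_i^H v, restoring row i gives A v = u_i + c_i q u_i, a
  multiple of u_i. The factor 1 + c_i q is not 0 because its real part is positive.\<close>

lemma sherman_morrison_vec:
  assumes "x > 0" "\<And>l. l < n \<Longrightarrow> c l \<ge> 0" "i < n" "j < n"
  shows "mat_app n (minv n (reg_gram n x c F)) (\<lambda>k. cnj (F i k)) j =
    mat_app n (minv n (reg_gram n x (c(i := 0)) F)) (\<lambda>k. cnj (F i k)) j
      / (1 + of_real (c i) * leave_one_out n x c F i)"
proof -
  let ?A = "reg_gram n x c F" and ?Ai = "reg_gram n x (c(i := 0)) F"
  let ?d = "1 + of_real (c i) * leave_one_out n x c F i"
  define v where "v = mat_app n (minv n ?Ai) (\<lambda>k. cnj (F i k))"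
  have co: "coercive n x ?A" "coercive n x ?Ai" using assms by (auto intro!: coercive_reg_gram)
  have l: "leave_one_out n x c F i = row_form n F i v" by (simp add: leave_one_out_def v_def)
  have d: "?d \<noteq> 0"
  proof -
    have "Re ?d > 0"
      using leave_one_out_nonneg[where n=n and x=x and c=c and F=F and i=i] assms by (simp add: add_pos_nonneg)
    then show ?thesis by (intro notI) simp
  qed
  have "mat_app n ?A v j = ?d * cnj (F i j)" if "j < n" for j
    using mat_app_mat_app_minv[OF co(2) assms(1) that, of "\<lambda>k. cnj (F i k)"]
    by (simp add: reg_gram_remove[where c=c, OF that assms(3)] v_def[symmetric] l algebra_simps)
  then have "mat_app n ?A (\<lambda>k. v k / ?d) j = cnj (F i j)" if "j < n" for j
    using d that by (simp add: mat_app_def flip: sum_divide_distrib)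
  from mat_app_minv[OF co(1) assms(1) this assms(4)] show ?thesis by (simp add: v_def)
qed

text \<open>Take the trace of R A = I and expand A: the rank one terms contribute c_i u_i^H R u_i,
  which Sherman-Morrison expresses by the leave-one-out form.\<close>

lemma trace_identity:
  assumes "x > 0" "\<And>l. l < n \<Longrightarrow> c l \<ge> 0"
  shows "of_nat n = of_real x * (\<Sum>j<n. minv n (reg_gram n x c F) j j)
     + (\<Sum>i<n. of_real (c i) * leave_one_out n x c F i / (1 + of_real (c i) * leave_one_out n x c F i))"
proof -
  let ?A = "reg_gram n x c F" let ?R = "minv n ?A"
  have co: "coercive n x ?A" using assms by (auto intro!: coercive_reg_gram)
  have d: "Determinant.det (mat n n (\<lambda>(i, j). ?A i j)) \<noteq> 0" using coercive_det co assms by blast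
  have "of_nat n = (\<Sum>j<n. \<Sum>k<n. ?R j k * ?A k j)"
    by (simp add: minv_left[OF d])
  also have "\<dots> = (\<Sum>j<n. \<Sum>k<n. (if k = j then of_real x * ?R j k else 0)) +
      (\<Sum>j<n. \<Sum>k<n. \<Sum>i<n. of_real (c i) * (F i j * (?R j k * cnj (F i k))))"
    unfolding sum.distrib[symmetric]
    by (intro sum.cong) (auto simp: reg_gram_def algebra_simps sum_distrib_left)
  also have "(\<Sum>j<n. \<Sum>k<n. (if k = j then of_real x * ?R j k else 0)) =
      of_real x * (\<Sum>j<n. ?R j j)"
    by (simp add: sum_distrib_left)
  also have "(\<Sum>j<n. \<Sum>k<n. \<Sum>i<n. of_real (c i) * (F i j * (?R j k * cnj (F i k)))) =
      (\<Sum>i<n. \<Sum>j<n. \<Sum>k<n. of_real (c i) * (F i j * (?R j k * cnj (F i k))))"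
  proof -
    have "(\<Sum>j<n. \<Sum>k<n. \<Sum>i<n. of_real (c i) * (F i j * (?R j k * cnj (F i k)))) =
      (\<Sum>j<n. \<Sum>i<n. \<Sum>k<n. of_real (c i) * (F i j * (?R j k * cnj (F i k))))"
      by (intro sum.cong refl sum.swap)
    then show ?thesis by (subst (asm) (3) sum.swap) simp
  qed
  also have "\<dots> = (\<Sum>i<n. of_real (c i) * row_form n F i (mat_app n ?R (\<lambda>k. cnj (F i k))))"
    by (simp add: row_form_def mat_app_def sum_distrib_left)
  also have "\<dots> = (\<Sum>i<n. of_real (c i) * leave_one_out n x c F i / (1 + of_real (c i) * leave_one_out n x c F i))"
  proof (intro sum.cong refl)
    fix i assume "i \<in> {..<n}"
    then have "row_form n F i (mat_app n ?R (\<lambda>k. cnj (F i k))) = 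
       (\<Sum>j<n. F i j * (mat_app n (minv n (reg_gram n x (c(i := 0)) F)) (\<lambda>k. cnj (F i k)) j
         / (1 + of_real (c i) * leave_one_out n x c F i)))"
      unfolding row_form_def using sherman_morrison_vec[where n=n and x=x and c=c and F=F and i=i, OF assms]
      by (intro sum.cong) auto
    also have "\<dots> = leave_one_out n x c F i / (1 + of_real (c i) * leave_one_out n x c F i)"
      by (simp add: leave_one_out_def row_form_def sum_divide_distrib)
    finally show "of_real (c i) * row_form n F i (mat_app n ?R (\<lambda>k. cnj (F i k))) =
        of_real (c i) * leave_one_out n x c F i / (1 + of_real (c i) * leave_one_out n x c F i)" by simp
  qed
  finally show ?thesis .
qed

text \<open>The difference of the traces is c_i |R_i u_i|^2 / (1 + c_i q) with x |R_i u_i|^2 <= q.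
  The denominator compensates the numerator, so the bound is free of c_i, of the row and of
  n.\<close>

lemma trace_rank_one:
  assumes "x > 0" "\<And>l. l < n \<Longrightarrow> c l \<ge> 0" "i < n"
  shows "cmod ((\<Sum>j<n. minv n (reg_gram n x (c(i := 0)) F) j j)
             - (\<Sum>j<n. minv n (reg_gram n x c F) j j)) \<le> 1 / x"
proof -
  let ?A = "reg_gram n x c F" and ?Ai = "reg_gram n x (c(i := 0)) F"
  let ?R = "minv n ?A" and ?Ri = "minv n ?Ai"
  let ?d = "1 + of_real (c i) * leave_one_out n x c F i"
  define v where "v = mat_app n ?Ri (\<lambda>k. cnj (F i k))"
  have co: "coercive n x ?A" "coercive n x ?Ai" using assms by (auto intro!: coercive_reg_gram)
  have ptw: "?Ri j j - ?R j j = of_real (c i) * (v j * cnj (v j)) / ?d" if j: "j < n" for j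
  proof -
    let ?r = "\<lambda>k. ?Ri k j"
    \<comment> \<open>Column j of R_i solves A_i r = e_j, hence A r = \<open>?w\<close>; applying R
      to \<open>?w\<close> compares the two inverses.\<close>
    let ?w = "\<lambda>k. (if k = j then 1 else 0) + of_real (c i) * row_form n F i ?r * cnj (F i k)"
    have r: "?r = mat_app n ?Ri (\<lambda>k. if k = j then 1 else 0)"
      using minv_column[OF j] by (rule ext)
    have "mat_app n ?Ai ?r k = (if k = j then 1 else 0)" if "k < n" for k
      using mat_app_mat_app_minv[OF co(2) assms(1) that, of "\<lambda>k. if k = j then 1 else 0"]
      by (subst r)
    then have "mat_app n ?A ?r k = ?w k" if "k < n" for k
      using that by (simp add: reg_gram_remove[where c=c, OF that assms(3)] mult.assoc mult.commute)
    from mat_app_minv[OF co(1) assms(1) this j]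
    have "?Ri j j = mat_app n ?R ?w j" .
    also have "\<dots> = ?R j j + of_real (c i) * row_form n F i ?r * mat_app n ?R (\<lambda>k. cnj (F i k)) j"
    proof -
      have "mat_app n ?R ?w j = (\<Sum>k<n. if k = j then ?R j k else 0) +
        (\<Sum>k<n. of_real (c i) * row_form n F i ?r * (?R j k * cnj (F i k)))"
        unfolding mat_app_def sum.distrib[symmetric] by (intro sum.cong) (auto simp: algebra_simps)
      then show ?thesis using j by (simp add: mat_app_def sum_distrib_left)
    qed
    also have "row_form n F i ?r = cnj (v j)"
      unfolding row_form_def v_def mat_app_def cnj_sum
      using minv_hermitian[OF co(2) assms(1) j _ reg_gram_hermitian]
      by (intro sum.cong) auto
    also have "mat_app n ?R (\<lambda>k. cnj (F i k)) j = v j / ?d"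
      using sherman_morrison_vec[where n=n and x=x and c=c and F=F and i=i, OF assms j] by (simp add: v_def)
    finally show ?thesis by (simp add: fun_upd_def mult_ac)
  qed
  define V where "V = (\<Sum>j<n. (cmod (v j))\<^sup>2)"
  define q where "q = Re (leave_one_out n x c F i)"
  have q: "leave_one_out n x c F i = of_real q" "x * V \<le> q"
    using leave_one_out_real[where n=n and x=x and c=c and F=F and i=i, OF assms(1,2)] by (simp_all add: q_def V_def v_def)
  have V: "V \<ge> 0" by (simp add: V_def sum_nonneg)
  have c: "c i \<ge> 0" using assms by simp
  have xV: "x * V \<ge> 0" using V assms(1) by simp
  have q0: "q \<ge> 0" using q(2) xV by linarith
  have "(\<Sum>j<n. ?Ri j j) - (\<Sum>j<n. ?R j j) = (\<Sum>j<n. of_real (c i) * (v j * cnj (v j)) / ?d)"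
    using ptw by (simp flip: sum_subtractf)
  also have "\<dots> = of_real (c i) * (\<Sum>j<n. v j * cnj (v j)) / ?d"
    by (simp add: sum_distrib_left sum_divide_distrib)
  also have "\<dots> = of_real (c i * V / (1 + c i * q))"
    by (simp add: q(1) V_def complex_norm_square[symmetric])
  finally have "cmod ((\<Sum>j<n. ?Ri j j) - (\<Sum>j<n. ?R j j)) = c i * V / (1 + c i * q)"
    using V c q0 by (simp only: norm_of_real) simp
  also have "\<dots> \<le> 1 / x"
  proof -
    have "c i * (x * V) \<le> c i * q" using q(2) c by (rule mult_left_mono)
    moreover have "0 \<le> c i * q" using c q0 by simp
    ultimately show ?thesis using assms(1) by (simp add: field_simps)
  qed
  finally show ?thesis .
qed

lemma trace_minv_bound:
  assumes "x > 0" "\<And>l. l < n \<Longrightarrow> c l \<ge> 0"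
  shows "cmod (\<Sum>j<n. minv n (reg_gram n x c F) j j) \<le> n / x"
proof -
  have co: "coercive n x (reg_gram n x c F)" using assms by (auto intro!: coercive_reg_gram)
  have "cmod (\<Sum>j<n. minv n (reg_gram n x c F) j j) \<le> (\<Sum>j<n. 1 / x)"
    using coercive_minv_entry_bound[OF co assms(1)] by (intro sum_norm_le) auto
  then show ?thesis by simp
qed

text \<open>This passes from the sample covariance, whose spectrum is prescribed, to the companion
  matrix, which is a sum over the rows of X. From Y R = S Y and cyclicity, n - x tr R = tr (Y^H Y R)
  = tr (Y^H S Y) = tr (S Y Y^H) = n - x tr S. Since Y is square, the traces agree without a
  correction for dimensions.\<close>

lemma trace_minv_adjoint:
  assumes "x > 0"
  shows "(\<Sum>j<n. minv n (reg_gram n x (\<lambda>_. 1) Y) j j) =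
         (\<Sum>j<n. minv n (reg_gram n x (\<lambda>_. 1) (\<lambda>i j. cnj (Y j i))) j j)"
proof -
  let ?A = "reg_gram n x (\<lambda>_. 1) Y" and ?B = "reg_gram n x (\<lambda>_. 1) (\<lambda>i j. cnj (Y j i))"
  define R where "R = minv n ?A"
  define S where "S = minv n ?B"
  have co: "coercive n x ?A" "coercive n x ?B" by (auto intro!: coercive_reg_gram)
  have dA: "Determinant.det (mat n n (\<lambda>(i, j). ?A i j)) \<noteq> 0" using coercive_det co assms by blast
  have dB: "Determinant.det (mat n n (\<lambda>(i, j). ?B i j)) \<noteq> 0" using coercive_det co assms by blast
  have A: "?A j k = (if j = k then of_real x else 0) + (\<Sum>l<n. cnj (Y l j) * Y l k)" for j k
    by (simp add: reg_gram_def)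
  have B: "?B j k = (if j = k then of_real x else 0) + (\<Sum>l<n. Y j l * cnj (Y k l))" for j k
    by (simp add: reg_gram_def)
  \<comment> \<open>Y R = S Y: each column of Y R solves the system with matrix \<open>?B\<close>
    and the corresponding column of Y on the right.\<close>
  have push: "(\<Sum>k<n. Y i k * R k j) = mat_app n S (\<lambda>k. Y k j) i" if i: "i < n" and j: "j < n" for i j
  proof (unfold S_def, rule mat_app_minv[OF co(2) assms(1) _ i, of "\<lambda>i. \<Sum>k<n. Y i k * R k j"])
    fix a assume a: "a < n"
    have "mat_app n ?B (\<lambda>i. \<Sum>k<n. Y i k * R k j) a =
      (\<Sum>b<n. (if b = a then of_real x * (\<Sum>k<n. Y a k * R k j) else 0)) +
      (\<Sum>b<n. \<Sum>l<n. Y a l * cnj (Y b l) * (\<Sum>k<n. Y b k * R k j))"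
      unfolding mat_app_def B sum.distrib[symmetric]
      by (intro sum.cong) (auto simp: distrib_right sum_distrib_right mult.assoc)
    also have "(\<Sum>b<n. \<Sum>l<n. Y a l * cnj (Y b l) * (\<Sum>k<n. Y b k * R k j)) =
      (\<Sum>l<n. Y a l * (\<Sum>k<n. (\<Sum>b<n. cnj (Y b l) * Y b k) * R k j))"
    proof -
      have "(\<Sum>b<n. \<Sum>l<n. Y a l * cnj (Y b l) * (\<Sum>k<n. Y b k * R k j)) =
        (\<Sum>l<n. \<Sum>b<n. \<Sum>k<n. Y a l * (cnj (Y b l) * Y b k * R k j))"
        by (subst sum.swap) (simp add: sum_distrib_left mult.assoc)
      also have "\<dots> = (\<Sum>l<n. \<Sum>k<n. \<Sum>b<n. Y a l * (cnj (Y b l) * Y b k * R k j))"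
        by (intro sum.cong refl sum.swap)
      finally show ?thesis by (simp add: sum_distrib_left sum_distrib_right)
    qed
    also have "(\<Sum>b<n. (if b = a then of_real x * (\<Sum>k<n. Y a k * R k j) else 0)) =
       (\<Sum>l<n. Y a l * (of_real x * R l j))"
      using a by (simp add: sum_distrib_left mult_ac)
    also have "(\<Sum>l<n. Y a l * (of_real x * R l j)) +
       (\<Sum>l<n. Y a l * (\<Sum>k<n. (\<Sum>b<n. cnj (Y b l) * Y b k) * R k j)) =
       (\<Sum>l<n. Y a l * (\<Sum>k<n. ?A l k * R k j))"
      unfolding sum.distrib[symmetric] distrib_left[symmetric]
    proof (intro sum.cong refl arg_cong2[where f = "(*)"])
      fix l assume "l \<in> {..<n}"
      then have "of_real x * R l j = (\<Sum>k<n. if l = k then of_real x * R k j else 0)" by simp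
      then show "of_real x * R l j + (\<Sum>k<n. (\<Sum>b<n. cnj (Y b l) * Y b k) * R k j) =
         (\<Sum>k<n. ?A l k * R k j)"
        unfolding A by (simp add: distrib_right sum.distrib if_distrib[of "\<lambda>z. z * _"] cong: if_cong)
    qed
    also have "\<dots> = (\<Sum>l<n. if l = j then Y a l else 0)"
      by (intro sum.cong) (auto simp: minv_right[OF dA _ j, folded R_def])
    finally show "mat_app n ?B (\<lambda>i. \<Sum>k<n. Y i k * R k j) a = Y a j" using j by simp
  qed
  have 1: "of_nat n = of_real x * (\<Sum>j<n. S j j) + (\<Sum>j<n. \<Sum>k<n. \<Sum>l<n. S j k * Y k l * cnj (Y j l))"
  proof -
    have "of_nat n = (\<Sum>j<n. \<Sum>k<n. S j k * ?B k j)"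
      by (simp add: minv_left[OF dB, folded S_def])
    also have "\<dots> = (\<Sum>j<n. \<Sum>k<n. (if k = j then of_real x * S j k else 0)) +
      (\<Sum>j<n. \<Sum>k<n. \<Sum>l<n. S j k * Y k l * cnj (Y j l))"
      unfolding sum.distrib[symmetric] B
      by (intro sum.cong) (auto simp: algebra_simps sum_distrib_left)
    finally show ?thesis by (simp add: sum_distrib_left)
  qed
  have 2: "of_nat n = of_real x * (\<Sum>j<n. R j j) + (\<Sum>j<n. \<Sum>k<n. \<Sum>l<n. cnj (Y l j) * Y l k * R k j)"
  proof -
    have "of_nat n = (\<Sum>j<n. \<Sum>k<n. ?A j k * R k j)"
      by (simp add: minv_right[OF dA, folded R_def])
    also have "\<dots> = (\<Sum>j<n. \<Sum>k<n. (if j = k then of_real x * R k j else 0)) +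
      (\<Sum>j<n. \<Sum>k<n. \<Sum>l<n. cnj (Y l j) * Y l k * R k j)"
      unfolding sum.distrib[symmetric] A
      by (intro sum.cong) (auto simp: distrib_right sum_distrib_right)
    finally show ?thesis by (simp add: sum_distrib_left)
  qed
  have "(\<Sum>j<n. \<Sum>k<n. \<Sum>l<n. cnj (Y l j) * Y l k * R k j) =
        (\<Sum>j<n. \<Sum>l<n. \<Sum>k<n. cnj (Y l j) * Y l k * R k j)"
    by (rule sum.cong[OF refl], rule sum.swap)
  also have "\<dots> = (\<Sum>j<n. \<Sum>l<n. cnj (Y l j) * (\<Sum>k<n. S l k * Y k j))"
    by (intro sum.cong refl) (simp add: push mat_app_def mult.assoc flip: sum_distrib_left)
  also have "\<dots> = (\<Sum>l<n. \<Sum>j<n. cnj (Y l j) * (\<Sum>k<n. S l k * Y k j))" by (rule sum.swap)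
  also have "\<dots> = (\<Sum>l<n. \<Sum>j<n. \<Sum>k<n. S l k * Y k j * cnj (Y l j))"
    by (intro sum.cong refl) (simp add: mult.commute[of "cnj _"] sum_distrib_right)
  also have "\<dots> = (\<Sum>l<n. \<Sum>k<n. \<Sum>j<n. S l k * Y k j * cnj (Y l j))"
    by (rule sum.cong[OF refl], rule sum.swap)
  finally have eq: "(\<Sum>j<n. \<Sum>k<n. \<Sum>l<n. cnj (Y l j) * Y l k * R k j) =
    (\<Sum>l<n. \<Sum>k<n. \<Sum>j<n. S l k * Y k j * cnj (Y l j))" .
  have "of_real x * (\<Sum>j<n. R j j) = of_real x * (\<Sum>j<n. S j j)"
    by (rule add_right_imp_eq[OF trans[OF 2[symmetric, unfolded eq] 1]])
  then show ?thesis using assms by (simp add: R_def S_def)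
qed

section \<open>Spectral distributions and resolvent traces\<close>

lemma poly_pderiv_linear_factors:
  assumes "y \<notin># S"
  shows "poly (pderiv (\<Prod>e\<in>#S. [:-e, 1:])) y =
    poly (\<Prod>e\<in>#S. [:-e, 1:]) y * (\<Sum>e\<in>#S. 1 / (y - e :: complex))"
  using assms
proof (induction S)
  case (add a S)
  then have "y \<noteq> a" by auto
  define q s where "q = poly (\<Prod>e\<in>#S. [:-e, 1:]) y" and "s = (\<Sum>e\<in>#S. 1 / (y - e))"
  have "poly (pderiv (\<Prod>e\<in>#S. [:-e, 1:])) y = q * s"
    using add by (simp add: q_def s_def)
  then have "poly (pderiv (\<Prod>e\<in>#add_mset a S. [:-e, 1:])) y = q + (y - a) * (q * s)"
    by (simp add: pderiv_mult pderiv_pCons q_def[symmetric] algebra_simps del: mult_pCons_left)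
  also have "\<dots> = ((y - a) * q) * (1 / (y - a) + s)"
    using \<open>y \<noteq> a\<close> by (simp add: distrib_left)
  finally show ?case
    by (simp add: q_def s_def algebra_simps)
qed simp

text \<open>Both sides are, up to sign, the logarithmic derivative of the characteristic polynomial
  at -x. Its derivative is the sum of the characteristic polynomials of the principal submatrices,
  whose values are up to sign the diagonal cofactors of \<open>B\<close>; the factorisation into
  linear factors gives the sum over the roots. This avoids diagonalising \<open>A\<close>.\<close>

lemma trace_minv_eq_sum_proots:
  assumes A: "A \<in> carrier_mat n n"
    and B: "\<And>i j. i < n \<Longrightarrow> j < n \<Longrightarrow> B i j = A $$ (i, j) + (if i = j then x else 0)"
    and x: "-x \<notin># proots (char_poly A)"
  shows "(\<Sum>j<n. minv n B j j) = (\<Sum>e\<in>#proots (char_poly A). 1 / (x + e))"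
proof -
  let ?p = "char_poly A" and ?B = "mat n n (\<lambda>(i, j). B i j)"
  have monic: "lead_coeff ?p = 1" "degree ?p = n" using degree_monic_char_poly[OF A] by auto
  have fac: "(\<Prod>e\<in>#proots ?p. [:-e, 1:]) = ?p"
    using complex_poly_decompose_multiset[of ?p] monic by simp
  have p0: "?p \<noteq> 0" using monic by auto
  have px: "poly ?p (-x) \<noteq> 0" using x p0 by (simp add: set_count_proots)
  have ev: "poly (char_poly C) (-x) = (-1) ^ m * Determinant.det (C + x \<cdot>\<^sub>m 1\<^sub>m m)"
    if C: "C \<in> carrier_mat m m" for C :: "complex mat" and m
  proof -
    have "- char_matrix C (-x) = (-1) \<cdot>\<^sub>m (C + x \<cdot>\<^sub>m 1\<^sub>m m)"
      using C by (intro eq_matI) (auto simp: char_matrix_def)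
    then show ?thesis using C by (simp add: char_poly_matrix[OF C])
  qed
  have Beq: "?B = A + x \<cdot>\<^sub>m 1\<^sub>m n" using A B by (intro eq_matI) auto
  have "poly (pderiv ?p) (-x) = (\<Sum>j<n. poly (char_poly (mat_delete A j j)) (-x))"
    by (simp add: pderiv_char_poly[OF A] poly_sum)
  also have "\<dots> = (\<Sum>j<n. (-1) ^ (n - 1) * cofactor ?B j j)"
  proof (intro sum.cong refl)
    fix j assume j: "j \<in> {..<n}"
    have C: "mat_delete A j j \<in> carrier_mat (n - 1) (n - 1)" using A by (intro carrier_matI) auto
    have "mat_delete A j j + x \<cdot>\<^sub>m 1\<^sub>m (n - 1) = mat_delete ?B j j"
      unfolding Beq using A j by (intro eq_matI) (auto simp: mat_delete_def)
    then show "poly (char_poly (mat_delete A j j)) (-x) = (-1) ^ (n - 1) * cofactor ?B j j"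
      by (simp add: ev[OF C] cofactor_def)
  qed
  finally have d: "poly (pderiv ?p) (-x) = (-1) ^ (n - 1) * (\<Sum>j<n. cofactor ?B j j)"
    by (simp add: sum_distrib_left)
  have pB: "poly ?p (-x) = (-1) ^ n * Determinant.det ?B"
    unfolding Beq by (rule ev[OF A])
  have "poly (pderiv ?p) (-x) = poly ?p (-x) * (\<Sum>e\<in>#proots ?p. 1 / (-x - e))"
    using poly_pderiv_linear_factors[OF x] unfolding fac .
  also have "(\<Sum>e\<in>#proots ?p. 1 / (-x - e)) = - (\<Sum>e\<in>#proots ?p. 1 / (x + e))"
  proof -
    have "1 / (-x - e) = - (1 / (x + e))" for e :: complex
      by (metis add.commute minus_add_distrib minus_divide_right uminus_add_conv_diff)
    then have "(\<Sum>e\<in>#M. 1 / (-x - e)) = - (\<Sum>e\<in>#M. 1 / (x + e))" for M :: "complex multiset"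
      by (induction M) simp_all
    then show ?thesis .
  qed
  finally have eq: "(-1) ^ (n - 1) * (\<Sum>j<n. cofactor ?B j j) =
    - ((-1) ^ n * Determinant.det ?B * (\<Sum>e\<in>#proots ?p. 1 / (x + e)))"
    using d pB by simp
  have detB: "Determinant.det ?B \<noteq> 0" using pB px by auto
  show ?thesis
  proof (cases n)
    case 0
    then have "proots ?p = {#}" using size_proots_complex[of ?p] monic by simp
    then show ?thesis using 0 by simp
  next
    case (Suc m)
    define C d s where "C = (\<Sum>j<n. cofactor ?B j j)" and "d = Determinant.det ?B"
      and "s = (\<Sum>e\<in>#proots ?p. 1 / (x + e))"
    have "(-1) ^ m * C = (-1) ^ m * (d * s)"
      using eq unfolding C_def[symmetric] d_def[symmetric] s_def[symmetric] by (simp add: Suc)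
    then have "C = d * s" by simp
    moreover have "d \<noteq> 0" using detB by (simp add: d_def)
    ultimately have "C / d = s" by simp
    then show ?thesis by (simp only: minv_def sum_divide_distrib[symmetric] C_def d_def s_def)
  qed
qed

lemma sum_mset_eq_sum_count:
  fixes f :: "'b \<Rightarrow> real"
  shows "(\<Sum>e\<in>#M. f e) = (\<Sum>e\<in>set_mset M. real (count M e) * f e)"
proof (induction M)
  case (add a M)
  have "(\<Sum>e\<in>insert a (set_mset M). real (count M e) * f e) = (\<Sum>e\<in>set_mset M. real (count M e) * f e)"
    by (intro sum.mono_neutral_right) (auto simp: not_in_iff)
  moreover have "(\<Sum>e\<in>insert a (set_mset M). real (count (add_mset a M) e) * f e) =
    (\<Sum>e\<in>insert a (set_mset M). real (count M e) * f e) +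
    (\<Sum>e\<in>insert a (set_mset M). if e = a then f e else 0)"
    unfolding sum.distrib[symmetric] by (intro sum.cong) (auto simp: algebra_simps)
  ultimately show ?case using add by simp
qed simp

lemma integral_esd:
  fixes f :: "real \<Rightarrow> real"
  assumes A: "A \<in> carrier_mat n n" and n: "n > 0" and f: "f \<in> borel_measurable borel"
  shows "integral\<^sup>L (esd A) f = (\<Sum>e\<in>#proots (char_poly A). f (Re e)) / n"
proof -
  let ?P = "proots (char_poly A)"
  have sz: "size ?P = n" using size_proots_complex degree_monic_char_poly[OF A] by metis
  then have ne: "?P \<noteq> {#}" using n by auto
  have "integral\<^sup>L (esd A) f = measure_pmf.expectation (pmf_of_multiset ?P) (\<lambda>e. f (Re e))"
    unfolding esd_def by (rule integral_distr) (use f in auto)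
  also have "\<dots> = (\<Sum>e\<in>set_mset ?P. pmf (pmf_of_multiset ?P) e *\<^sub>R f (Re e))"
    by (rule integral_measure_pmf) (use ne in auto)
  also have "\<dots> = (\<Sum>e\<in>set_mset ?P. real (count ?P e) * f (Re e)) / n"
    by (simp add: ne sz sum_divide_distrib)
  also have "(\<Sum>e\<in>set_mset ?P. real (count ?P e) * f (Re e)) = (\<Sum>e\<in>#?P. f (Re e))"
    by (simp add: sum_mset_eq_sum_count)
  finally show ?thesis .
qed

section \<open>Entries and eigenvalues of the sample covariance\<close>

lemma mat_adjoint_index:
  assumes "A \<in> carrier_mat n n" "i < n" "j < n"
  shows "mat_adjoint A $$ (i, j) = cnj (A $$ (j, i) :: complex)"
  using assms by (simp add: mat_adjoint_def mat_of_rows_index)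

lemma mat_adjoint_carrier:
  assumes "A \<in> carrier_mat n n"
  shows "mat_adjoint A \<in> carrier_mat n n"
  using assms by (auto simp: mat_adjoint_def)

lemma mat_mult_index:
  assumes "A \<in> carrier_mat n n" "B \<in> carrier_mat n n" "i < n" "j < n"
  shows "(A * B) $$ (i, j) = (\<Sum>k<n. A $$ (i, k) * B $$ (k, j))"
  using assms by (auto simp: scalar_prod_def atLeast0LessThan)

lemma nonneg_diagonal_index:
  assumes "nonneg_diagonal n L" "i < n" "j < n"
  shows "L $$ (i, j) = (if i = j then of_real (Re (L $$ (i, i))) else 0)"
  using assms by (auto simp: nonneg_diagonal_def diagonal_mat_def nonneg_Reals_def)

lemma sample_cov_carrier:
  assumes "nonneg_diagonal n L" "X \<in> carrier_mat n n"
  shows "sample_cov n L X \<in> carrier_mat n n"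
  using assms mat_adjoint_carrier[of X n] by (auto simp: sample_cov_def nonneg_diagonal_def)

lemma sample_cov_index:
  assumes L: "nonneg_diagonal n L" and X: "X \<in> carrier_mat n n" and ij: "i < n" "j < n"
  shows "sample_cov n L X $$ (i, j) =
    (\<Sum>k<n. of_real (Re (L $$ (i, i)) * Re (L $$ (j, j)) / n) * (X $$ (i, k) * cnj (X $$ (j, k))))"
proof -
  define l where "l i = Re (L $$ (i, i))" for i
  have Lc: "L \<in> carrier_mat n n" using L by (simp add: nonneg_diagonal_def)
  have Li: "L $$ (i, j) = (if i = j then of_real (l i) else 0)" if "i < n" "j < n" for i j
    using nonneg_diagonal_index[OF L that] by (simp add: l_def)
  note Xa = mat_adjoint_carrier[OF X]
  have c: "L * X \<in> carrier_mat n n" "L * X * mat_adjoint X \<in> carrier_mat n n"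
    using Lc X Xa by auto
  have LX: "(L * X) $$ (i, k) = of_real (l i) * X $$ (i, k)" if "k < n" for k
    using ij(1) that
    by (simp add: mat_mult_index[OF Lc X] Li if_distrib[of "\<lambda>z. z * _"] cong: if_cong)
  have M: "(L * X * mat_adjoint X) $$ (i, m) = (\<Sum>k<n. of_real (l i) * X $$ (i, k) * cnj (X $$ (m, k)))"
    if "m < n" for m
    using ij(1) that by (simp add: mat_mult_index[OF c(1) Xa] LX mat_adjoint_index[OF X])
  have "(L * X * mat_adjoint X * L) $$ (i, j) = (L * X * mat_adjoint X) $$ (i, j) * of_real (l j)"
    using ij by (simp add: mat_mult_index[OF c(2) Lc] Li if_distrib[of "\<lambda>z. _ * z"] cong: if_cong)
  also have "\<dots> = (\<Sum>k<n. of_real (l i * l j) * (X $$ (i, k) * cnj (X $$ (j, k))))"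
    by (simp only: M[OF ij(2)] sum_distrib_right) (simp add: mult_ac)
  finally show ?thesis
    using ij c Lc by (simp add: sample_cov_def l_def[symmetric] sum_divide_distrib del: index_mult_mat(1))
qed

text \<open>For an eigenvector v the quadratic form gives e |v|^2 = |G v|^2.\<close>

lemma gram_eigenvalue_nonneg:
  assumes A: "A \<in> carrier_mat n n"
    and G: "\<And>i j. i < n \<Longrightarrow> j < n \<Longrightarrow> A $$ (i, j) = reg_gram n 0 (\<lambda>_. 1) G i j"
    and e: "e \<in># proots (char_poly A)"
  shows "e = of_real (Re e)" "Re e \<ge> 0"
proof -
  have "char_poly A \<noteq> 0" using degree_monic_char_poly[OF A] by auto
  then have "eigenvalue A e"
    using e by (simp add: eigenvalue_root_char_poly[OF A] set_count_proots)
  then obtain w where w: "w \<in> carrier_vec n" "w \<noteq> 0\<^sub>v n" "A *\<^sub>v w = e \<cdot>\<^sub>v w"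
    using A by (auto simp: eigenvalue_def eigenvector_def)
  define v where "v = vec_index w"
  have Av: "mat_app n (reg_gram n 0 (\<lambda>_. 1) G) v i = e * v i" if "i < n" for i
    using arg_cong[OF w(3), of "\<lambda>u. vec_index u i"] that w(1) A
    by (simp add: mat_app_def scalar_prod_def atLeast0LessThan v_def G[symmetric])
  let ?N = "\<Sum>j<n. (cmod (v j))\<^sup>2" and ?M = "\<Sum>l<n. (cmod (row_form n G l v))\<^sup>2"
  have "(\<Sum>j<n. cnj (v j) * (e * v j)) = of_real ?M"
    using reg_gram_form[where n=n and v=v and x=0 and c="\<lambda>_. 1" and F=G] Av by simp
  moreover have "(\<Sum>j<n. cnj (v j) * (e * v j)) = e * of_real ?N"
    by (simp add: sum_distrib_left complex_norm_square[symmetric] mult_ac flip: of_real_power)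
  ultimately have eN: "e * of_real ?N = of_real ?M" by simp
  have "?N \<noteq> 0"
  proof
    assume "?N = 0"
    then have "\<forall>j<n. v j = 0" by (simp add: sum_nonneg_eq_0_iff)
    then have "w = 0\<^sub>v n" using w(1) by (intro eq_vecI) (auto simp: v_def)
    with w(2) show False by simp
  qed
  then have "complex_of_real ?N \<noteq> 0" by (simp only: of_real_eq_0_iff not_False_eq_True)
  then have "e = of_real ?M / of_real ?N" using eN by (metis nonzero_eq_divide_eq)
  then have e: "e = of_real (?M / ?N)" by (simp only: of_real_divide)
  then show "e = of_real (Re e)" by (metis Re_complex_of_real)
  have "Re e = ?M / ?N" using e by (metis Re_complex_of_real)
  then show "Re e \<ge> 0" by (simp add: sum_nonneg)
qed

lemma of_real_sum_mset:
  "of_real (\<Sum>e\<in>#M. f e) = (\<Sum>e\<in>#M. of_real (f e) :: 'c :: real_algebra_1)"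
  by (induction M) simp_all

text \<open>The absolute value makes the test function bounded and continuous on the whole line, as
  weak convergence requires, and changes nothing at the eigenvalues, which are nonnegative.\<close>

lemma integral_esd_sample_cov:
  assumes L: "nonneg_diagonal n L" and X: "X \<in> carrier_mat n n" and n: "n > 0" and x: "x > 0"
  shows "of_real (\<integral>t. 1 / (x + \<bar>t\<bar>) \<partial>esd (sample_cov n L X)) =
    (\<Sum>j<n. minv n (reg_gram n x (\<lambda>l. (Re (L $$ (l, l)))\<^sup>2 / n) (\<lambda>i j. X $$ (i, j))) j j) / of_nat n"
proof -
  define l where "l i = Re (L $$ (i, i))" for i
  define Y where "Y i j = of_real (l i / sqrt n) * X $$ (i, j)" for i j
  let ?A = "sample_cov n L X"
  \<comment> \<open>As \<open>?G\<close> is the adjoint of \<open>Y\<close>, its Gram matrix is Y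
    Y^H, the sample covariance; that of \<open>Y\<close> itself is the companion matrix.\<close>
  let ?G = "\<lambda>i j. cnj (Y j i)"
  note A = sample_cov_carrier[OF L X]
  have sq: "complex_of_real (sqrt (real n)) * complex_of_real (sqrt (real n)) = of_nat n"
    by (simp flip: of_real_mult)
  have G: "?A $$ (i, j) = reg_gram n 0 (\<lambda>_. 1) ?G i j" if "i < n" "j < n" for i j
    using that by (simp add: sample_cov_index[OF L X] reg_gram_def Y_def l_def mult_ac sq flip: times_divide_times_eq)
  have Gx: "reg_gram n x (\<lambda>_. 1) ?G i j = ?A $$ (i, j) + (if i = j then of_real x else 0)"
    if "i < n" "j < n" for i j
    using G[OF that] by (simp add: reg_gram_def)
  note ev = gram_eigenvalue_nonneg[OF A G]
  have nx: "- of_real x \<notin># proots (char_poly ?A)"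
  proof
    assume "- of_real x \<in># proots (char_poly ?A)"
    from ev(2)[OF _ _ this] x show False by simp
  qed
  have Yg: "reg_gram n x (\<lambda>_. 1) Y = reg_gram n x (\<lambda>l. (Re (L $$ (l, l)))\<^sup>2 / n) (\<lambda>i j. X $$ (i, j))"
    by (intro ext) (simp add: reg_gram_def Y_def l_def power2_eq_square mult_ac sq)
  have int: "(\<integral>t. 1 / (x + \<bar>t\<bar>) \<partial>esd ?A) = (\<Sum>e\<in>#proots (char_poly ?A). 1 / (x + \<bar>Re e\<bar>)) / n"
    by (rule integral_esd[OF A n]) simp
  have "of_real (\<integral>t. 1 / (x + \<bar>t\<bar>) \<partial>esd ?A) =
     (\<Sum>e\<in>#proots (char_poly ?A). complex_of_real (1 / (x + \<bar>Re e\<bar>))) / of_nat n"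
    unfolding int of_real_divide[of _ "real n"] of_real_sum_mset of_real_of_nat_eq by (rule refl)
  also have "(\<Sum>e\<in>#proots (char_poly ?A). complex_of_real (1 / (x + \<bar>Re e\<bar>))) =
     (\<Sum>e\<in>#proots (char_poly ?A). 1 / (of_real x + e))"
  proof (intro arg_cong[of _ _ sum_mset] image_mset_cong)
    fix e assume e: "e \<in># proots (char_poly ?A)"
    have "complex_of_real (1 / (x + \<bar>Re e\<bar>)) = 1 / (of_real x + of_real (Re e))"
      using ev(2)[OF _ _ e] by simp
    then show "complex_of_real (1 / (x + \<bar>Re e\<bar>)) = 1 / (of_real x + e)"
      using ev(1)[OF _ _ e] by simp
  qed
  also have "\<dots> = (\<Sum>j<n. minv n (reg_gram n x (\<lambda>_. 1) ?G) j j)"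
    by (rule trace_minv_eq_sum_proots[OF A Gx nx, symmetric])
  also have "\<dots> = (\<Sum>j<n. minv n (reg_gram n x (\<lambda>_. 1) Y) j j)"
    by (rule trace_minv_adjoint[OF x, symmetric])
  finally show ?thesis unfolding Yg .
qed

lemma integral_esd_diagonal:
  fixes f :: "real \<Rightarrow> real"
  assumes L: "nonneg_diagonal n L" and n: "n > 0" and f: "f \<in> borel_measurable borel"
  shows "integral\<^sup>L (esd (L * L)) f = (\<Sum>i<n. f ((Re (L $$ (i, i)))\<^sup>2)) / n"
proof -
  have Lc: "L \<in> carrier_mat n n" using L by (simp add: nonneg_diagonal_def)
  have LL: "L * L \<in> carrier_mat n n" using Lc by simp
  define l where "l i = Re (L $$ (i, i))" for i
  have Li: "L $$ (i, j) = (if i = j then of_real (l i) else 0)" if "i < n" "j < n" for i j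
    using nonneg_diagonal_index[OF L that] by (simp add: l_def)
  have LLi: "(L * L) $$ (i, j) = (if i = j then of_real ((l i)\<^sup>2) else 0)" if "i < n" "j < n" for i j
    using that by (simp add: mat_mult_index[OF Lc Lc] Li power2_eq_square
        if_distrib[of "\<lambda>z. z * _"] cong: if_cong)
  have ut: "upper_triangular (L * L)"
    using Lc by (intro upper_triangularI) (auto simp: LLi simp del: index_mult_mat(1))
  have "char_poly (L * L) = (\<Prod>a\<leftarrow>diag_mat (L * L). [:-a, 1:])"
    by (rule char_poly_upper_triangular[OF LL ut])
  also have "diag_mat (L * L) = map (\<lambda>i. of_real ((l i)\<^sup>2)) [0..<n]"
    using Lc by (auto simp: diag_mat_def LLi simp del: index_mult_mat(1))
  finally have cp: "char_poly (L * L) = (\<Prod>i<n. [:- of_real ((l i)\<^sup>2), 1:])"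
    using prod.distinct_set_conv_list[of "[0..<n]" "\<lambda>i. [:- complex_of_real ((l i)\<^sup>2), 1:]"]
    by (simp add: comp_def atLeast0LessThan del: of_real_power)
  have "proots (char_poly (L * L)) = (\<Sum>i<n. {#of_real ((l i)\<^sup>2)#})"
    unfolding cp by (subst proots_prod) (auto simp: proots_linear_factor simp del: of_real_power)
  moreover have "(\<Sum>e\<in>#(\<Sum>i\<in>I. {#g i#}). h e) = (\<Sum>i\<in>I. h (g i))"
    if "finite I" for I :: "nat set" and g :: "nat \<Rightarrow> complex" and h :: "complex \<Rightarrow> real"
    using that by induction auto
  ultimately show ?thesis
    by (simp add: integral_esd[OF LL n f] l_def del: of_real_power)
qed

section \<open>Moments of the complex Gaussian law\<close>

text \<open>"Half" refers to the variance 1/2; this is not the law of the absolute value of a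
  Gaussian.\<close>

definition half_normal :: "real measure" where
  "half_normal = density lborel (\<lambda>x. ennreal (normal_density 0 (1 / sqrt 2) x))"

lemma half_normal_prob: "prob_space half_normal"
  unfolding half_normal_def by (rule prob_space_normal_density) simp

lemma half_normal_sets [simp, measurable_cong]: "sets half_normal = sets borel" "space half_normal = UNIV"
  by (simp_all add: half_normal_def)

lemma half_normal_uminus: "distr half_normal borel uminus = half_normal"
proof -
  have "distr half_normal borel uminus =
     distr (density (distr lborel borel uminus) (\<lambda>x. ennreal (normal_density 0 (1 / sqrt 2) x))) borel uminus"
    by (simp add: half_normal_def lborel_distr_uminus)
  also have "\<dots> = distr (distr (density lborel (\<lambda>x. ennreal (normal_density 0 (1 / sqrt 2) (-x)))) borel uminus) borel uminus"
    by (subst density_distr) auto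
  also have "\<dots> = density lborel (\<lambda>x. ennreal (normal_density 0 (1 / sqrt 2) (-x)))"
    by (subst distr_distr) (auto simp: comp_def intro!: distr_cong[THEN trans, OF refl _ _ distr_id2])
  finally show ?thesis by (simp add: half_normal_def normal_density_def)
qed

lemma half_normal_integrable: "integrable half_normal (\<lambda>x. x ^ k)"
  unfolding half_normal_def
  using integrable_normal_moment[of "1 / sqrt 2" 0 k]
  by (subst integrable_density) auto

lemma half_normal_moments:
  "(\<integral>x. x\<^sup>2 \<partial>half_normal) = 1 / 2" "(\<integral>x. x ^ 4 \<partial>half_normal) = 3 / 4"
proof -
  have "(\<integral>x. x ^ (2 * k) \<partial>half_normal) = fact (2 * k) / (4 ^ k * fact k)" for k
    unfolding half_normal_def
    using integral_normal_moment_even[of "1 / sqrt 2" 0 k]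
    by (subst integral_density) (auto simp: power_divide)
  from this[of 1] this[of 2] show "(\<integral>x. x\<^sup>2 \<partial>half_normal) = 1 / 2" "(\<integral>x. x ^ 4 \<partial>half_normal) = 3 / 4"
    by (simp_all add: fact_numeral)
qed

lemma std_complex_gaussian_eq:
  "std_complex_gaussian = distr (half_normal \<Otimes>\<^sub>M half_normal) borel (\<lambda>(x, y). Complex x y)"
  by (simp add: std_complex_gaussian_def half_normal_def Let_def)

lemma Complex_measurable [measurable]:
  assumes "f \<in> borel_measurable M" "g \<in> borel_measurable M"
  shows "(\<lambda>x. Complex (f x) (g x)) \<in> borel_measurable M"
  unfolding Complex_eq using assms by measurable

lemma cnj_measurable [measurable]:
  assumes "f \<in> borel_measurable M"
  shows "(\<lambda>x. cnj (f x)) \<in> borel_measurable M"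
proof -
  have "cnj \<in> borel_measurable borel"
    by (intro borel_measurable_continuous_onI continuous_intros)
  from measurable_compose[OF assms this] show ?thesis .
qed

lemma prob_space_std_complex_gaussian: "prob_space std_complex_gaussian"
proof -
  interpret pair_prob_space half_normal half_normal
    by (simp add: pair_prob_space_def pair_sigma_finite_def half_normal_prob prob_space_imp_sigma_finite)
  show ?thesis unfolding std_complex_gaussian_eq by (rule prob_space_distr) measurable
qed

lemma sets_std_complex_gaussian [simp, measurable_cong]:
  "sets std_complex_gaussian = sets borel" "space std_complex_gaussian = UNIV"
  by (simp_all add: std_complex_gaussian_eq)

lemma std_complex_gaussian_moments:
  "integrable std_complex_gaussian (\<lambda>z. (cmod z) ^ 4)"
  "(\<integral>z. (cmod z) ^ 4 \<partial>std_complex_gaussian) = 2"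
  "(\<integral>z. (cmod z) ^ 2 \<partial>std_complex_gaussian) = 1"
proof -
  interpret h: prob_space half_normal by (rule half_normal_prob)
  interpret pair_sigma_finite half_normal half_normal
    by (simp add: pair_sigma_finite_def half_normal_prob prob_space_imp_sigma_finite)
  have i: "integrable (half_normal \<Otimes>\<^sub>M half_normal) (\<lambda>p. fst p ^ a * snd p ^ b)" for a b :: nat
    by (rule Fubini_integrable)
      (auto simp: abs_mult power_abs half_normal_integrable intro!: integrable_mult_right integrable_mult_left
        integrable_abs[OF half_normal_integrable, unfolded power_abs])
  have e: "(\<integral>p. fst p ^ a * snd p ^ b \<partial>(half_normal \<Otimes>\<^sub>M half_normal)) =
     (\<integral>x. x ^ a \<partial>half_normal) * (\<integral>x. x ^ b \<partial>half_normal)" for a b :: nat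
    using i by (subst integral_fst'[symmetric]) (auto simp: case_prod_beta)
  have c4: "(cmod (Complex x y)) ^ 4 = x ^ 4 + 2 * (x\<^sup>2 * y\<^sup>2) + y ^ 4" for x y
  proof -
    have "(cmod (Complex x y)) ^ 4 = ((cmod (Complex x y))\<^sup>2)\<^sup>2" by simp
    also have "\<dots> = (x\<^sup>2 + y\<^sup>2)\<^sup>2" by (simp only: cmod_power2 complex.sel)
    finally show ?thesis by (simp add: power2_sum power_mult_distrib)
  qed
  have c2: "(cmod (Complex x y)) ^ 2 = x\<^sup>2 + y\<^sup>2" for x y
    by (simp add: cmod_power2)
  have h1: "measure half_normal UNIV = 1" using h.prob_space by simp
  note ints = i[of 4 0, simplified] i[of 0 4, simplified] i[of 2 2] i[of 2 0, simplified] i[of 0 2, simplified]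
  note vals = e[of 4 0, simplified] e[of 0 4, simplified] e[of 2 2] e[of 2 0, simplified] e[of 0 2, simplified]
  have int4: "integrable (half_normal \<Otimes>\<^sub>M half_normal)
      (\<lambda>p. fst p ^ 4 + 2 * ((fst p)\<^sup>2 * (snd p)\<^sup>2) + snd p ^ 4)"
    by (intro Bochner_Integration.integrable_add integrable_mult_right ints)
  show "integrable std_complex_gaussian (\<lambda>z. (cmod z) ^ 4)"
    unfolding std_complex_gaussian_eq
    by (subst integrable_distr_eq) (auto simp: case_prod_beta c4 int4)
  show "(\<integral>z. (cmod z) ^ 4 \<partial>std_complex_gaussian) = 2"
    unfolding std_complex_gaussian_eq
    by (subst integral_distr) (auto simp: case_prod_beta c4 ints vals half_normal_moments h1)
  show "(\<integral>z. (cmod z) ^ 2 \<partial>std_complex_gaussian) = 1"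
    unfolding std_complex_gaussian_eq
    by (subst integral_distr) (auto simp: case_prod_beta c2 ints vals half_normal_moments h1)
qed

text \<open>On pairs the map is (x, y) -> (-y, x), a swap of the coordinates combined with a
  reflection; each preserves the product law.\<close>

lemma std_complex_gaussian_rotate: "distr std_complex_gaussian borel (\<lambda>z. \<i> * z) = std_complex_gaussian"
proof -
  interpret pair_sigma_finite half_normal half_normal
    by (simp add: pair_sigma_finite_def half_normal_prob prob_space_imp_sigma_finite)
  have idd: "distr half_normal borel id = half_normal" by (simp add: id_def distr_id2)
  have "distr std_complex_gaussian borel (\<lambda>z. \<i> * z) =
    distr (half_normal \<Otimes>\<^sub>M half_normal) borel (\<lambda>(x, y). Complex (-y) x)"
    unfolding std_complex_gaussian_eq
    by (subst distr_distr) (auto intro!: distr_cong simp: complex_eq_iff)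
  also have "\<dots> = distr (distr (half_normal \<Otimes>\<^sub>M half_normal) (half_normal \<Otimes>\<^sub>M half_normal) (\<lambda>(x, y). (y, x))) borel
      (\<lambda>(x, y). Complex (-y) x)"
    by (subst distr_pair_swap[symmetric]) simp
  also have "\<dots> = distr (half_normal \<Otimes>\<^sub>M half_normal) borel (\<lambda>(x, y). Complex (-x) y)"
    by (subst distr_distr) (auto intro!: distr_cong)
  also have "\<dots> = distr (distr half_normal borel uminus \<Otimes>\<^sub>M distr half_normal borel id) borel (\<lambda>(x, y). Complex x y)"
    by (subst pair_measure_distr) (auto simp: half_normal_uminus idd half_normal_prob prob_space_imp_sigma_finite
        distr_id2 distr_distr intro!: distr_cong)
  finally show ?thesis
    by (simp add: half_normal_uminus std_complex_gaussian_eq id_def distr_id2)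
qed

definition gaussian_moment :: "nat \<Rightarrow> nat \<Rightarrow> complex" where
  "gaussian_moment p q = (\<integral>z. z ^ p * cnj z ^ q \<partial>std_complex_gaussian)"

lemma std_complex_gaussian_integrable:
  assumes "p + q \<le> 4"
  shows "integrable std_complex_gaussian (\<lambda>z. z ^ p * cnj z ^ q)"
proof -
  interpret prob_space std_complex_gaussian by (rule prob_space_std_complex_gaussian)
  show ?thesis
  proof (rule Bochner_Integration.integrable_bound)
    show "integrable std_complex_gaussian (\<lambda>z. 1 + (cmod z) ^ 4)"
      using std_complex_gaussian_moments(1) by simp
    show "AE z in std_complex_gaussian. norm (z ^ p * cnj z ^ q) \<le> norm (1 + (cmod z) ^ 4)"
    proof (rule AE_I2)
      fix z :: complex
      have "(cmod z) ^ (p + q) \<le> 1 + (cmod z) ^ 4"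
      proof (cases "cmod z \<le> 1")
        case True
        then have "(cmod z) ^ (p + q) \<le> 1" by (simp add: power_le_one)
        then show ?thesis by (simp add: add_increasing2)
      next
        case False
        then have "(cmod z) ^ (p + q) \<le> (cmod z) ^ 4" using assms by (intro power_increasing) auto
        then show ?thesis by simp
      qed
      then show "norm (z ^ p * cnj z ^ q) \<le> norm (1 + (cmod z) ^ 4)"
        by (simp add: norm_mult norm_power power_add)
    qed
  qed measurable
qed

text \<open>The factor equals i^(p - q), so the moment vanishes unless 4 divides p - q. For
  exponents up to 2, all that the variance computation meets, this leaves only p = q.\<close>

lemma gaussian_moment_rotate: "gaussian_moment p q = \<i> ^ p * (-\<i>) ^ q * gaussian_moment p q"
proof -
  have "gaussian_moment p q = (\<integral>z. z ^ p * cnj z ^ q \<partial>distr std_complex_gaussian borel (\<lambda>z. \<i> * z))"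
    by (simp add: gaussian_moment_def std_complex_gaussian_rotate)
  also have "\<dots> = (\<integral>z. (\<i> ^ p * (-\<i>) ^ q) * (z ^ p * cnj z ^ q) \<partial>std_complex_gaussian)"
    by (subst integral_distr, measurable, intro Bochner_Integration.integral_cong refl)
      (simp add: power_mult_distrib[of "\<i>"] power_mult_distrib[of "-\<i>", simplified])
  finally show ?thesis by (simp add: gaussian_moment_def)
qed

lemma gaussian_moment_values:
  "gaussian_moment 0 0 = 1" "gaussian_moment 1 1 = 1" "gaussian_moment 2 2 = 2"
  "gaussian_moment 1 0 = 0" "gaussian_moment 0 1 = 0" "gaussian_moment 2 0 = 0" "gaussian_moment 0 2 = 0"
  "gaussian_moment 2 1 = 0" "gaussian_moment 1 2 = 0"
proof -
  interpret prob_space std_complex_gaussian by (rule prob_space_std_complex_gaussian)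
  show "gaussian_moment 0 0 = 1" using prob_space by (simp add: gaussian_moment_def)
  have 1: "z * cnj z = of_real ((cmod z)\<^sup>2)" for z by (rule complex_norm_square[symmetric])
  have 2: "z\<^sup>2 * (cnj z)\<^sup>2 = of_real ((cmod z) ^ 4)" for z
  proof -
    have "z\<^sup>2 * (cnj z)\<^sup>2 = (z * cnj z)\<^sup>2" by (simp add: power_mult_distrib)
    then show ?thesis unfolding 1 by simp
  qed
  show "gaussian_moment 1 1 = 1" using std_complex_gaussian_moments(3)
    by (simp add: gaussian_moment_def 1 del: of_real_power)
  show "gaussian_moment 2 2 = 2" using std_complex_gaussian_moments(2)
    by (simp add: gaussian_moment_def 2 del: of_real_power)
  have z: "gaussian_moment p q = 0" if "\<i> ^ p * (-\<i>) ^ q \<noteq> 1" for p q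
    using gaussian_moment_rotate[of p q] that by (metis mult_cancel_right1)
  show "gaussian_moment 1 0 = 0" "gaussian_moment 0 1 = 0" "gaussian_moment 2 0 = 0" "gaussian_moment 0 2 = 0"
    "gaussian_moment 2 1 = 0" "gaussian_moment 1 2 = 0"
    by (rule z, simp add: complex_eq_iff power2_eq_square)+
qed

section \<open>Variance of quadratic forms\<close>

lemma gaussian_moment_eq_0:
  assumes "p \<le> 2" "q \<le> 2" "p \<noteq> q"
  shows "gaussian_moment p q = 0"
proof -
  have "p \<in> {0, 1, 2}" "q \<in> {0, 1, 2}" using assms by auto
  then show ?thesis using assms(3) gaussian_moment_values by auto
qed

lemma gaussian_moment_eq_1: "p = q \<Longrightarrow> p \<le> 1 \<Longrightarrow> gaussian_moment p q = 1"
  using gaussian_moment_values by (cases p) auto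

context prob_space begin

context
  fixes I :: "'i set" and Z :: "'i \<Rightarrow> 'a \<Rightarrow> complex"
  assumes fin: "finite I" and ind: "indep_vars (\<lambda>_. borel) Z I"
    and law: "\<And>l. l \<in> I \<Longrightarrow> distr M borel (Z l) = std_complex_gaussian"
begin

lemma gaussian_measurable: "l \<in> I \<Longrightarrow> Z l \<in> borel_measurable M"
  using ind by (auto simp: indep_vars_def)

text \<open>Writing a monomial as a product over the whole index set, with exponents counting how
  often an index occurs, handles coincidences among the indices without a case distinction:
  independence always factorises it in the same way.\<close>

lemma gaussian_moments_prod:
  assumes pq: "\<And>l. l \<in> I \<Longrightarrow> p l + q l \<le> 4"
  shows "integrable M (\<lambda>\<omega>. \<Prod>l\<in>I. Z l \<omega> ^ p l * cnj (Z l \<omega>) ^ q l)"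
    and "expectation (\<lambda>\<omega>. \<Prod>l\<in>I. Z l \<omega> ^ p l * cnj (Z l \<omega>) ^ q l) = (\<Prod>l\<in>I. gaussian_moment (p l) (q l))"
proof -
  have ind': "indep_vars (\<lambda>_. borel) (\<lambda>l \<omega>. Z l \<omega> ^ p l * cnj (Z l \<omega>) ^ q l) I"
    by (rule indep_vars_compose2[OF ind]) measurable
  have int: "integrable M (\<lambda>\<omega>. Z l \<omega> ^ p l * cnj (Z l \<omega>) ^ q l)" if "l \<in> I" for l
    using std_complex_gaussian_integrable[OF pq[OF that]] gaussian_measurable[OF that]
    unfolding law[OF that, symmetric] by (subst (asm) integrable_distr_eq) auto
  have ex: "expectation (\<lambda>\<omega>. Z l \<omega> ^ p l * cnj (Z l \<omega>) ^ q l) = gaussian_moment (p l) (q l)" if "l \<in> I" for l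
    unfolding gaussian_moment_def law[OF that, symmetric] using gaussian_measurable[OF that]
    by (subst integral_distr) auto
  show "integrable M (\<lambda>\<omega>. \<Prod>l\<in>I. Z l \<omega> ^ p l * cnj (Z l \<omega>) ^ q l)"
    by (rule indep_vars_integrable[OF fin ind' int])
  show "expectation (\<lambda>\<omega>. \<Prod>l\<in>I. Z l \<omega> ^ p l * cnj (Z l \<omega>) ^ q l) = (\<Prod>l\<in>I. gaussian_moment (p l) (q l))"
    by (subst indep_vars_lebesgue_integral[OF fin ind' int]) (simp_all add: ex)
qed

lemma prod_power_delta:
  assumes "a \<in> I"
  shows "(\<Prod>l\<in>I. f l ^ of_bool (a = l)) = (f a :: complex)"
proof -
  have "(\<Prod>l\<in>I. f l ^ of_bool (a = l)) = (\<Prod>l\<in>I. if a = l then f l else 1)"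
    by (intro prod.cong) auto
  then show ?thesis using assms fin by simp
qed

lemma gaussian_second_moment:
  assumes "a \<in> I" "b \<in> I"
  shows "integrable M (\<lambda>\<omega>. Z a \<omega> * cnj (Z b \<omega>))"
    and "expectation (\<lambda>\<omega>. Z a \<omega> * cnj (Z b \<omega>)) = of_bool (a = b)"
proof -
  let ?p = "\<lambda>l. of_bool (a = l) :: nat" and ?q = "\<lambda>l. of_bool (b = l) :: nat"
  have eq: "(\<lambda>\<omega>. \<Prod>l\<in>I. Z l \<omega> ^ ?p l * cnj (Z l \<omega>) ^ ?q l) = (\<lambda>\<omega>. Z a \<omega> * cnj (Z b \<omega>))"
    using assms by (simp add: prod.distrib prod_power_delta)
  note m = gaussian_moments_prod[of ?p ?q, unfolded eq]
  show "integrable M (\<lambda>\<omega>. Z a \<omega> * cnj (Z b \<omega>))" by (rule m(1)) (auto simp: of_bool_def)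
  have "expectation (\<lambda>\<omega>. Z a \<omega> * cnj (Z b \<omega>)) = (\<Prod>l\<in>I. gaussian_moment (?p l) (?q l))"
    by (rule m(2)) (auto simp: of_bool_def)
  also have "\<dots> = of_bool (a = b)"
  proof (cases "a = b")
    case True
    have "gaussian_moment (?p l) (?q l) = 1" for l using True gaussian_moment_values by (cases "b = l") auto
    then show ?thesis using True by simp
  next
    case False
    then have "gaussian_moment (?p a) (?q a) = 0" using gaussian_moment_values by auto
    then have "(\<Prod>l\<in>I. gaussian_moment (?p l) (?q l)) = 0"
      by (intro prod_zero[OF fin] bexI[OF _ assms(1)])
    then show ?thesis using False by simp
  qed
  finally show "expectation (\<lambda>\<omega>. Z a \<omega> * cnj (Z b \<omega>)) = of_bool (a = b)" .
qed

text \<open>Wick's formula: the two unconjugated factors a, d are paired with the two conjugated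
  ones b, c. If the exponents differ at some index, its factor vanishes by rotation and no pairing
  exists.\<close>

lemma gaussian_fourth_moment:
  assumes abcd: "a \<in> I" "b \<in> I" "c \<in> I" "d \<in> I"
  shows "integrable M (\<lambda>\<omega>. Z a \<omega> * cnj (Z b \<omega>) * (cnj (Z c \<omega>) * Z d \<omega>))"
    and "expectation (\<lambda>\<omega>. Z a \<omega> * cnj (Z b \<omega>) * (cnj (Z c \<omega>) * Z d \<omega>)) =
      of_bool (a = b \<and> c = d) + of_bool (a = c \<and> b = d)"
proof -
  let ?p = "\<lambda>l. of_bool (a = l) + of_bool (d = l) :: nat"
  let ?q = "\<lambda>l. of_bool (b = l) + of_bool (c = l) :: nat"
  have eq: "(\<lambda>\<omega>. \<Prod>l\<in>I. Z l \<omega> ^ ?p l * cnj (Z l \<omega>) ^ ?q l) =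
      (\<lambda>\<omega>. Z a \<omega> * cnj (Z b \<omega>) * (cnj (Z c \<omega>) * Z d \<omega>))"
    using abcd by (simp add: prod.distrib prod_power_delta power_add mult_ac)
  note m = gaussian_moments_prod[of ?p ?q, unfolded eq]
  show "integrable M (\<lambda>\<omega>. Z a \<omega> * cnj (Z b \<omega>) * (cnj (Z c \<omega>) * Z d \<omega>))"
    by (rule m(1)) (auto simp: of_bool_def)
  have "expectation (\<lambda>\<omega>. Z a \<omega> * cnj (Z b \<omega>) * (cnj (Z c \<omega>) * Z d \<omega>)) =
     (\<Prod>l\<in>I. gaussian_moment (?p l) (?q l))"
    by (rule m(2)) (auto simp: of_bool_def)
  also have "\<dots> = of_bool (a = b \<and> c = d) + of_bool (a = c \<and> b = d)"
  proof (cases "\<exists>l\<in>I. ?p l \<noteq> ?q l")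
    case True
    then obtain l where l: "l \<in> I" "?p l \<noteq> ?q l" by blast
    have "gaussian_moment (?p l) (?q l) = 0"
      by (rule gaussian_moment_eq_0) (use l(2) in \<open>auto simp: of_bool_def\<close>)
    then have "(\<Prod>l\<in>I. gaussian_moment (?p l) (?q l)) = 0" by (intro prod_zero[OF fin] bexI[OF _ l(1)])
    moreover have "\<not> (a = b \<and> c = d)" "\<not> (a = c \<and> b = d)"
      using l(2) by auto
    ultimately show ?thesis by simp
  next
    case False
    then have pq: "?p l = ?q l" if "l \<in> I" for l using that by blast
    show ?thesis
    \<comment> \<open>If a = d, all four indices coincide and both pairings count, matching the
      fourth absolute moment 2. If they differ, every exponent is at most 1 and exactly one pairing
      is possible.\<close>
    proof (cases "a = d")
      case True
      then have bc: "b = a" "c = a" using pq[OF abcd(1)] by (auto simp: of_bool_def split: if_splits)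
      have "(\<Prod>l\<in>I. gaussian_moment (?p l) (?q l)) = (\<Prod>l\<in>I. if a = l then 2 else 1)"
        using True bc gaussian_moment_values by (intro prod.cong) (auto simp: numeral_2_eq_2)
      then show ?thesis using True bc fin abcd(1) by simp
    next
      case ad: False
      have one: "gaussian_moment (?p l) (?q l) = 1" if "l \<in> I" for l
        by (rule gaussian_moment_eq_1[OF pq[OF that]]) (use ad in auto)
      have "(a = b \<and> c = d) \<noteq> (a = c \<and> b = d)"
      proof -
        have "(b = a) \<noteq> (c = a)"
          using pq[OF abcd(1)] ad ad[symmetric] by (cases "b = a"; cases "c = a") simp_all
        moreover have "(b = d) \<noteq> (c = d)"
          using pq[OF abcd(4)] ad ad[symmetric] by (cases "b = d"; cases "c = d") simp_all
        ultimately show ?thesis using ad by metis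
      qed
      then have "of_bool (a = b \<and> c = d) + of_bool (a = c \<and> b = d) = (1 :: complex)"
        by (cases "a = b \<and> c = d") auto
      moreover have "(\<Prod>l\<in>I. gaussian_moment (?p l) (?q l)) = 1"
      proof (rule prod.neutral, rule ballI)
        fix l assume "l \<in> I"
        then show "gaussian_moment (?p l) (?q l) = 1" by (rule one)
      qed
      ultimately show ?thesis by (simp only:)
    qed
  qed
  finally show "expectation (\<lambda>\<omega>. Z a \<omega> * cnj (Z b \<omega>) * (cnj (Z c \<omega>) * Z d \<omega>)) =
      of_bool (a = b \<and> c = d) + of_bool (a = c \<and> b = d)" .
qed

text \<open>Centring cancels the first pairing in Wick's formula, and the second one is
  orthonormality. On the diagonal this says that |Z|^2 - 1 has variance 2 - 1 = 1, the same as the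
  products with distinct indices.\<close>

lemma gaussian_quadratic_orthonormal:
  assumes abcd: "a \<in> I" "b \<in> I" "c \<in> I" "d \<in> I"
  defines "\<xi> \<equiv> \<lambda>j k \<omega>. Z j \<omega> * cnj (Z k \<omega>) - of_bool (j = k)"
  shows "integrable M (\<lambda>\<omega>. \<xi> a b \<omega> * cnj (\<xi> c d \<omega>))"
    and "expectation (\<lambda>\<omega>. \<xi> a b \<omega> * cnj (\<xi> c d \<omega>)) = of_bool (a = c \<and> b = d)"
proof -
  have eq: "(\<lambda>\<omega>. \<xi> a b \<omega> * cnj (\<xi> c d \<omega>)) =
    (\<lambda>\<omega>. Z a \<omega> * cnj (Z b \<omega>) * (cnj (Z c \<omega>) * Z d \<omega>) - of_bool (c = d) * (Z a \<omega> * cnj (Z b \<omega>))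
      - of_bool (a = b) * (Z d \<omega> * cnj (Z c \<omega>)) + of_bool (a = b) * of_bool (c = d))"
    by (auto simp: \<xi>_def algebra_simps of_bool_def)
  note i = gaussian_fourth_moment[OF abcd] gaussian_second_moment[OF abcd(1,2)] gaussian_second_moment[OF abcd(4,3)]
  show "integrable M (\<lambda>\<omega>. \<xi> a b \<omega> * cnj (\<xi> c d \<omega>))"
    unfolding eq using i by auto
  show "expectation (\<lambda>\<omega>. \<xi> a b \<omega> * cnj (\<xi> c d \<omega>)) = of_bool (a = c \<and> b = d)"
    unfolding eq using i by (auto simp: prob_space of_bool_def)
qed

end

text \<open>Expand |Q|^2 as a fourfold sum. Independence splits each expectation, and orthonormality
  leaves the terms with (c, d) = (a, b), so the result is the mean squared Hilbert-Schmidt norm of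
  H. Independence is stated for exactly the products that this expansion produces, and
  \<open>K\<close> makes them integrable.\<close>

lemma quadratic_form_variance:
  fixes Z :: "nat \<Rightarrow> 'a \<Rightarrow> complex" and H :: "nat \<Rightarrow> nat \<Rightarrow> 'a \<Rightarrow> complex"
  assumes ind: "indep_vars (\<lambda>_. borel) Z {..<n}"
    and law: "\<And>l. l < n \<Longrightarrow> distr M borel (Z l) = std_complex_gaussian"
    and HZ: "\<And>a b c d. a < n \<Longrightarrow> b < n \<Longrightarrow> c < n \<Longrightarrow> d < n \<Longrightarrow>
       indep_var borel (\<lambda>\<omega>. H a b \<omega> * cnj (H c d \<omega>))
         borel (\<lambda>\<omega>. (Z a \<omega> * cnj (Z b \<omega>) - of_bool (a = b)) * cnj (Z c \<omega> * cnj (Z d \<omega>) - of_bool (c = d)))"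
    and Hm: "\<And>a b. a < n \<Longrightarrow> b < n \<Longrightarrow> H a b \<in> borel_measurable M"
    and K: "\<And>a b \<omega>. a < n \<Longrightarrow> b < n \<Longrightarrow> \<omega> \<in> space M \<Longrightarrow> cmod (H a b \<omega>) \<le> K"
  defines "Q \<equiv> \<lambda>\<omega>. \<Sum>a<n. \<Sum>b<n. H a b \<omega> * (Z a \<omega> * cnj (Z b \<omega>) - of_bool (a = b))"
  shows "integrable M (\<lambda>\<omega>. (cmod (Q \<omega>))\<^sup>2)"
    and "expectation (\<lambda>\<omega>. (cmod (Q \<omega>))\<^sup>2) = expectation (\<lambda>\<omega>. \<Sum>a<n. \<Sum>b<n. (cmod (H a b \<omega>))\<^sup>2)"
proof -
  let ?\<xi> = "\<lambda>j k \<omega>. Z j \<omega> * cnj (Z k \<omega>) - of_bool (j = k)"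
  note on = gaussian_quadratic_orthonormal[OF finite_lessThan ind law, simplified]
  have Hint: "integrable M (\<lambda>\<omega>. H a b \<omega> * cnj (H c d \<omega>))" if "a < n" "b < n" "c < n" "d < n" for a b c d
  proof (rule integrable_const_bound[where B = "K * K"])
    show "AE \<omega> in M. norm (H a b \<omega> * cnj (H c d \<omega>)) \<le> K * K"
    proof (rule AE_I2)
      fix \<omega> assume w: "\<omega> \<in> space M"
      have "0 \<le> K" using K[OF that(1,2) w] norm_ge_zero order.trans by blast
      then show "norm (H a b \<omega> * cnj (H c d \<omega>)) \<le> K * K"
        unfolding norm_mult complex_mod_cnj using K[OF that(1,2) w] K[OF that(3,4) w]
        by (intro mult_mono) auto
    qed
    show "(\<lambda>\<omega>. H a b \<omega> * cnj (H c d \<omega>)) \<in> borel_measurable M"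
      using Hm that by (intro borel_measurable_times cnj_measurable) auto
  qed
  have term_int: "integrable M (\<lambda>\<omega>. (H a b \<omega> * cnj (H c d \<omega>)) * (?\<xi> a b \<omega> * cnj (?\<xi> c d \<omega>)))"
    and term_ex: "expectation (\<lambda>\<omega>. (H a b \<omega> * cnj (H c d \<omega>)) * (?\<xi> a b \<omega> * cnj (?\<xi> c d \<omega>))) =
       (if c = a \<and> d = b then expectation (\<lambda>\<omega>. of_real ((cmod (H a b \<omega>))\<^sup>2)) else 0)"
    if "a < n" "b < n" "c < n" "d < n" for a b c d
  proof -
    show "integrable M (\<lambda>\<omega>. (H a b \<omega> * cnj (H c d \<omega>)) * (?\<xi> a b \<omega> * cnj (?\<xi> c d \<omega>)))"
      using indep_var_integrable[OF HZ[OF that] Hint[OF that]] on(1)[OF that] by simp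
    have "expectation (\<lambda>\<omega>. (H a b \<omega> * cnj (H c d \<omega>)) * (?\<xi> a b \<omega> * cnj (?\<xi> c d \<omega>))) =
      expectation (\<lambda>\<omega>. H a b \<omega> * cnj (H c d \<omega>)) * of_bool (a = c \<and> b = d)"
      using indep_var_lebesgue_integral[OF HZ[OF that] Hint[OF that]] on[OF that] by simp
    also have "\<dots> = (if c = a \<and> d = b then expectation (\<lambda>\<omega>. of_real ((cmod (H a b \<omega>))\<^sup>2)) else 0)"
      unfolding complex_norm_square by auto
    finally show "expectation (\<lambda>\<omega>. (H a b \<omega> * cnj (H c d \<omega>)) * (?\<xi> a b \<omega> * cnj (?\<xi> c d \<omega>))) =
       (if c = a \<and> d = b then expectation (\<lambda>\<omega>. of_real ((cmod (H a b \<omega>))\<^sup>2)) else 0)" .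
  qed
  have QQ: "complex_of_real ((cmod (Q \<omega>))\<^sup>2) =
     (\<Sum>a<n. \<Sum>b<n. \<Sum>c<n. \<Sum>d<n. (H a b \<omega> * cnj (H c d \<omega>)) * (?\<xi> a b \<omega> * cnj (?\<xi> c d \<omega>)))" for \<omega>
  proof -
    have c: "cnj (Q \<omega>) = (\<Sum>c<n. \<Sum>d<n. cnj (H c d \<omega>) * cnj (?\<xi> c d \<omega>))"
      by (simp add: Q_def)
    show ?thesis
      unfolding complex_norm_square c unfolding Q_def sum_distrib_right
      unfolding sum_distrib_left
      by (intro sum.cong refl) (simp only: mult_ac)
  qed
  have QQi: "integrable M (\<lambda>\<omega>. complex_of_real ((cmod (Q \<omega>))\<^sup>2))"
    unfolding QQ by (intro Bochner_Integration.integrable_sum term_int) auto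
  then show "integrable M (\<lambda>\<omega>. (cmod (Q \<omega>))\<^sup>2)"
    unfolding complex_of_real_integrable_eq .
  have Hi: "integrable M (\<lambda>\<omega>. (cmod (H a b \<omega>))\<^sup>2)" if "a < n" "b < n" for a b
    using Hint[OF that that] unfolding complex_norm_square[symmetric] complex_of_real_integrable_eq .
  have "complex_of_real (expectation (\<lambda>\<omega>. (cmod (Q \<omega>))\<^sup>2)) = expectation (\<lambda>\<omega>. complex_of_real ((cmod (Q \<omega>))\<^sup>2))"
    by (rule integral_complex_of_real[symmetric])
  also have "\<dots> = (\<Sum>a<n. \<Sum>b<n. \<Sum>c<n. \<Sum>d<n.
      expectation (\<lambda>\<omega>. (H a b \<omega> * cnj (H c d \<omega>)) * (?\<xi> a b \<omega> * cnj (?\<xi> c d \<omega>))))"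
    unfolding QQ
    apply (subst Bochner_Integration.integral_sum, (intro Bochner_Integration.integrable_sum term_int; simp))
    apply (rule sum.cong[OF refl])
    apply (subst Bochner_Integration.integral_sum, (intro Bochner_Integration.integrable_sum term_int; simp))
    apply (rule sum.cong[OF refl])
    apply (subst Bochner_Integration.integral_sum, (intro Bochner_Integration.integrable_sum term_int; simp))
    apply (rule sum.cong[OF refl])
    apply (subst Bochner_Integration.integral_sum, (intro Bochner_Integration.integrable_sum term_int; simp))
    apply (rule refl)
    done
  also have "\<dots> = (\<Sum>a<n. \<Sum>b<n. \<Sum>c<n. \<Sum>d<n.
      if d = b then (if c = a then expectation (\<lambda>\<omega>. complex_of_real ((cmod (H a b \<omega>))\<^sup>2)) else 0) else 0)"
    by (intro sum.cong refl) (subst term_ex, auto)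
  also have "\<dots> = (\<Sum>a<n. \<Sum>b<n. expectation (\<lambda>\<omega>. complex_of_real ((cmod (H a b \<omega>))\<^sup>2)))"
    by (intro sum.cong refl) simp
  also have "\<dots> = complex_of_real (\<Sum>a<n. \<Sum>b<n. expectation (\<lambda>\<omega>. (cmod (H a b \<omega>))\<^sup>2))"
    by (simp only: integral_complex_of_real of_real_sum)
  also have "(\<Sum>a<n. \<Sum>b<n. expectation (\<lambda>\<omega>. (cmod (H a b \<omega>))\<^sup>2)) =
      expectation (\<lambda>\<omega>. \<Sum>a<n. \<Sum>b<n. (cmod (H a b \<omega>))\<^sup>2)"
  proof -
    have "expectation (\<lambda>\<omega>. \<Sum>a<n. \<Sum>b<n. (cmod (H a b \<omega>))\<^sup>2) =
        (\<Sum>a<n. expectation (\<lambda>\<omega>. \<Sum>b<n. (cmod (H a b \<omega>))\<^sup>2))"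
      by (rule Bochner_Integration.integral_sum) (auto intro!: Bochner_Integration.integrable_sum Hi)
    also have "\<dots> = (\<Sum>a<n. \<Sum>b<n. expectation (\<lambda>\<omega>. (cmod (H a b \<omega>))\<^sup>2))"
      by (intro sum.cong refl Bochner_Integration.integral_sum) (auto intro!: Hi)
    finally show ?thesis by simp
  qed
  finally show "expectation (\<lambda>\<omega>. (cmod (Q \<omega>))\<^sup>2) = expectation (\<lambda>\<omega>. \<Sum>a<n. \<Sum>b<n. (cmod (H a b \<omega>))\<^sup>2)"
    by (simp only: of_real_eq_iff)
qed

end

section \<open>The Marchenko-Pastur equation\<close>

lemma det_measurable:
  assumes "\<And>\<omega>. A \<omega> \<in> carrier_mat m m"
    and "\<And>i j. i < m \<Longrightarrow> j < m \<Longrightarrow> (\<lambda>\<omega>. A \<omega> $$ (i, j)) \<in> borel_measurable M"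
  shows "(\<lambda>\<omega>. Determinant.det (A \<omega>) :: complex) \<in> borel_measurable M"
  unfolding det_def'[OF assms(1)]
proof (intro borel_measurable_sum borel_measurable_times borel_measurable_prod borel_measurable_const)
  fix p i assume "p \<in> {p. p permutes {0..<m}}" "i \<in> {0..<m}"
  then have "i < m" "p i < m" using permutes_in_image[of p "{0..<m}" i] by auto
  then show "(\<lambda>\<omega>. A \<omega> $$ (i, p i)) \<in> borel_measurable M" by (rule assms(2))
qed

lemma minv_measurable:
  assumes "\<And>i j. i < n \<Longrightarrow> j < n \<Longrightarrow> (\<lambda>\<omega>. A \<omega> i j) \<in> borel_measurable M"
  shows "(\<lambda>\<omega>. minv n (A \<omega>) j k) \<in> borel_measurable M"
  unfolding minv_def cofactor_def
proof (intro borel_measurable_divide borel_measurable_times borel_measurable_const)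
  show "(\<lambda>\<omega>. Determinant.det (mat n n (\<lambda>(i, j). A \<omega> i j))) \<in> borel_measurable M"
    by (rule det_measurable[where m = n]) (auto intro: assms)
  show "(\<lambda>\<omega>. Determinant.det (mat_delete (mat n n (\<lambda>(i, j). A \<omega> i j)) k j)) \<in> borel_measurable M"
  proof (rule det_measurable[where m = "n - 1"])
    show "mat_delete (mat n n (\<lambda>(i, j). A \<omega> i j)) k j \<in> carrier_mat (n - 1) (n - 1)" for \<omega>
      by (rule mat_delete_carrier) simp
    show "(\<lambda>\<omega>. mat_delete (mat n n (\<lambda>(i, j). A \<omega> i j)) k j $$ (a, b)) \<in> borel_measurable M"
      if "a < n - 1" "b < n - 1" for a b
      using that assms by (auto simp: mat_delete_def)
  qed
qed

lemma minv_cong: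
  assumes "\<And>i j. i < n \<Longrightarrow> j < n \<Longrightarrow> A i j = B i j"
  shows "minv n A = minv n B"
proof -
  have "mat n n (\<lambda>(i, j). A i j) = mat n n (\<lambda>(i, j). B i j)"
    using assms by (intro eq_matI) auto
  then show ?thesis by (intro ext) (simp add: minv_def)
qed

lemma reg_gram_measurable:
  assumes "\<And>l k. l < n \<Longrightarrow> k < n \<Longrightarrow> (\<lambda>\<omega>. F \<omega> l k) \<in> borel_measurable M" "j < n" "k < n"
  shows "(\<lambda>\<omega>. reg_gram n x c (F \<omega>) j k) \<in> borel_measurable M"
  unfolding reg_gram_def using assms
  by (intro borel_measurable_add borel_measurable_sum borel_measurable_times borel_measurable_const cnj_measurable) auto

section \<open>Concentration of the leave-one-out forms and the finite-dimensional equation\<close>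

context prob_space begin

lemma integrable_bounded_by:
  fixes f :: "'a \<Rightarrow> 'b :: {banach, second_countable_topology}"
  assumes "f \<in> borel_measurable M" "\<And>\<omega>. norm (f \<omega>) \<le> B"
  shows "integrable M f"
  using assms by (intro integrable_const_bound[where B = B]) auto

context
  fixes X :: "'a \<Rightarrow> complex mat" and n :: nat and x :: real and c :: "nat \<Rightarrow> real"
  assumes iid: "iid_gaussian_mat M n X" and x: "x > 0" and c: "\<And>l. l < n \<Longrightarrow> c l \<ge> 0"
begin

abbreviation (input) FX :: "'a \<Rightarrow> nat \<Rightarrow> nat \<Rightarrow> complex" where
  "FX \<omega> l k \<equiv> X \<omega> $$ (l, k)"

lemma entry_measurable: "l < n \<Longrightarrow> k < n \<Longrightarrow> (\<lambda>\<omega>. FX \<omega> l k) \<in> borel_measurable M"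
  using iid by (auto simp: iid_gaussian_mat_def indep_vars_def)

lemma gram_minv_measurable: "(\<lambda>\<omega>. minv n (reg_gram n x c' (FX \<omega>)) j k) \<in> borel_measurable M"
  by (intro minv_measurable reg_gram_measurable entry_measurable)

lemma leave_one_out_measurable: "i < n \<Longrightarrow> (\<lambda>\<omega>. leave_one_out n x c (FX \<omega>) i) \<in> borel_measurable M"
  unfolding leave_one_out_def row_form_def mat_app_def
  by (intro borel_measurable_sum borel_measurable_times gram_minv_measurable entry_measurable cnj_measurable) auto

text \<open>Apply the variance formula with H = R_i. Each of the n columns of R_i has squared norm
  at most \<open>1 / x\<^sup>2\<close>.\<close>

lemma leave_one_out_variance:
  assumes i: "i < n"
  defines "Q \<equiv> \<lambda>\<omega>. leave_one_out n x c (FX \<omega>) i - (\<Sum>j<n. minv n (reg_gram n x (c(i := 0)) (FX \<omega>)) j j)"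
  shows "integrable M (\<lambda>\<omega>. (cmod (Q \<omega>))\<^sup>2)"
    and "expectation (\<lambda>\<omega>. (cmod (Q \<omega>))\<^sup>2) \<le> n / x\<^sup>2"
proof -
  define H where "H a b \<omega> = minv n (reg_gram n x (c(i := 0)) (FX \<omega>)) a b" for a b \<omega>
  \<comment> \<open>\<open>h\<close> presents R_i as a measurable function of the entries outside
    row i. That row has weight 0, so replacing it by zeros leaves the Gram matrix unchanged;
    independence of disjoint blocks then applies.\<close>
  define h where "h a b G = minv n (reg_gram n x (c(i := 0)) (\<lambda>l k. if l = i then 0 else G (l, k))) a b"
    for a b and G :: "nat \<times> nat \<Rightarrow> complex"
  define Z where "Z k \<omega> = X \<omega> $$ (i, k)" for k \<omega>
  let ?A = "({..<n} - {i}) \<times> {..<n}" and ?B = "{i} \<times> {..<n}"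
  have ind: "indep_vars (\<lambda>_. borel) (\<lambda>ij \<omega>. X \<omega> $$ ij) ({..<n} \<times> {..<n})"
    and law: "\<And>i j. i < n \<Longrightarrow> j < n \<Longrightarrow> distr M borel (\<lambda>\<omega>. X \<omega> $$ (i, j)) = std_complex_gaussian"
    using iid by (auto simp: iid_gaussian_mat_def)
  have co: "coercive n x (reg_gram n x (c(i := 0)) F)" for F
    using c by (intro coercive_reg_gram) auto
  \<comment> \<open>Row i is reindexed by column numbers through the one-point blocks {(i,
    k)}.\<close>
  have "indep_vars (\<lambda>k. PiM {(i, k)} (\<lambda>_. borel)) (\<lambda>k \<omega>. restrict (\<lambda>ij. X \<omega> $$ ij) {(i, k)}) {..<n}"
    by (rule indep_vars_restrict[OF ind]) (use i in \<open>auto simp: disjoint_family_on_def\<close>)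
  then have "indep_vars (\<lambda>_. borel) (\<lambda>k \<omega>. (restrict (\<lambda>ij. X \<omega> $$ ij) {(i, k)}) (i, k)) {..<n}"
    by (rule indep_vars_compose2) (auto intro!: measurable_component_singleton)
  then have indZ: "indep_vars (\<lambda>_. borel) Z {..<n}"
    by (simp add: Z_def[abs_def])
  have hH: "h a b (restrict (\<lambda>ij. X \<omega> $$ ij) ?A) = H a b \<omega>" for a b \<omega>
    unfolding h_def H_def
    by (rule fun_cong[OF fun_cong[OF minv_cong]]) (auto simp: reg_gram_def intro!: sum.cong)
  have hm: "h a b \<in> borel_measurable (PiM ?A (\<lambda>_. borel))" for a b
    unfolding h_def
  proof (intro minv_measurable reg_gram_measurable)
    fix l k assume "l < n" "k < n"
    then show "(\<lambda>G. if l = i then 0 else G (l, k)) \<in> borel_measurable (PiM ?A (\<lambda>_. borel))"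
      by (cases "l = i") auto
  qed
  have HZ: "indep_var borel (\<lambda>\<omega>. H a b \<omega> * cnj (H c d \<omega>))
         borel (\<lambda>\<omega>. (Z a \<omega> * cnj (Z b \<omega>) - of_bool (a = b)) * cnj (Z c \<omega> * cnj (Z d \<omega>) - of_bool (c = d)))"
    if "a < n" "b < n" "c < n" "d < n" for a b c d
  proof -
    have "indep_var (PiM ?A (\<lambda>_. borel)) (\<lambda>\<omega>. restrict (\<lambda>ij. X \<omega> $$ ij) ?A)
       (PiM ?B (\<lambda>_. borel)) (\<lambda>\<omega>. restrict (\<lambda>ij. X \<omega> $$ ij) ?B)"
      by (rule indep_var_restrict[OF ind]) (use i in auto)
    then have "indep_var borel ((\<lambda>G. h a b G * cnj (h c d G)) \<circ> (\<lambda>\<omega>. restrict (\<lambda>ij. X \<omega> $$ ij) ?A))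
       borel ((\<lambda>G. (G (i, a) * cnj (G (i, b)) - of_bool (a = b)) * cnj (G (i, c) * cnj (G (i, d)) - of_bool (c = d)))
         \<circ> (\<lambda>\<omega>. restrict (\<lambda>ij. X \<omega> $$ ij) ?B))"
    proof (rule indep_var_compose)
      show "(\<lambda>G. h a b G * cnj (h c d G)) \<in> PiM ?A (\<lambda>_. borel) \<rightarrow>\<^sub>M borel"
        by (intro borel_measurable_times cnj_measurable hm)
      show "(\<lambda>G. (G (i, a) * cnj (G (i, b)) - of_bool (a = b)) * cnj (G (i, c) * cnj (G (i, d)) - of_bool (c = d)))
        \<in> PiM ?B (\<lambda>_. borel) \<rightarrow>\<^sub>M borel"
        using that
        by (intro borel_measurable_times borel_measurable_diff borel_measurable_const cnj_measurable
            measurable_component_singleton) auto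
    qed
    then show ?thesis using that by (simp add: comp_def hH Z_def)
  qed
  have Hb: "cmod (H a b \<omega>) \<le> 1 / x" if "a < n" "b < n" for a b \<omega>
    unfolding H_def by (rule coercive_minv_entry_bound[OF co x that])
  have Hm: "H a b \<in> borel_measurable M" for a b
    unfolding H_def by (rule gram_minv_measurable)
  have Q: "Q \<omega> = (\<Sum>a<n. \<Sum>b<n. H a b \<omega> * (Z a \<omega> * cnj (Z b \<omega>) - of_bool (a = b)))" for \<omega>
  proof -
    have "(\<Sum>a<n. \<Sum>b<n. H a b \<omega> * (Z a \<omega> * cnj (Z b \<omega>) - of_bool (a = b))) =
      (\<Sum>a<n. \<Sum>b<n. Z a \<omega> * (H a b \<omega> * cnj (Z b \<omega>))) - (\<Sum>a<n. \<Sum>b<n. if b = a then H a b \<omega> else 0)"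
      unfolding sum_subtractf[symmetric] by (intro sum.cong refl) (auto simp: algebra_simps)
    then show ?thesis
      by (simp add: Q_def leave_one_out_def row_form_def mat_app_def H_def[symmetric] Z_def[symmetric] sum_distrib_left)
  qed
  note v = quadratic_form_variance[OF indZ _ HZ Hm Hb, folded Q]
  show "integrable M (\<lambda>\<omega>. (cmod (Q \<omega>))\<^sup>2)"
    by (rule v(1)) (use law i in \<open>auto simp: Z_def[abs_def]\<close>)
  have "expectation (\<lambda>\<omega>. (cmod (Q \<omega>))\<^sup>2) = expectation (\<lambda>\<omega>. \<Sum>a<n. \<Sum>b<n. (cmod (H a b \<omega>))\<^sup>2)"
    by (rule v(2)) (use law i in \<open>auto simp: Z_def[abs_def]\<close>)
  also have "\<dots> \<le> n / x\<^sup>2"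
  proof -
    have b: "(\<Sum>a<n. \<Sum>b<n. (cmod (H a b \<omega>))\<^sup>2) \<le> n / x\<^sup>2" for \<omega>
    proof -
      have "(\<Sum>a<n. \<Sum>b<n. (cmod (H a b \<omega>))\<^sup>2) = (\<Sum>b<n. \<Sum>a<n. (cmod (H a b \<omega>))\<^sup>2)"
        by (rule sum.swap)
      also have "\<dots> \<le> (\<Sum>b<n. 1 / x\<^sup>2)"
        unfolding H_def by (intro sum_mono coercive_minv_column_bound[OF co x]) auto
      finally show ?thesis by simp
    qed
    have "integrable M (\<lambda>\<omega>. \<Sum>a<n. \<Sum>b<n. (cmod (H a b \<omega>))\<^sup>2)"
    proof (rule integrable_bounded_by[where B = "n / x\<^sup>2"])
      show "(\<lambda>\<omega>. \<Sum>a<n. \<Sum>b<n. (cmod (H a b \<omega>))\<^sup>2) \<in> borel_measurable M"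
        using Hm by measurable
      show "norm (\<Sum>a<n. \<Sum>b<n. (cmod (H a b \<omega>))\<^sup>2) \<le> n / x\<^sup>2" for \<omega>
        using b[of \<omega>] by (simp add: sum_nonneg)
    qed
    then show ?thesis by (rule integral_le_const) (use b in auto)
  qed
  finally show "expectation (\<lambda>\<omega>. (cmod (Q \<omega>))\<^sup>2) \<le> n / x\<^sup>2" .
qed

lemma leave_one_out_L1:
  assumes i: "i < n"
  defines "Q \<equiv> \<lambda>\<omega>. leave_one_out n x c (FX \<omega>) i - (\<Sum>j<n. minv n (reg_gram n x (c(i := 0)) (FX \<omega>)) j j)"
  shows "integrable M (\<lambda>\<omega>. cmod (Q \<omega>) / n)"
    and "expectation (\<lambda>\<omega>. cmod (Q \<omega>) / n) \<le> 1 / (sqrt n * x)"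
proof -
  have v: "integrable M (\<lambda>\<omega>. (cmod (Q \<omega>))\<^sup>2)" "expectation (\<lambda>\<omega>. (cmod (Q \<omega>))\<^sup>2) \<le> n / x\<^sup>2"
    unfolding Q_def by (rule leave_one_out_variance[OF i])+
  have Qm: "Q \<in> borel_measurable M"
    unfolding Q_def
    by (intro borel_measurable_diff leave_one_out_measurable[OF i] borel_measurable_sum gram_minv_measurable)
  have n: "n > 0" using i by simp
  \<comment> \<open>This weight balances the two terms of |Q| <= (s |Q|^2 + 1 / s) / 2 when the
    expectation of |Q|^2 is n / x^2.\<close>
  define s where "s = x / sqrt n"
  have s: "s > 0" using x n by (simp add: s_def)
  have ptw: "cmod (Q \<omega>) \<le> (s * (cmod (Q \<omega>))\<^sup>2 + 1 / s) / 2" for \<omega>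
  proof -
    have "0 \<le> (s * cmod (Q \<omega>) - 1)\<^sup>2 / s" using s by simp
    also have "\<dots> = s * (cmod (Q \<omega>))\<^sup>2 + 1 / s - 2 * cmod (Q \<omega>)"
      using s by (simp add: field_simps power2_eq_square)
    finally show ?thesis by simp
  qed
  have i1: "integrable M (\<lambda>\<omega>. (s * (cmod (Q \<omega>))\<^sup>2 + 1 / s) / 2)"
    using v(1) by simp
  have i2: "integrable M (\<lambda>\<omega>. cmod (Q \<omega>))"
    by (rule Bochner_Integration.integrable_bound[OF i1])
      (use Qm ptw s in \<open>auto intro!: AE_I2 order_trans[OF ptw]\<close>)
  then show "integrable M (\<lambda>\<omega>. cmod (Q \<omega>) / n)" by simp
  have "expectation (\<lambda>\<omega>. cmod (Q \<omega>)) \<le> expectation (\<lambda>\<omega>. (s * (cmod (Q \<omega>))\<^sup>2 + 1 / s) / 2)"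
    using ptw by (intro integral_mono i1 i2)
  also have "\<dots> = (s * expectation (\<lambda>\<omega>. (cmod (Q \<omega>))\<^sup>2) + 1 / s) / 2"
    using v(1) by (simp add: prob_space)
  also have "\<dots> \<le> (s * (n / x\<^sup>2) + 1 / s) / 2"
    using mult_left_mono[OF v(2), of s] s by (intro divide_right_mono add_right_mono) auto
  also have "\<dots> = sqrt n / x"
    using x n by (simp add: s_def field_simps power2_eq_square)
  finally have "expectation (\<lambda>\<omega>. cmod (Q \<omega>)) / n \<le> sqrt n / x / n"
    by (intro divide_right_mono) auto
  also have "\<dots> = 1 / (sqrt n * x)"
    using n x by (simp add: field_simps real_sqrt_mult_self flip: power2_eq_square)
  finally show "expectation (\<lambda>\<omega>. cmod (Q \<omega>) / n) \<le> 1 / (sqrt n * x)" by simp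
qed

end

text \<open>Here \<open>m\<close> is an arbitrary positive number, later the limit of T. The left
  side of the last claim is deterministic, so a pointwise estimate can be integrated; the
  fluctuations of T enter only through the mean distance of T from m.\<close>

lemma companion_fixed_point_error:
  fixes X :: "'a \<Rightarrow> complex mat" and \<tau> :: "nat \<Rightarrow> real"
  assumes iid: "iid_gaussian_mat M n X" and x: "x > 0" and \<tau>: "\<And>l. l < n \<Longrightarrow> \<tau> l \<ge> 0"
    and n: "n > 0" and m: "m > 0"
  defines "T \<equiv> \<lambda>\<omega>. Re (\<Sum>j<n. minv n (reg_gram n x (\<lambda>l. \<tau> l / n) (\<lambda>l k. X \<omega> $$ (l, k))) j j) / n"
  shows "integrable M (\<lambda>\<omega>. \<bar>T \<omega> - m\<bar>)"
    and "\<bar>T \<omega>\<bar> \<le> 1 / x"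
    and "\<bar>x * m - (\<Sum>i<n. 1 / (1 + \<tau> i * m)) / n\<bar> \<le>
      (x + 1 / m) * expectation (\<lambda>\<omega>. \<bar>T \<omega> - m\<bar>) + (1 / (sqrt n * x) + 1 / (n * x)) / m"
proof -
  define c where "c l = \<tau> l / n" for l
  have c: "c l \<ge> 0" if "l < n" for l using \<tau>[OF that] by (simp add: c_def)
  define F where "F \<omega> l k = X \<omega> $$ (l, k)" for \<omega> l k
  define tr where "tr \<omega> = (\<Sum>j<n. minv n (reg_gram n x c (F \<omega>)) j j)" for \<omega>
  define tri where "tri i \<omega> = (\<Sum>j<n. minv n (reg_gram n x (c(i := 0)) (F \<omega>)) j j)" for i \<omega>
  define q where "q i \<omega> = Re (leave_one_out n x c (F \<omega>) i) / n" for i \<omega>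
  define D where "D i \<omega> = cmod (leave_one_out n x c (F \<omega>) i - tri i \<omega>) / n" for i \<omega>
  have T: "T \<omega> = Re (tr \<omega>) / n" for \<omega>
    by (simp add: T_def tr_def F_def[abs_def] c_def[abs_def])
  have Tb: "\<bar>T \<omega>\<bar> \<le> 1 / x" for \<omega>
  proof -
    have "\<bar>Re (tr \<omega>)\<bar> \<le> n / x"
      unfolding tr_def using order_trans[OF abs_Re_le_cmod trace_minv_bound[where n = n and c = c, OF x c]] by blast
    then have "\<bar>Re (tr \<omega>)\<bar> / n \<le> (n / x) / n" by (rule divide_right_mono) simp
    then show ?thesis using n by (simp add: T abs_divide)
  qed
  then show "\<bar>T \<omega>\<bar> \<le> 1 / x" .
  have Tm: "T \<in> borel_measurable M"
    unfolding T_def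
    by (intro borel_measurable_divide borel_measurable_const
        measurable_compose[OF _ borel_measurable_Re] borel_measurable_sum gram_minv_measurable[where c = "\<lambda>_. 0", OF iid x]) simp
  show iT: "integrable M (\<lambda>\<omega>. \<bar>T \<omega> - m\<bar>)"
  proof (rule integrable_bounded_by[where B = "1 / x + m"])
    show "(\<lambda>\<omega>. \<bar>T \<omega> - m\<bar>) \<in> borel_measurable M" using Tm by measurable
    show "norm \<bar>T \<omega> - m\<bar> \<le> 1 / x + m" for \<omega>
      using Tb[of \<omega>] m by simp
  qed
  have q0: "q i \<omega> \<ge> 0" for i \<omega>
    unfolding q_def using leave_one_out_nonneg[where n = n and c = c, OF x c] by simp
  \<comment> \<open>This is the trace identity with a / (1 + a) rewritten as 1 - 1 / (1 + a). The
    normalisations of \<open>c\<close> and \<open>q\<close> cancel: \<open>c i\<close> times the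
    leave-one-out form is \<open>\<tau> i * q i \<omega>\<close>.\<close>
  have xT: "x * T \<omega> = (\<Sum>i<n. 1 / (1 + \<tau> i * q i \<omega>)) / n" for \<omega>
  proof -
    have "of_nat n = of_real x * tr \<omega> +
      (\<Sum>i<n. of_real (c i) * leave_one_out n x c (F \<omega>) i / (1 + of_real (c i) * leave_one_out n x c (F \<omega>) i))"
      unfolding tr_def by (rule trace_identity[where n = n and c = c, OF x c])
    also have "(\<Sum>i<n. of_real (c i) * leave_one_out n x c (F \<omega>) i / (1 + of_real (c i) * leave_one_out n x c (F \<omega>) i)) =
      (\<Sum>i<n. of_real (\<tau> i * q i \<omega> / (1 + \<tau> i * q i \<omega>)))"
    proof (intro sum.cong refl)
      fix i
      have "leave_one_out n x c (F \<omega>) i = of_real (Re (leave_one_out n x c (F \<omega>) i))" by (rule leave_one_out_real(1)[where n = n and c = c, OF x c])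
      also have "\<dots> = of_real (n * q i \<omega>)" using n by (simp add: q_def)
      finally have l: "leave_one_out n x c (F \<omega>) i = of_real (n * q i \<omega>)" .
      have "of_real (c i) * leave_one_out n x c (F \<omega>) i = of_real (\<tau> i * q i \<omega>)"
        unfolding l of_real_mult[symmetric] using n by (simp add: c_def)
      then show "of_real (c i) * leave_one_out n x c (F \<omega>) i / (1 + of_real (c i) * leave_one_out n x c (F \<omega>) i) =
         of_real (\<tau> i * q i \<omega> / (1 + \<tau> i * q i \<omega>))" by simp
    qed
    finally have "real n = Re (of_real x * tr \<omega> + of_real (\<Sum>i<n. \<tau> i * q i \<omega> / (1 + \<tau> i * q i \<omega>)))"
      by (metis Re_complex_of_real of_real_of_nat_eq of_real_sum)
    then have e: "real n = x * Re (tr \<omega>) + (\<Sum>i<n. \<tau> i * q i \<omega> / (1 + \<tau> i * q i \<omega>))"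
      by (simp only: plus_complex.sel Re_complex_of_real times_complex.sel Im_complex_of_real)
    have "(\<Sum>i<n. 1 / (1 + \<tau> i * q i \<omega>)) + (\<Sum>i<n. \<tau> i * q i \<omega> / (1 + \<tau> i * q i \<omega>)) = (\<Sum>i<n. 1)"
      unfolding sum.distrib[symmetric]
    proof (intro sum.cong refl)
      fix i assume "i \<in> {..<n}"
      then have "1 + \<tau> i * q i \<omega> > 0" using \<tau> q0 by (intro add_pos_nonneg) auto
      then show "1 / (1 + \<tau> i * q i \<omega>) + \<tau> i * q i \<omega> / (1 + \<tau> i * q i \<omega>) = 1"
        by (simp flip: add_divide_distrib)
    qed
    with e have "x * Re (tr \<omega>) = (\<Sum>i<n. 1 / (1 + \<tau> i * q i \<omega>))" by simp
    then show ?thesis by (simp add: T)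
  qed
  \<comment> \<open>The three errors come from replacing the quadratic form by its trace, from
    restoring row i, and from replacing T by m.\<close>
  have qm: "\<bar>q i \<omega> - m\<bar> \<le> D i \<omega> + 1 / (n * x) + \<bar>T \<omega> - m\<bar>" if i: "i < n" for i \<omega>
  proof -
    have "\<bar>q i \<omega> - Re (tri i \<omega>) / n\<bar> \<le> D i \<omega>"
    proof -
      have "\<bar>Re (leave_one_out n x c (F \<omega>) i - tri i \<omega>)\<bar> / n \<le> D i \<omega>"
        unfolding D_def by (intro divide_right_mono abs_Re_le_cmod) simp
      then show ?thesis by (simp add: q_def abs_divide flip: diff_divide_distrib)
    qed
    moreover have "\<bar>Re (tri i \<omega>) / n - T \<omega>\<bar> \<le> 1 / (n * x)"
    proof -
      have "\<bar>Re (tri i \<omega> - tr \<omega>)\<bar> \<le> 1 / x"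
        unfolding tri_def tr_def
        using order_trans[OF abs_Re_le_cmod trace_rank_one[where n = n and c = c, OF x c i]] by blast
      then have "\<bar>Re (tri i \<omega> - tr \<omega>)\<bar> / n \<le> 1 / x / n" by (rule divide_right_mono) simp
      then show ?thesis by (simp add: T abs_divide mult.commute flip: diff_divide_distrib)
    qed
    ultimately show ?thesis by linarith
  qed
  \<comment> \<open>The constant 1 / m bounds \<tau> / (1 + \<tau> m) for all \<tau> >= 0, so large
    weights do no harm.\<close>
  have step: "\<bar>1 / (1 + \<tau> i * a) - 1 / (1 + \<tau> i * m)\<bar> \<le> \<bar>a - m\<bar> / m" if "a \<ge> 0" "i < n" for a i
  proof -
    have t: "\<tau> i \<ge> 0" using \<tau> that by simp
    have p: "1 + \<tau> i * a \<ge> 1" "1 + \<tau> i * m > 0" using t that m by (simp_all add: add_pos_nonneg)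
    have "1 / (1 + \<tau> i * a) - 1 / (1 + \<tau> i * m) = (\<tau> i * (m - a)) / ((1 + \<tau> i * a) * (1 + \<tau> i * m))"
      using p by (simp add: field_simps)
    then have "\<bar>1 / (1 + \<tau> i * a) - 1 / (1 + \<tau> i * m)\<bar> =
       (\<bar>a - m\<bar> * (\<tau> i / (1 + \<tau> i * m))) / (1 + \<tau> i * a)"
      using p t by (simp add: abs_mult abs_divide abs_minus_commute mult_ac)
    also have "\<dots> \<le> (\<bar>a - m\<bar> * (\<tau> i / (1 + \<tau> i * m))) / 1"
      using p t by (intro divide_left_mono mult_nonneg_nonneg) auto
    also have "\<dots> \<le> \<bar>a - m\<bar> * (1 / m)"
      unfolding div_by_1 using p m t by (intro mult_left_mono) (auto simp: field_simps)
    finally show ?thesis by simp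
  qed
  let ?G = "(\<Sum>i<n. 1 / (1 + \<tau> i * m)) / n"
  have ptw: "\<bar>x * m - ?G\<bar> \<le> (x + 1 / m) * \<bar>T \<omega> - m\<bar> + (\<Sum>i<n. (D i \<omega> + 1 / (n * x)) / m) / n" for \<omega>
  proof -
    have "\<bar>x * T \<omega> - ?G\<bar> = \<bar>\<Sum>i<n. 1 / (1 + \<tau> i * q i \<omega>) - 1 / (1 + \<tau> i * m)\<bar> / n"
      unfolding xT by (simp add: sum_subtractf abs_divide flip: diff_divide_distrib)
    also have "\<dots> \<le> (\<Sum>i<n. \<bar>1 / (1 + \<tau> i * q i \<omega>) - 1 / (1 + \<tau> i * m)\<bar>) / n"
      by (intro divide_right_mono sum_abs) simp
    also have "\<dots> \<le> (\<Sum>i<n. (D i \<omega> + 1 / (n * x)) / m + \<bar>T \<omega> - m\<bar> / m) / n"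
    proof (intro divide_right_mono sum_mono)
      fix i assume "i \<in> {..<n}"
      then have i: "i < n" by simp
      have "\<bar>1 / (1 + \<tau> i * q i \<omega>) - 1 / (1 + \<tau> i * m)\<bar> \<le> \<bar>q i \<omega> - m\<bar> / m"
        by (rule step[OF q0 i])
      also have "\<dots> \<le> (D i \<omega> + 1 / (n * x) + \<bar>T \<omega> - m\<bar>) / m"
        using qm[OF i] m by (intro divide_right_mono) auto
      finally show "\<bar>1 / (1 + \<tau> i * q i \<omega>) - 1 / (1 + \<tau> i * m)\<bar> \<le> (D i \<omega> + 1 / (n * x)) / m + \<bar>T \<omega> - m\<bar> / m"
        by (simp add: add_divide_distrib)
    qed simp
    also have "\<dots> = (\<Sum>i<n. (D i \<omega> + 1 / (n * x)) / m) / n + (1 / m) * \<bar>T \<omega> - m\<bar>"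
      unfolding sum.distrib using n by (simp add: add_divide_distrib)
    finally have "\<bar>x * T \<omega> - ?G\<bar> \<le> (\<Sum>i<n. (D i \<omega> + 1 / (n * x)) / m) / n + (1 / m) * \<bar>T \<omega> - m\<bar>" .
    moreover have "\<bar>x * m - x * T \<omega>\<bar> = x * \<bar>T \<omega> - m\<bar>"
      using x by (simp add: abs_mult abs_minus_commute flip: right_diff_distrib)
    ultimately show ?thesis by (simp add: distrib_right)
  qed
  have Di: "integrable M (D i)" "expectation (D i) \<le> 1 / (sqrt n * x)" if "i < n" for i
    using leave_one_out_L1[where n = n and X = X and x = x and c = c and i = i, OF iid x c that]
    by (simp_all add: D_def[abs_def] tri_def F_def[abs_def])
  have iS: "integrable M (\<lambda>\<omega>. (\<Sum>i<n. (D i \<omega> + 1 / (n * x)) / m) / n)"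
    by (intro integrable_divide Bochner_Integration.integrable_sum Bochner_Integration.integrable_add integrable_const Di) auto
  have "\<bar>x * m - ?G\<bar> = expectation (\<lambda>\<omega>. \<bar>x * m - ?G\<bar>)" by (simp add: prob_space)
  also have "\<dots> \<le> expectation (\<lambda>\<omega>. (x + 1 / m) * \<bar>T \<omega> - m\<bar> + (\<Sum>i<n. (D i \<omega> + 1 / (n * x)) / m) / n)"
    by (intro integral_mono integrable_const Bochner_Integration.integrable_add integrable_mult_right iT iS ptw)
  also have "\<dots> = (x + 1 / m) * expectation (\<lambda>\<omega>. \<bar>T \<omega> - m\<bar>) +
      expectation (\<lambda>\<omega>. (\<Sum>i<n. (D i \<omega> + 1 / (n * x)) / m) / n)"
    by (subst Bochner_Integration.integral_add) (auto intro!: integrable_mult_right iT iS)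
  also have "expectation (\<lambda>\<omega>. (\<Sum>i<n. (D i \<omega> + 1 / (n * x)) / m) / n) =
      (\<Sum>i<n. (expectation (D i) + 1 / (n * x)) / m) / n"
  proof -
    have "expectation (\<lambda>\<omega>. \<Sum>i<n. (D i \<omega> + 1 / (n * x)) / m) =
        (\<Sum>i<n. expectation (\<lambda>\<omega>. (D i \<omega> + 1 / (n * x)) / m))"
      by (rule Bochner_Integration.integral_sum)
        (auto intro!: integrable_divide Bochner_Integration.integrable_add integrable_const Di)
    also have "\<dots> = (\<Sum>i<n. (expectation (D i) + 1 / (n * x)) / m)"
    proof (rule sum.cong[OF refl])
      fix i assume "i \<in> {..<n}"
      then show "expectation (\<lambda>\<omega>. (D i \<omega> + 1 / (n * x)) / m) = (expectation (D i) + 1 / (n * x)) / m"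
        using Di(1)[of i] by (simp add: prob_space)
    qed
    finally show ?thesis by simp
  qed
  also have "\<dots> \<le> (\<Sum>i<n. (1 / (sqrt n * x) + 1 / (n * x)) / m) / n"
    using m x Di(2) by (intro divide_right_mono sum_mono add_mono) auto
  also have "\<dots> = (1 / (sqrt n * x) + 1 / (n * x)) / m" using n by simp
  finally show "\<bar>x * m - ?G\<bar> \<le>
      (x + 1 / m) * expectation (\<lambda>\<omega>. \<bar>T \<omega> - m\<bar>) + (1 / (sqrt n * x) + 1 / (n * x)) / m" by simp
qed

end

text \<open>Dimension 0 is covered as well, since \<open>pmf_of_multiset\<close> has a pmf as value
  even on the empty multiset; the weak convergence theorem asks for a distribution at every
  index.\<close>

lemma real_distribution_esd: "real_distribution (esd A)"
  unfolding esd_def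
  by (intro prob_space.real_distribution_distr prob_space_measure_pmf) simp

text \<open>The averages of 1 / (1 + \<tau> m) over the population have two limits: x m by the error
  bound, whose mean distance tends to 0 by dominated convergence, and the integral over \<nu> by
  weak convergence of the population spectra. In the application x is
  \<open>y\<^sup>2\<close>.\<close>

lemma marchenko_pastur_equation:
  assumes mp: "marchenko_pastur_limit W \<Lambda> X \<nu> \<mu>MP" and \<nu>: "real_distribution \<nu>" and x: "x > 0"
  defines "m \<equiv> \<integral>t. 1 / (x + \<bar>t\<bar>) \<partial>\<mu>MP"
  shows "m > 0" and "x * m = (\<integral>t. 1 / (1 + \<bar>t\<bar> * m) \<partial>\<nu>)"
proof -
  interpret W: prob_space W using mp by (simp add: marchenko_pastur_limit_def)
  interpret MP: real_distribution \<mu>MP using mp by (simp add: marchenko_pastur_limit_def)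
  have L: "nonneg_diagonal n (\<Lambda> n)" and iid: "iid_gaussian_mat W n (X n)" for n
    using mp by (auto simp: marchenko_pastur_limit_def)
  have Xc: "X n \<omega> \<in> carrier_mat n n" if "\<omega> \<in> space W" for n \<omega>
    using iid[of n] that by (auto simp: iid_gaussian_mat_def)
  have b: "norm (1 / (x + \<bar>t\<bar>)) \<le> 1 / x" for t using x by (simp add: frac_le)
  have int: "integrable \<mu>MP (\<lambda>t. 1 / (x + \<bar>t\<bar>))"
    by (rule MP.integrable_bounded_by[OF _ b]) simp
  show m: "m > 0"
  proof -
    have pos: "1 / (x + \<bar>t\<bar>) > 0" for t using x by (simp add: add_pos_nonneg)
    then have "m \<ge> 0" unfolding m_def by (intro Bochner_Integration.integral_nonneg) (simp add: less_imp_le)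
    moreover have "m \<noteq> 0"
    proof
      assume "m = 0"
      then have "AE t in \<mu>MP. 1 / (x + \<bar>t\<bar>) = 0"
        unfolding m_def using integral_nonneg_eq_0_iff_AE[OF int] pos by (simp add: less_imp_le)
      moreover have "1 / (x + \<bar>t\<bar>) \<noteq> 0" for t using pos[of t] by linarith
      ultimately have "AE t in \<mu>MP. False" by simp
      then show False by (rule MP.AE_contr) simp
    qed
    ultimately show ?thesis by simp
  qed
  define \<tau> where "\<tau> n l = (Re (\<Lambda> n $$ (l, l)))\<^sup>2" for n l
  define T where "T n \<omega> = Re (\<Sum>j<n. minv n (reg_gram n x (\<lambda>l. \<tau> n l / n) (\<lambda>l k. X n \<omega> $$ (l, k))) j j) / n" for n \<omega>
  have T: "T n \<omega> = (\<integral>t. 1 / (x + \<bar>t\<bar>) \<partial>esd (sample_cov n (\<Lambda> n) (X n \<omega>)))"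
    if "n > 0" "\<omega> \<in> space W" for n \<omega>
  proof -
    from arg_cong[OF integral_esd_sample_cov[OF L Xc[OF that(2)] that(1) x], of Re]
    show ?thesis by (simp add: T_def \<tau>_def)
  qed
  have cont: "isCont (\<lambda>t. 1 / (x + \<bar>t\<bar>)) t" for t
    using x by (intro continuous_intros) (auto simp: add_pos_nonneg intro!: less_imp_neq[symmetric])
  \<comment> \<open>The index is shifted because the formula for \<open>T\<close> as a spectral
    integral needs positive dimension.\<close>
  have conv: "AE \<omega> in W. (\<lambda>n. T (Suc n) \<omega>) \<longlonglongrightarrow> m"
  proof -
    have "AE \<omega> in W. weak_conv_m (\<lambda>n. esd (sample_cov n (\<Lambda> n) (X n \<omega>))) \<mu>MP"
      using mp by (simp add: marchenko_pastur_limit_def)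
    then show ?thesis
    proof (rule AE_mp[OF _ AE_I2], intro impI)
      fix \<omega> assume w: "\<omega> \<in> space W" and "weak_conv_m (\<lambda>n. esd (sample_cov n (\<Lambda> n) (X n \<omega>))) \<mu>MP"
      then have "(\<lambda>n. \<integral>t. 1 / (x + \<bar>t\<bar>) \<partial>esd (sample_cov n (\<Lambda> n) (X n \<omega>))) \<longlonglongrightarrow> m"
        unfolding m_def
        by (intro weak_conv_imp_integral_bdd_continuous_conv[where B = "1 / x"]
            real_distribution_esd MP.real_distribution_axioms cont b)
      then have "(\<lambda>n. \<integral>t. 1 / (x + \<bar>t\<bar>) \<partial>esd (sample_cov (Suc n) (\<Lambda> (Suc n)) (X (Suc n) \<omega>))) \<longlonglongrightarrow> m"
        by (rule LIMSEQ_Suc)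
      then show "(\<lambda>n. T (Suc n) \<omega>) \<longlonglongrightarrow> m" using T[OF _ w] by simp
    qed
  qed
  have \<tau>0: "\<tau> n l \<ge> 0" for n l by (simp add: \<tau>_def)
  have err: "integrable W (\<lambda>\<omega>. \<bar>T n \<omega> - m\<bar>)" "\<bar>T n \<omega>\<bar> \<le> 1 / x"
    "\<bar>x * m - (\<Sum>i<n. 1 / (1 + \<tau> n i * m)) / n\<bar> \<le>
      (x + 1 / m) * W.expectation (\<lambda>\<omega>. \<bar>T n \<omega> - m\<bar>) + (1 / (sqrt n * x) + 1 / (n * x)) / m"
    if "n > 0" for n \<omega>
    unfolding T_def by (rule W.companion_fixed_point_error[where \<tau> = "\<tau> n", OF iid x \<tau>0 that m])+
  define e where "e n = W.expectation (\<lambda>\<omega>. \<bar>T (Suc n) \<omega> - m\<bar>)" for n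
  have "e \<longlonglongrightarrow> W.expectation (\<lambda>\<omega>. 0)"
    unfolding e_def
  proof (rule integral_dominated_convergence[where w = "\<lambda>_. 1 / x + m"])
    show "(\<lambda>\<omega>. \<bar>T (Suc n) \<omega> - m\<bar>) \<in> borel_measurable W" for n
      by (rule borel_measurable_integrable[OF err(1)]) simp
    show "AE \<omega> in W. (\<lambda>n. \<bar>T (Suc n) \<omega> - m\<bar>) \<longlonglongrightarrow> 0"
      using conv by eventually_elim (simp add: tendsto_rabs_zero_iff LIM_zero_iff)
    show "AE \<omega> in W. norm \<bar>T (Suc n) \<omega> - m\<bar> \<le> 1 / x + m" for n
    proof (rule AE_I2)
      fix \<omega> show "norm \<bar>T (Suc n) \<omega> - m\<bar> \<le> 1 / x + m"
        using err(2)[of "Suc n" \<omega>] m by simp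
    qed
  qed auto
  then have e: "e \<longlonglongrightarrow> 0" by simp
  let ?G = "\<lambda>n. (\<Sum>i<Suc n. 1 / (1 + \<tau> (Suc n) i * m)) / Suc n"
  have lim: "(\<lambda>n. 1 / (sqrt (Suc n) * x) + 1 / (Suc n * x)) \<longlonglongrightarrow> 0"
    using x by real_asymp
  have bnd: "(\<lambda>n. (x + 1 / m) * e n + (1 / (sqrt (Suc n) * x) + 1 / (Suc n * x)) / m) \<longlonglongrightarrow> 0"
    using tendsto_add[OF tendsto_mult_left[OF e, of "x + 1 / m"] tendsto_divide[OF lim tendsto_const[of m]]] m
    by simp
  have "norm (?G n - x * m) \<le> (x + 1 / m) * e n + (1 / (sqrt (Suc n) * x) + 1 / (Suc n * x)) / m" for n
    unfolding e_def real_norm_def abs_minus_commute[of "?G n"] by (rule err(3)) simp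
  then have "(\<lambda>n. ?G n - x * m) \<longlonglongrightarrow> 0"
    by (intro Lim_null_comparison[OF always_eventually bnd] allI)
  then have G1: "?G \<longlonglongrightarrow> x * m" by (simp add: LIM_zero_iff)
  have d: "1 + \<bar>t\<bar> * m > 0" for t using m by (simp add: add_pos_nonneg)
  have "(\<lambda>n. \<integral>t. 1 / (1 + \<bar>t\<bar> * m) \<partial>esd (\<Lambda> n * \<Lambda> n)) \<longlonglongrightarrow> (\<integral>t. 1 / (1 + \<bar>t\<bar> * m) \<partial>\<nu>)"
  proof (rule weak_conv_imp_integral_bdd_continuous_conv[where B = 1])
    show "weak_conv_m (\<lambda>n. esd (\<Lambda> n * \<Lambda> n)) \<nu>" using mp by (simp add: marchenko_pastur_limit_def)
    show "isCont (\<lambda>t. 1 / (1 + \<bar>t\<bar> * m)) t" for t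
      using d by (intro continuous_intros) (auto intro!: less_imp_neq[symmetric])
    show "norm (1 / (1 + \<bar>t\<bar> * m)) \<le> 1" for t using m d[of t] by simp
  qed (use \<nu> real_distribution_esd in auto)
  then have "(\<lambda>n. \<integral>t. 1 / (1 + \<bar>t\<bar> * m) \<partial>esd (\<Lambda> (Suc n) * \<Lambda> (Suc n))) \<longlonglongrightarrow> (\<integral>t. 1 / (1 + \<bar>t\<bar> * m) \<partial>\<nu>)"
    by (rule LIMSEQ_Suc)
  moreover have "(\<integral>t. 1 / (1 + \<bar>t\<bar> * m) \<partial>esd (\<Lambda> (Suc n) * \<Lambda> (Suc n))) = ?G n" for n
    by (subst integral_esd_diagonal[OF L]) (auto simp: \<tau>_def)
  ultimately have "?G \<longlonglongrightarrow> (\<integral>t. 1 / (1 + \<bar>t\<bar> * m) \<partial>\<nu>)" by simp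
  with G1 show "x * m = (\<integral>t. 1 / (1 + \<bar>t\<bar> * m) \<partial>\<nu>)" by (rule LIMSEQ_unique)
qed

section \<open>Transforms of measures\<close>

lemma real_distribution_eq_return_0:
  assumes "real_distribution \<phi>" "AE t in \<phi>. t = 0"
  shows "\<phi> = return borel 0"
proof -
  interpret real_distribution \<phi> by fact
  show ?thesis
  proof (rule measure_eqI)
    fix A assume A: "A \<in> sets \<phi>"
    have "emeasure \<phi> A = (\<integral>\<^sup>+t. indicator A t \<partial>\<phi>)" using A by simp
    also have "\<dots> = (\<integral>\<^sup>+t. indicator A 0 \<partial>\<phi>)"
      using assms(2) by (intro nn_integral_cong_AE) auto
    also have "\<dots> = indicator A 0" using emeasure_space_1 by simp
    finally show "emeasure \<phi> A = emeasure (return borel 0) A" using A by simp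
  qed simp
qed

text \<open>The factor \<open>c\<close> rotates to the right half-plane an open half-plane that
  contains all values of f away from 0; an average of such values cannot vanish. Applied to a
  difference quotient, this yields injectivity.\<close>

lemma AE_eq_0_if_integral_eq_0:
  fixes f :: "real \<Rightarrow> complex"
  assumes f: "integrable \<phi> f" "integral\<^sup>L \<phi> f = 0"
    and pos: "AE t in \<phi>. t \<noteq> 0 \<longrightarrow> Re (c * f t) > 0" "AE t in \<phi>. t = 0 \<longrightarrow> f t = 0"
  shows "AE t in \<phi>. t = 0"
proof -
  have int: "integrable \<phi> (\<lambda>t. Re (c * f t))"
    using f(1) by (intro integrable_Re integrable_mult_right)
  have "(\<integral>t. Re (c * f t) \<partial>\<phi>) = Re (\<integral>t. c * f t \<partial>\<phi>)"
    using f(1) by (intro integral_Re integrable_mult_right)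
  also have "\<dots> = 0" using f by simp
  finally have "(\<integral>t. Re (c * f t) \<partial>\<phi>) = 0" .
  moreover have nn: "AE t in \<phi>. 0 \<le> Re (c * f t)"
    using pos by eventually_elim (metis less_imp_le mult_zero_right order_refl zero_complex.sel(1))
  ultimately have "AE t in \<phi>. Re (c * f t) = 0"
    using integral_nonneg_eq_0_iff_AE[OF int nn] by simp
  with pos(1) show ?thesis by eventually_elim fastforce
qed

lemma half_plane_factor_norm:
  assumes "Re z < 0" "t \<ge> 0"
  shows "cmod (z * of_real t) \<le> cmod (1 - z * of_real t)" "1 - z * of_real t \<noteq> 0"
proof -
  have t: "Re z * t \<le> 0" using assms by (simp add: mult_nonpos_nonneg)
  have "(Re z * t)\<^sup>2 \<le> (1 - Re z * t)\<^sup>2"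
    using t by (simp add: power2_eq_square algebra_simps)
  then have "(cmod (z * of_real t))\<^sup>2 \<le> (cmod (1 - z * of_real t))\<^sup>2"
    by (simp add: cmod_power2)
  then show "cmod (z * of_real t) \<le> cmod (1 - z * of_real t)"
    by (rule power2_le_imp_le) simp
  have "Re (1 - z * of_real t) > 0" using t by simp
  then show "1 - z * of_real t \<noteq> 0" by (metis less_irrefl zero_complex.sel(1))
qed

lemma m_transform_integrable:
  assumes "real_distribution \<phi>" "AE t in \<phi>. t \<ge> 0" "z \<in> half_plane"
  shows "integrable \<phi> (\<lambda>t. z * of_real t / (1 - z * of_real t))"
proof -
  interpret real_distribution \<phi> by fact
  show ?thesis
  proof (rule integrable_const_bound[where B = 1])
    show "AE t in \<phi>. norm (z * of_real t / (1 - z * of_real t)) \<le> 1"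
      using assms(2)
    proof eventually_elim
      case (elim t)
      have "Re z < 0" using assms(3) by (simp add: half_plane_def)
      from half_plane_factor_norm[OF this elim] show ?case
        by (simp add: norm_divide divide_le_eq_1)
    qed
  qed simp
qed

text \<open>The difference quotient of the m-transform is the integral of t / ((1 - z t) (1 - z'
  t)). For fixed z and z' all these values with t > 0 lie in one open half-plane, so the integral is
  nonzero unless the measure is the point mass at 0.\<close>

lemma inj_on_m_transform_half_plane:
  assumes \<phi>: "real_distribution \<phi>" "AE t in \<phi>. t \<ge> 0" "\<phi> \<noteq> return borel 0"
  shows "inj_on (m_transform \<phi>) half_plane"
proof (rule inj_onI, rule ccontr)
  fix z z' assume z: "z \<in> half_plane" "z' \<in> half_plane"
    and eq: "m_transform \<phi> z = m_transform \<phi> z'" and ne: "z \<noteq> z'"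
  have re: "Re z < 0" "Re z' < 0" using z by (auto simp: half_plane_def)
  note i = m_transform_integrable[OF \<phi>(1,2) z(1)] m_transform_integrable[OF \<phi>(1,2) z(2)]
  define f where "f t = (z * of_real t / (1 - z * of_real t) - z' * of_real t / (1 - z' * of_real t)) / (z - z')"
    for t :: real
  have int: "integrable \<phi> f" unfolding f_def using i by (intro integrable_divide) auto
  have "integral\<^sup>L \<phi> f = 0"
    unfolding f_def using i eq by (simp add: m_transform_def)
  define w where "w t = (1 - z * of_real t) * (1 - z' * of_real t)" for t :: real
  have f: "f t = of_real t / w t" if "t \<ge> 0" for t
  proof -
    note n = half_plane_factor_norm(2)[OF re(1) that] half_plane_factor_norm(2)[OF re(2) that]
    have "z * of_real t / (1 - z * of_real t) - z' * of_real t / (1 - z' * of_real t) = (z - z') * (of_real t / w t)"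
      using n unfolding w_def by (simp add: divide_simps) (simp add: algebra_simps)
    then show ?thesis using ne by (simp add: f_def)
  qed
  have wRe: "Re (w t) = (1 - Re z * t) * (1 - Re z' * t) - Im z * Im z' * t\<^sup>2" for t
    by (simp add: w_def algebra_simps power2_eq_square)
  have wIm: "Im (w t) = - (t * (Im z' * (1 - Re z * t) + Im z * (1 - Re z' * t)))" for t
    by (simp add: w_def algebra_simps)
  have p: "1 - Re z * t > 0" "1 - Re z' * t > 0" if "t \<ge> 0" for t
    using that re mult_nonpos_nonneg[of "Re z" t] mult_nonpos_nonneg[of "Re z'" t] by linarith+
  have cf: "Re (c * (of_real t / w t)) = t * Re (c * cnj (w t)) / (cmod (w t))\<^sup>2" for c t
    by (subst complex_div_cnj) (simp add: algebra_simps)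
  \<comment> \<open>For t > 0 the quotient t / w has the direction of the conjugate of w. If Im z
    and Im z' are not strictly of the same sign, then Re w > 0; otherwise Im w has the sign opposite
    to that of Im z for all t > 0, and c is -i or i.\<close>
  have "\<exists>c. \<forall>t>0. Re (c * cnj (w t)) > 0"
  proof (cases "Im z * Im z' \<le> 0")
    case True
    have "Re (1 * cnj (w t)) > 0" if "t > 0" for t
    proof -
      have "Im z * Im z' * t\<^sup>2 \<le> 0" using True by (simp add: mult_nonpos_nonneg)
      moreover have "(1 - Re z * t) * (1 - Re z' * t) > 0" using p[of t] that by simp
      ultimately show ?thesis by (simp add: wRe)
    qed
    then show ?thesis by blast
  next
    case False
    then have s: "(Im z > 0 \<and> Im z' > 0) \<or> (Im z < 0 \<and> Im z' < 0)"
      by (simp add: not_le zero_less_mult_iff)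
    define s where "s = (if Im z > 0 then -\<i> else \<i>)"
    have "Re (s * cnj (w t)) > 0" if t: "t > 0" for t
    proof -
      let ?k = "Im z' * (1 - Re z * t) + Im z * (1 - Re z' * t)"
      have "(if Im z > 0 then ?k else - ?k) > 0"
      proof (cases "Im z > 0")
        case True
        have "?k > 0" by (intro add_pos_pos mult_pos_pos) (use s True p[of t] t in auto)
        then show ?thesis using True by simp
      next
        case False
        have "?k < 0" by (intro add_neg_neg mult_neg_pos) (use s False p[of t] t in auto)
        then show ?thesis using False by simp
      qed
      then have "t * (if Im z > 0 then ?k else - ?k) > 0" using t by simp
      then show ?thesis by (auto simp: s_def wIm algebra_simps split: if_splits)
    qed
    then show ?thesis by blast
  qed
  then obtain c where c: "\<And>t. t > 0 \<Longrightarrow> Re (c * cnj (w t)) > 0" by blast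
  have "AE t in \<phi>. t = 0"
  proof (rule AE_eq_0_if_integral_eq_0[OF int \<open>integral\<^sup>L \<phi> f = 0\<close>, where c = c])
    show "AE t in \<phi>. t \<noteq> 0 \<longrightarrow> Re (c * f t) > 0"
      using \<phi>(2)
    proof (eventually_elim, intro impI)
      fix t :: real assume t: "t \<ge> 0" "t \<noteq> 0"
      have "w t \<noteq> 0" using half_plane_factor_norm(2)[OF re(1) t(1)] half_plane_factor_norm(2)[OF re(2) t(1)]
        by (simp add: w_def)
      then show "Re (c * f t) > 0"
        using c[of t] t by (simp only: f[OF t(1)] cf) simp
    qed
    show "AE t in \<phi>. t = 0 \<longrightarrow> f t = 0" by (simp add: f_def)
  qed
  then have "\<phi> = return borel 0" by (rule real_distribution_eq_return_0[OF \<phi>(1)])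
  with \<phi>(3) show False by contradiction
qed

section \<open>Symmetric measures and the sector\<close>

lemma symmetric_measure_integral:
  fixes f :: "real \<Rightarrow> 'c :: {banach, second_countable_topology}"
  assumes "symmetric_measure \<psi>" "sets \<psi> = sets borel" "f \<in> borel_measurable borel"
  shows "(\<integral>t. f (- t) \<partial>\<psi>) = integral\<^sup>L \<psi> f"
proof -
  have "integral\<^sup>L \<psi> f = integral\<^sup>L (distr \<psi> borel uminus) f"
    using assms(1) by (simp add: symmetric_measure_def)
  also have "\<dots> = (\<integral>t. f (- t) \<partial>\<psi>)"
  proof (subst integral_distr)
    show "uminus \<in> \<psi> \<rightarrow>\<^sub>M borel" by (simp add: measurable_cong_sets[OF assms(2) refl])
  qed (use assms(3) in auto)
  finally show ?thesis by simp
qed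

text \<open>The hypothesis means |Re z| < |Im z|, so it covers the sector and its negative; the
  latter is needed at -i / y. The imaginary part of 1 - z t is then large enough to control z
  t.\<close>

lemma sector_factor_norm:
  assumes "Re (z\<^sup>2) < 0"
  shows "cmod (z * of_real t) \<le> 2 * cmod (1 - z * of_real t)" "1 - z * of_real t \<noteq> 0"
proof -
  have ab: "(Re z)\<^sup>2 < (Im z)\<^sup>2" using assms by (simp add: power2_eq_square)
  have "(cmod (z * of_real t))\<^sup>2 = ((Re z)\<^sup>2 + (Im z)\<^sup>2) * t\<^sup>2"
    by (simp add: cmod_power2 power_mult_distrib algebra_simps)
  also have "\<dots> \<le> (4 * (Im z)\<^sup>2) * t\<^sup>2"
  proof (rule mult_right_mono)
    show "(Re z)\<^sup>2 + (Im z)\<^sup>2 \<le> 4 * (Im z)\<^sup>2" using ab zero_le_power2[of "Im z"] by linarith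
  qed simp
  also have "\<dots> \<le> 4 * ((1 - Re z * t)\<^sup>2 + (Im z)\<^sup>2 * t\<^sup>2)" by simp
  also have "\<dots> = (2 * cmod (1 - z * of_real t))\<^sup>2"
    by (simp add: power_mult_distrib cmod_power2)
  finally show "cmod (z * of_real t) \<le> 2 * cmod (1 - z * of_real t)"
    by (rule power2_le_imp_le) simp
  show "1 - z * of_real t \<noteq> 0"
  proof
    assume "1 - z * of_real t = 0"
    then have "Im z * t = 0" "Re z * t = 1" by (simp_all add: complex_eq_iff)
    moreover have "Im z \<noteq> 0" using ab by auto
    ultimately show False by simp
  qed
qed

text \<open>Averaging the integrand over t and -t gives a function of the squares alone. This
  reduces symmetric measures to measures on the nonnegative half-line.\<close>

lemma m_transform_symmetric:
  assumes \<psi>: "real_distribution \<psi>" "symmetric_measure \<psi>" and z: "Re (z\<^sup>2) < 0"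
  shows "m_transform \<psi> z = m_transform (distr \<psi> borel (\<lambda>t. t\<^sup>2)) (z\<^sup>2)"
proof -
  interpret real_distribution \<psi> by fact
  let ?f = "\<lambda>t. z * of_real t / (1 - z * of_real t)"
  let ?g = "\<lambda>t. z\<^sup>2 * of_real (t\<^sup>2) / (1 - z\<^sup>2 * of_real (t\<^sup>2))"
  have int: "integrable \<psi> ?f"
  proof (rule integrable_bounded_by[where B = 2])
    show "norm (?f t) \<le> 2" for t
      using sector_factor_norm[OF z, of t] by (simp add: norm_divide divide_le_eq)
  qed simp
  have int': "integrable \<psi> (\<lambda>t. ?f (- t))"
  proof (rule integrable_bounded_by[where B = 2])
    show "norm (?f (-t)) \<le> 2" for t
      using sector_factor_norm[OF z, of "-t"] by (simp add: norm_divide divide_le_eq)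
  qed simp
  have eq: "?f t + ?f (- t) = 2 * ?g t" for t
  proof -
    have n: "1 - z * of_real t \<noteq> 0" "1 + z * of_real t \<noteq> 0"
      using sector_factor_norm(2)[OF z, of t] sector_factor_norm(2)[OF z, of "-t"] by auto
    have d: "1 - z\<^sup>2 * of_real (t\<^sup>2) = (1 - z * of_real t) * (1 + z * of_real t)"
      by (simp add: algebra_simps power2_eq_square)
    show ?thesis unfolding d using n by (simp add: divide_simps) (simp add: algebra_simps power2_eq_square)
  qed
  have "2 * m_transform \<psi> z = integral\<^sup>L \<psi> ?f + (\<integral>t. ?f (- t) \<partial>\<psi>)"
    by (subst symmetric_measure_integral[OF \<psi>(2) events_eq_borel, of ?f]) (simp_all add: m_transform_def)
  also have "\<dots> = (\<integral>t. ?f t + ?f (- t) \<partial>\<psi>)"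
    by (rule Bochner_Integration.integral_add[OF int int', symmetric])
  also have "\<dots> = 2 * (\<integral>t. ?g t \<partial>\<psi>)" unfolding eq by (rule integral_mult_right_zero)
  also have "(\<integral>t. ?g t \<partial>\<psi>) = m_transform (distr \<psi> borel (\<lambda>t. t\<^sup>2)) (z\<^sup>2)"
    unfolding m_transform_def by (subst integral_distr) auto
  finally show ?thesis by simp
qed

lemma sector_square: "z \<in> sector \<Longrightarrow> Re (z\<^sup>2) < 0"
proof -
  assume "z \<in> sector"
  then have "\<bar>Re z\<bar> < \<bar>Im z\<bar>" by (auto simp: sector_def)
  then have "(Re z)\<^sup>2 < (Im z)\<^sup>2" by (metis abs_ge_zero power2_abs power_strict_mono zero_less_numeral)
  then show ?thesis by (simp add: power2_eq_square)
qed

text \<open>Squaring maps the sector into the half-plane, and it is injective there because the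
  sector never contains both z and -z.\<close>

lemma inj_on_m_transform_sector:
  assumes \<psi>: "real_distribution \<psi>" "symmetric_measure \<psi>" "\<psi> \<noteq> return borel 0"
  shows "inj_on (m_transform \<psi>) sector"
proof -
  interpret real_distribution \<psi> by fact
  let ?\<phi> = "distr \<psi> borel (\<lambda>t. t\<^sup>2)"
  have d: "real_distribution ?\<phi>" by (rule real_distribution_distr) simp
  have nn: "AE t in ?\<phi>. t \<ge> 0" by (subst AE_distr_iff) auto
  have ne: "?\<phi> \<noteq> return borel 0"
  proof
    assume eq: "?\<phi> = return borel 0"
    have "AE t in ?\<phi>. t = 0" unfolding eq by (simp add: AE_return)
    then have "AE t in \<psi>. t\<^sup>2 = 0" by (subst (asm) AE_distr_iff) auto
    then have "\<psi> = return borel 0" by (intro real_distribution_eq_return_0 \<psi>) simp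
    with \<psi>(3) show False by contradiction
  qed
  show ?thesis
  proof (rule inj_onI)
    fix z z' assume z: "z \<in> sector" "z' \<in> sector" and eq: "m_transform \<psi> z = m_transform \<psi> z'"
    have "z\<^sup>2 = z'\<^sup>2"
      using inj_onD[OF inj_on_m_transform_half_plane[OF d nn ne], of "z\<^sup>2" "z'\<^sup>2"] eq z[THEN sector_square]
      by (simp add: m_transform_symmetric[OF \<psi>(1,2)] half_plane_def)
    then have "z = z' \<or> z = - z'" by (simp add: power2_eq_iff)
    then show "z = z'" using z by (auto simp: sector_def)
  qed
qed

section \<open>The imaginary axis, and holomorphy of the Cauchy-Stieltjes transform\<close>

text \<open>For symmetric \<psi> and b not 0 this is minus the m-transform at i b. It is real and
  even in b, so real analysis applies and the signs of i / y and -i / y do not matter.\<close>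

definition k_transform :: "real measure \<Rightarrow> real \<Rightarrow> real" where
  "k_transform \<psi> b = (\<integral>t. b\<^sup>2 * t\<^sup>2 / (1 + b\<^sup>2 * t\<^sup>2) \<partial>\<psi>)"

lemma m_transform_imag:
  assumes \<psi>: "real_distribution \<psi>" "symmetric_measure \<psi>" and b: "b \<noteq> 0"
  shows "m_transform \<psi> (\<i> * of_real b) = - of_real (k_transform \<psi> b)"
proof -
  interpret real_distribution \<psi> by fact
  have "(\<i> * of_real b)\<^sup>2 = - of_real (b\<^sup>2)" by (simp add: power_mult_distrib)
  then have "Re ((\<i> * of_real b)\<^sup>2) = - (b\<^sup>2)" by (simp del: of_real_power)
  then have "Re ((\<i> * of_real b)\<^sup>2) < 0" using b by simp
  from m_transform_symmetric[OF \<psi> this]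
  have "m_transform \<psi> (\<i> * of_real b) =
     (\<integral>t. (\<i> * of_real b)\<^sup>2 * of_real (t\<^sup>2) / (1 - (\<i> * of_real b)\<^sup>2 * of_real (t\<^sup>2)) \<partial>\<psi>)"
    unfolding m_transform_def by (subst (asm) integral_distr) auto
  also have "\<dots> = (\<integral>t. complex_of_real (- (b\<^sup>2 * t\<^sup>2 / (1 + b\<^sup>2 * t\<^sup>2))) \<partial>\<psi>)"
    by (intro Bochner_Integration.integral_cong refl) (simp add: power_mult_distrib)
  also have "\<dots> = of_real (- k_transform \<psi> b)"
    unfolding k_transform_def integral_complex_of_real by simp
  finally show ?thesis by simp
qed

lemma dominated_convergence_within:
  fixes f :: "'p :: metric_space \<Rightarrow> 'a \<Rightarrow> 'b :: {banach, second_countable_topology}"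
  assumes "integrable M w" "\<And>x. f x \<in> borel_measurable M" "g \<in> borel_measurable M"
    and b: "\<And>x. x \<in> S \<Longrightarrow> AE t in M. norm (f x t) \<le> w t"
    and lim: "AE t in M. ((\<lambda>x. f x t) \<longlongrightarrow> g t) (at z within S)"
  shows "((\<lambda>x. integral\<^sup>L M (f x)) \<longlongrightarrow> integral\<^sup>L M g) (at z within S)"
  unfolding tendsto_at_iff_sequentially comp_def
proof (intro allI impI)
  fix X :: "nat \<Rightarrow> 'p" assume X: "\<forall>i. X i \<in> S - {z}" "X \<longlonglongrightarrow> z"
  show "(\<lambda>i. integral\<^sup>L M (f (X i))) \<longlonglongrightarrow> integral\<^sup>L M g"
  proof (rule integral_dominated_convergence[where w = w])
    show "AE t in M. (\<lambda>i. f (X i) t) \<longlonglongrightarrow> g t"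
      using lim by eventually_elim (use X in \<open>auto simp: tendsto_at_iff_sequentially comp_def\<close>)
  qed (use assms X in auto)
qed

lemma k_transform_continuous:
  assumes "real_distribution \<psi>"
  shows "continuous_on UNIV (k_transform \<psi>)"
proof -
  interpret real_distribution \<psi> by fact
  have p: "1 + b\<^sup>2 * t\<^sup>2 > 0" for b t :: real by (simp add: add_pos_nonneg)
  have "isCont (k_transform \<psi>) b" for b
    unfolding isCont_def k_transform_def
  proof (rule dominated_convergence_within[where w = "\<lambda>_. 1"])
    show "AE t in \<psi>. norm (b\<^sup>2 * t\<^sup>2 / (1 + b\<^sup>2 * t\<^sup>2)) \<le> 1" for b
      using p by (auto simp: divide_le_eq_1)
    show "AE t in \<psi>. ((\<lambda>b. b\<^sup>2 * t\<^sup>2 / (1 + b\<^sup>2 * t\<^sup>2)) \<longlongrightarrow> b\<^sup>2 * t\<^sup>2 / (1 + b\<^sup>2 * t\<^sup>2)) (at b)"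
      using p by (intro AE_I2 tendsto_intros) (auto simp: less_imp_neq[symmetric])
  qed auto
  then show ?thesis by (simp add: continuous_at_imp_continuous_on)
qed

lemma k_transform_pos:
  assumes \<psi>: "real_distribution \<psi>" "\<psi> \<noteq> return borel 0"
  shows "k_transform \<psi> 1 > 0"
proof -
  interpret real_distribution \<psi> by fact
  let ?f = "\<lambda>t::real. 1\<^sup>2 * t\<^sup>2 / (1 + 1\<^sup>2 * t\<^sup>2)"
  have p: "1 + t\<^sup>2 > 0" for t :: real by (simp add: add_pos_nonneg)
  have int: "integrable \<psi> ?f"
    by (rule integrable_bounded_by[where B = 1]) (use p in \<open>auto simp: divide_le_eq_1\<close>)
  have nn: "AE t in \<psi>. 0 \<le> ?f t" by simp
  have ne: "integral\<^sup>L \<psi> ?f \<noteq> 0"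
  proof
    assume "integral\<^sup>L \<psi> ?f = 0"
    then have "AE t in \<psi>. ?f t = 0" using integral_nonneg_eq_0_iff_AE[OF int nn] by simp
    then have "AE t in \<psi>. t = 0"
    proof eventually_elim
      case (elim t)
      then show ?case using p[of t] by auto
    qed
    then show False using real_distribution_eq_return_0[OF \<psi>(1)] \<psi>(2) by simp
  qed
  have "integral\<^sup>L \<psi> ?f \<ge> 0" by (intro Bochner_Integration.integral_nonneg) simp
  from order.not_eq_order_implies_strict[OF not_sym[OF ne] this]
  show ?thesis by (simp only: k_transform_def)
qed

text \<open>Intermediate values between b = 0, where the transform vanishes, and b = 1. The choice
  of 1 is arbitrary: some interval of values is all that is wanted of an otherwise unknown
  measure.\<close>

lemma k_transform_surj:
  assumes \<psi>: "real_distribution \<psi>" and w: "0 < w" "w \<le> k_transform \<psi> 1"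
  obtains b where "b > 0" "k_transform \<psi> b = w"
proof -
  have "continuous_on {0..1} (k_transform \<psi>)"
    using k_transform_continuous[OF \<psi>] continuous_on_subset by blast
  then obtain b where b: "0 \<le> b" "b \<le> 1" "k_transform \<psi> b = w"
    using IVT'[of "k_transform \<psi>" 0 w 1] w by (auto simp: k_transform_def)
  then have "b \<noteq> 0" using w by (auto simp: k_transform_def)
  with b show ?thesis by (intro that[of b]) auto
qed

lemma cauchy_stieltjes_holomorphic:
  assumes "real_distribution \<mu>"
  shows "cauchy_stieltjes \<mu> holomorphic_on {z. Im z > 0}"
proof -
  interpret real_distribution \<mu> by fact
  have "((cauchy_stieltjes \<mu>) has_field_derivative (\<integral>t. 1 / (of_real t - z) * (1 / (of_real t - z)) \<partial>\<mu>)) (at z)"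
    if z: "Im z > 0" for z
  proof -
    have b: "cmod (1 / (of_real t - w)) \<le> 1 / a" if "a > 0" "Im w \<ge> a" for t w and a :: real
    proof -
      have "a \<le> cmod (of_real t - w)" using abs_Im_le_cmod[of "of_real t - w"] that by simp
      then show ?thesis using that by (simp add: norm_divide frac_le)
    qed
    have nz: "of_real t - w \<noteq> 0" if "Im w > 0" for t w using that by (auto simp: complex_eq_iff)
    have int: "integrable \<mu> (\<lambda>t. 1 / (of_real t - w))" if "Im w > 0" for w
      by (rule integrable_bounded_by[where B = "1 / Im w"]) (use b[OF that] in auto)
    \<comment> \<open>On this half-plane |1 / (t - w)| is at most 2 / Im z, which dominates the
      difference quotients uniformly in w.\<close>
    define S where "S = {w. Im w > Im z / 2}"
    have S: "open S" "z \<in> S" using z by (simp_all only: S_def open_halfspace_Im_gt) simp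
    have ev: "\<forall>\<^sub>F w in at z. w \<in> S" by (rule eventually_at_in_open'[OF S])
    have "((\<lambda>w. \<integral>t. 1 / (of_real t - w) * (1 / (of_real t - z)) \<partial>\<mu>) \<longlongrightarrow>
       (\<integral>t. 1 / (of_real t - z) * (1 / (of_real t - z)) \<partial>\<mu>)) (at z within S)"
    proof (rule dominated_convergence_within[where w = "\<lambda>_. 1 / (Im z / 2) * (1 / Im z)"])
      show "AE t in \<mu>. norm (1 / (of_real t - w) * (1 / (of_real t - z))) \<le> 1 / (Im z / 2) * (1 / Im z)"
        if "w \<in> S" for w
        unfolding norm_mult using z that by (intro AE_I2 mult_mono b) (auto simp: S_def)
      show "AE t in \<mu>. ((\<lambda>w. 1 / (of_real t - w) * (1 / (of_real t - z))) \<longlongrightarrow> 1 / (of_real t - z) * (1 / (of_real t - z))) (at z within S)"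
        using nz[OF z] by (intro AE_I2 tendsto_intros) auto
    qed auto
    then have "((\<lambda>w. \<integral>t. 1 / (of_real t - w) * (1 / (of_real t - z)) \<partial>\<mu>) \<longlongrightarrow>
       (\<integral>t. 1 / (of_real t - z) * (1 / (of_real t - z)) \<partial>\<mu>)) (at z)"
      by (simp add: at_within_open[OF S(2,1)])
    moreover have "\<forall>\<^sub>F w in at z. (\<integral>t. 1 / (of_real t - w) * (1 / (of_real t - z)) \<partial>\<mu>) =
        (cauchy_stieltjes \<mu> w - cauchy_stieltjes \<mu> z) / (w - z)"
      using ev eventually_neq_at_within[of z]
    proof eventually_elim
      case (elim w)
      then have w: "Im w > 0" "w \<noteq> z" using z by (auto simp: S_def)
      have "cauchy_stieltjes \<mu> w - cauchy_stieltjes \<mu> z = (\<integral>t. 1 / (of_real t - w) - 1 / (of_real t - z) \<partial>\<mu>)"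
        unfolding cauchy_stieltjes_def by (rule Bochner_Integration.integral_diff[OF int[OF w(1)] int[OF z], symmetric])
      also have "\<dots> = (\<integral>t. (w - z) * (1 / (of_real t - w) * (1 / (of_real t - z))) \<partial>\<mu>)"
        using nz[OF w(1)] nz[OF z] by (intro Bochner_Integration.integral_cong refl) (simp add: divide_simps)
      also have "\<dots> = (w - z) * (\<integral>t. 1 / (of_real t - w) * (1 / (of_real t - z)) \<partial>\<mu>)"
        by (rule integral_mult_right_zero)
      finally show ?case using w(2) by simp
    qed
    ultimately show ?thesis
      unfolding has_field_derivative_iff by (rule Lim_transform_eventually)
  qed
  then show ?thesis
    by (auto simp: holomorphic_on_def field_differentiable_def intro: has_field_derivative_at_within)
qed

section \<open>The semicircle law\<close>

lemma four_minus_square_pos: "t \<in> {-2<..<2} \<Longrightarrow> 4 - t\<^sup>2 > (0::real)"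
  using abs_square_less_1[of "t / 2"] by (auto simp: power_divide)

lemma arcsin_half_deriv:
  assumes t: "t \<in> {-2<..<2::real}"
  shows "((\<lambda>t. arcsin (t / 2)) has_real_derivative 1 / sqrt (4 - t\<^sup>2)) (at t)"
proof -
  have "1 - (t / 2)\<^sup>2 = (4 - t\<^sup>2) / 2\<^sup>2" by (simp add: power_divide field_simps)
  then have h: "sqrt (1 - (t / 2)\<^sup>2) = sqrt (4 - t\<^sup>2) / 2"
    by (simp only: real_sqrt_divide) simp
  have e: "inverse (sqrt (1 - (t / 2)\<^sup>2)) * (1 / 2) = 1 / sqrt (4 - t\<^sup>2)" unfolding h by simp
  have "((\<lambda>t. arcsin (t / 2)) has_real_derivative inverse (sqrt (1 - (t / 2)\<^sup>2)) * (1 / 2)) (at t)"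
    using t by (intro DERIV_chain2[OF DERIV_arcsin] DERIV_cdivide DERIV_ident) auto
  then show ?thesis unfolding e .
qed

lemma sqrt_semicircle_deriv:
  assumes t: "t \<in> {-2<..<2::real}"
  shows "((\<lambda>t. sqrt (4 - t\<^sup>2)) has_real_derivative (- t / sqrt (4 - t\<^sup>2))) (at t)"
  using four_minus_square_pos[OF t] by (auto intro!: derivative_eq_intros simp: field_simps)

lemma semicircle_area_deriv:
  assumes t: "t \<in> {-2<..<2::real}"
  shows "((\<lambda>t. t * sqrt (4 - t\<^sup>2) / 2 + 2 * arcsin (t / 2)) has_real_derivative sqrt (4 - t\<^sup>2)) (at t)"
proof -
  define s where "s = sqrt (4 - t\<^sup>2)"
  have s: "s > 0" "s * s = 4 - t * t"
    using four_minus_square_pos[OF t] by (simp_all add: s_def power2_eq_square)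
  note d = DERIV_add[OF DERIV_cdivide[OF DERIV_mult[OF DERIV_ident sqrt_semicircle_deriv[OF t]], of 2]
      DERIV_cmult[OF arcsin_half_deriv[OF t], of 2]]
  have "(1 * s + (- t / s) * t) / 2 + 2 * (1 / s) = (s * s - t * t + 4) / (2 * s)"
    using s(1) by (simp add: field_simps)
  also have "\<dots> = s" using s by (simp add: field_simps)
  finally have e: "(1 * s + (- t / s) * t) / 2 + 2 * (1 / s) = s" .
  show ?thesis by (rule DERIV_cong[OF d, folded s_def, OF e, unfolded s_def])
qed

text \<open>With s and p as in the proof, \<open>r\<^sup>2 - p = b\<^sup>2 * s\<^sup>2\<close>.
  Hence s / p splits into multiples of 1 / (s p) and 1 / s, the derivatives of an arctan and an
  arcsin term.\<close>

lemma semicircle_resolvent_deriv: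
  assumes t: "t \<in> {-2<..<2::real}" and b: "b > 0"
  defines "r \<equiv> sqrt (1 + 4 * b\<^sup>2)"
  shows "((\<lambda>t. (r * arctan (r * (t / sqrt (4 - t\<^sup>2))) - arcsin (t / 2)) / b\<^sup>2)
    has_real_derivative sqrt (4 - t\<^sup>2) / (1 + b\<^sup>2 * t\<^sup>2)) (at t)"
proof -
  define s where "s = sqrt (4 - t\<^sup>2)"
  define p where "p = 1 + b\<^sup>2 * t\<^sup>2"
  have s: "s > 0" "s\<^sup>2 = 4 - t\<^sup>2" using four_minus_square_pos[OF t] by (simp_all add: s_def)
  have r: "r\<^sup>2 = 1 + 4 * b\<^sup>2" by (simp add: r_def)
  have p: "p > 0" by (simp add: p_def add_pos_nonneg)
  have "((\<lambda>t. t / sqrt (4 - t\<^sup>2)) has_real_derivative (1 * s - t * (- t / s)) / (s * s)) (at t)"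
    using DERIV_divide[OF DERIV_ident sqrt_semicircle_deriv[OF t]] s by (simp add: s_def)
  moreover have "(1 * s - t * (- t / s)) / (s * s) = 4 / s ^ 3"
  proof -
    have "(1 * s - t * (- t / s)) / (s * s) = (s\<^sup>2 + t\<^sup>2) / s ^ 3"
      using s(1) by (simp add: field_simps power2_eq_square power3_eq_cube)
    then show ?thesis using s(2) by simp
  qed
  ultimately have u: "((\<lambda>t. t / sqrt (4 - t\<^sup>2)) has_real_derivative 4 / s ^ 3) (at t)" by simp
  have a: "((\<lambda>t. arctan (r * (t / sqrt (4 - t\<^sup>2)))) has_real_derivative
      inverse (1 + (r * (t / s))\<^sup>2) * (r * (4 / s ^ 3))) (at t)"
    using DERIV_chain2[OF DERIV_arctan DERIV_cmult[OF u, of r]] by (simp add: s_def)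
  have e: "inverse (1 + (r * (t / s))\<^sup>2) * (r * (4 / s ^ 3)) = r / (s * p)"
  proof -
    have "1 + (r * (t / s))\<^sup>2 = (s\<^sup>2 + r\<^sup>2 * t\<^sup>2) / s\<^sup>2"
      using s(1) by (simp add: power_mult_distrib power_divide field_simps)
    also have "s\<^sup>2 + r\<^sup>2 * t\<^sup>2 = 4 * p"
      unfolding r s(2) p_def by (simp add: algebra_simps)
    finally show ?thesis using s(1) p by (simp add: field_simps power2_eq_square power3_eq_cube)
  qed
  note d = DERIV_cdivide[OF DERIV_diff[OF DERIV_cmult[OF a[unfolded e], of r] arcsin_half_deriv[OF t]], of "b\<^sup>2"]
  have "(r * (r / (s * p)) - 1 / s) / b\<^sup>2 = (r\<^sup>2 - p) / (s * p * b\<^sup>2)"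
    using s p b by (simp add: field_simps power2_eq_square)
  also have "r\<^sup>2 - p = s\<^sup>2 * b\<^sup>2"
    unfolding r s(2) p_def by (simp add: algebra_simps)
  also have "s\<^sup>2 * b\<^sup>2 / (s * p * b\<^sup>2) = s / p" using s(1) b p by (simp add: field_simps power2_eq_square)
  finally have e2: "(r * (r / (s * p)) - 1 / s) / b\<^sup>2 = s / p" .
  show ?thesis by (rule DERIV_cong[OF d, folded s_def p_def, OF e2, unfolded s_def p_def])
qed

lemma arcsin_half_tendsto:
  "((\<lambda>t. arcsin (t / 2)) \<longlongrightarrow> pi / 2) (at_left (2::real))"
  "((\<lambda>t. arcsin (t / 2)) \<longlongrightarrow> - (pi / 2)) (at_right (-2::real))"
proof -
  have "continuous_on {-2..2} (\<lambda>t::real. arcsin (t / 2))"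
    by (intro continuous_on_arcsin continuous_intros) auto
  note c = this[unfolded continuous_on, rule_format]
  have "((\<lambda>t. arcsin (t / 2)) \<longlongrightarrow> arcsin (2 / 2)) (at (2::real) within {-2..2})"
    by (rule c) simp
  then show "((\<lambda>t. arcsin (t / 2)) \<longlongrightarrow> pi / 2) (at_left (2::real))"
    by (simp add: at_within_Icc_at_left)
  have "((\<lambda>t. arcsin (t / 2)) \<longlongrightarrow> arcsin (-2 / 2)) (at (-2::real) within {-2..2})"
    by (rule c) simp
  then show "((\<lambda>t. arcsin (t / 2)) \<longlongrightarrow> - (pi / 2)) (at_right (-2::real))"
    by (simp add: at_within_Icc_at_right)
qed

lemma arctan_semicircle_tendsto:
  assumes "r > 0"
  shows "((\<lambda>t. arctan (r * (t / sqrt (4 - t\<^sup>2)))) \<longlongrightarrow> pi / 2) (at_left (2::real))"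
    "((\<lambda>t. arctan (r * (t / sqrt (4 - t\<^sup>2)))) \<longlongrightarrow> - (pi / 2)) (at_right (-2::real))"
proof -
  have "filterlim (\<lambda>t::real. t / sqrt (4 - t\<^sup>2)) at_top (at_left 2)" by real_asymp
  then show "((\<lambda>t. arctan (r * (t / sqrt (4 - t\<^sup>2)))) \<longlongrightarrow> pi / 2) (at_left (2::real))"
    by (intro filterlim_compose[OF tendsto_arctan_at_top] filterlim_tendsto_pos_mult_at_top[OF tendsto_const assms])
  have "filterlim (\<lambda>t::real. t / sqrt (4 - t\<^sup>2)) at_bot (at_right (-2))" by real_asymp
  then show "((\<lambda>t. arctan (r * (t / sqrt (4 - t\<^sup>2)))) \<longlongrightarrow> - (pi / 2)) (at_right (-2::real))"
    by (intro filterlim_compose[OF tendsto_arctan_at_bot] filterlim_tendsto_pos_mult_at_bot[OF tendsto_const assms])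
qed

lemma sqrt_semicircle_tendsto:
  "((\<lambda>t. t * sqrt (4 - t\<^sup>2) / 2) \<longlongrightarrow> 0) (at_left (2::real))"
  "((\<lambda>t. t * sqrt (4 - t\<^sup>2) / 2) \<longlongrightarrow> 0) (at_right (-2::real))"
  by (auto intro!: tendsto_eq_intros)

text \<open>One-sided limits are needed at -2 and 2: the antiderivatives come with derivatives in
  the interior only, and the arctan term divides by 0 at the endpoints, where its value is a mere
  default.\<close>

lemma semicircle_FTC:
  assumes F: "\<And>t. t \<in> {-2<..<2} \<Longrightarrow> (F has_real_derivative h t * sqrt (4 - t\<^sup>2)) (at t)"
    and h: "continuous_on UNIV h" "\<And>t. h t \<ge> 0"
    and lim: "(F \<longlongrightarrow> A) (at_right (-2))" "(F \<longlongrightarrow> B) (at_left 2)"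
  shows "integrable lborel (\<lambda>t. indicator {-2..2} t * sqrt (4 - t\<^sup>2) * h t)"
    and "(\<integral>t. indicator {-2..2} t * sqrt (4 - t\<^sup>2) * h t \<partial>lborel) = B - A"
proof -
  let ?f = "\<lambda>t. h t * sqrt (4 - t\<^sup>2)"
  have c: "isCont ?f t" for t
    using h(1) by (intro continuous_intros) (auto simp: continuous_on_eq_continuous_at)
  \<comment> \<open>The open and the closed interval give the same integrand because the square root
    vanishes at -2 and 2.\<close>
  have eq: "indicator (einterval (ereal (-2)) (ereal 2)) t *\<^sub>R ?f t = indicator {-2..2} t * sqrt (4 - t\<^sup>2) * h t" for t
    by (cases "t = 2 \<or> t = -2") (auto simp: indicator_def einterval_def)
  have 1: "DERIV F t :> ?f t" if "ereal (-2) < ereal t" "ereal t < ereal 2" for t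
    using F that by simp
  have 2: "AE t in lborel. ereal (-2) < ereal t \<longrightarrow> ereal t < ereal 2 \<longrightarrow> 0 \<le> ?f t"
  proof (rule AE_I2, intro impI)
    fix t assume "ereal (-2) < ereal t" "ereal t < ereal 2"
    then show "0 \<le> ?f t" using four_minus_square_pos[of t] h(2)[of t] by simp
  qed
  have 3: "((F \<circ> real_of_ereal) \<longlongrightarrow> A) (at_right (ereal (-2)))"
    unfolding ereal_tendsto_simps by (rule lim)
  have 4: "((F \<circ> real_of_ereal) \<longlongrightarrow> B) (at_left (ereal 2))"
    unfolding ereal_tendsto_simps by (rule lim)
  have lt: "ereal (-2) < ereal 2" by simp
  note ftc = interval_integral_FTC_nonneg[OF lt 1 c 2 3 4]
  show "integrable lborel (\<lambda>t. indicator {-2..2} t * sqrt (4 - t\<^sup>2) * h t)"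
    using ftc(1) unfolding set_integrable_def eq .
  show "(\<integral>t. indicator {-2..2} t * sqrt (4 - t\<^sup>2) * h t \<partial>lborel) = B - A"
    using ftc(2) unfolding interval_lebesgue_integral_def set_lebesgue_integral_def eq by simp
qed

section \<open>The semicircle law and its m-transform\<close>

lemma semicircle_density_nonneg: "0 \<le> indicator {-2..2} x * sqrt (4 - x\<^sup>2) / (2 * pi)" for x :: real
proof (cases "x \<in> {-2..2}")
  case True
  then have "x\<^sup>2 \<le> 2\<^sup>2" by (intro abs_le_square_iff[THEN iffD1]) auto
  then show ?thesis by simp
qed simp

lemma real_distribution_semicircle: "real_distribution semicircle"
proof -
  let ?g = "\<lambda>x::real. indicator {-2..2} x * sqrt (4 - x\<^sup>2) / (2 * pi)"
  note FTC = semicircle_FTC[where h = "\<lambda>_. 1" and F = "\<lambda>t. t * sqrt (4 - t\<^sup>2) / 2 + 2 * arcsin (t / 2)", OF _ _ _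
      tendsto_add[OF sqrt_semicircle_tendsto(2) tendsto_mult_left[OF arcsin_half_tendsto(2), of 2]]
      tendsto_add[OF sqrt_semicircle_tendsto(1) tendsto_mult_left[OF arcsin_half_tendsto(1), of 2]],
      simplified, OF semicircle_area_deriv[simplified]]
  have "emeasure semicircle (space semicircle) = (\<integral>\<^sup>+x. ennreal (?g x) \<partial>lborel)"
    by (simp add: semicircle_def emeasure_density)
  also have "\<dots> = ennreal (\<integral>x. ?g x \<partial>lborel)"
    using FTC(1) semicircle_density_nonneg by (intro nn_integral_eq_integral integrable_divide) auto
  also have "(\<integral>x. ?g x \<partial>lborel) = 1" using FTC(2) by simp
  finally have "prob_space semicircle" by (intro prob_spaceI) simp
  then show ?thesis
    by (intro real_distribution.intro real_distribution_axioms.intro) (simp_all add: semicircle_def)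
qed

lemma symmetric_semicircle: "symmetric_measure semicircle"
proof -
  let ?g = "\<lambda>x::real. ennreal (indicator {-2..2} x * sqrt (4 - x\<^sup>2) / (2 * pi))"
  have "distr semicircle borel uminus = distr (density (distr lborel borel uminus) ?g) borel uminus"
    by (simp add: semicircle_def lborel_distr_uminus)
  also have "\<dots> = distr (distr (density lborel (\<lambda>x. ?g (-x))) borel uminus) borel uminus"
    by (subst density_distr) auto
  also have "\<dots> = density lborel (\<lambda>x. ?g (-x))"
    by (subst distr_distr) (auto simp: comp_def intro!: distr_cong[THEN trans, OF refl _ _ distr_id2])
  also have "(\<lambda>x. ?g (-x)) = ?g" by (auto simp: indicator_def)
  finally show ?thesis by (simp add: symmetric_measure_def semicircle_def)
qed

lemma semicircle_neq_return: "semicircle \<noteq> return borel 0"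
proof
  assume eq: "semicircle = return borel 0"
  have "emeasure semicircle {0} = 1" unfolding eq by simp
  moreover have "emeasure semicircle {0} = 0"
    unfolding semicircle_def
    by (subst emeasure_density) (auto intro!: nn_integral_null_set simp: null_sets_def)
  ultimately show False by simp
qed

text \<open>The parametrisation b = g / (1 - g^2) makes 1 + 4 b^2 the square of (1 + g^2) / (1 -
  g^2), so that the integral becomes rational in g. It follows that the S-transform at w = -g^2 is
  -i / g, a square root of 1 / w.\<close>

lemma k_transform_semicircle:
  assumes g: "0 < g" "g < 1"
  shows "k_transform semicircle (g / (1 - g\<^sup>2)) = g\<^sup>2"
proof -
  define b where "b = g / (1 - g\<^sup>2)"
  have g2: "1 - g\<^sup>2 > 0" using g by (simp add: power_less_one_iff)
  have b: "b > 0" using g g2 by (simp add: b_def)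
  define r where "r = sqrt (1 + 4 * b\<^sup>2)"
  have r: "r = (1 + g\<^sup>2) / (1 - g\<^sup>2)"
  proof -
    have "1 + 4 * b\<^sup>2 = ((1 + g\<^sup>2) / (1 - g\<^sup>2))\<^sup>2"
    proof -
      define d where "d = 1 - g\<^sup>2"
      have "1 + 4 * (g / d)\<^sup>2 = (d\<^sup>2 + 4 * g\<^sup>2) / d\<^sup>2"
        using g2 by (simp add: d_def[symmetric] power_divide field_simps)
      also have "d\<^sup>2 + 4 * g\<^sup>2 = (1 + g\<^sup>2)\<^sup>2"
        by (simp add: d_def power2_eq_square algebra_simps)
      finally show ?thesis by (simp add: b_def d_def power_divide)
    qed
    moreover have "(1 + g\<^sup>2) / (1 - g\<^sup>2) \<ge> 0" using g2 by simp
    ultimately show ?thesis unfolding r_def by (intro real_sqrt_unique) (simp_all only:)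
  qed
  have r0: "r > 0" using g2 by (simp add: r add_pos_nonneg)
  have p: "1 + b\<^sup>2 * t\<^sup>2 > 0" for t :: real by (simp add: add_pos_nonneg)
  let ?h = "\<lambda>t. b\<^sup>2 * t\<^sup>2 / (1 + b\<^sup>2 * t\<^sup>2)"
  let ?F = "\<lambda>t. (t * sqrt (4 - t\<^sup>2) / 2 + 2 * arcsin (t / 2)) -
     (r * arctan (r * (t / sqrt (4 - t\<^sup>2))) - arcsin (t / 2)) / b\<^sup>2"
  have dF: "(?F has_real_derivative ?h t * sqrt (4 - t\<^sup>2)) (at t)" if t: "t \<in> {-2<..<2}" for t
  proof -
    have "?h t = 1 - 1 / (1 + b\<^sup>2 * t\<^sup>2)" using p[of t] by (simp add: field_simps)
    then show ?thesis
      using DERIV_diff[OF semicircle_area_deriv[OF t] semicircle_resolvent_deriv[OF t b, folded r_def]]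
      by (simp add: left_diff_distrib)
  qed
  have l: "(?F \<longlongrightarrow> (0 + 2 * (- (pi / 2))) - (r * (- (pi / 2)) - (- (pi / 2))) / b\<^sup>2) (at_right (-2))"
    "(?F \<longlongrightarrow> (0 + 2 * (pi / 2)) - (r * (pi / 2) - pi / 2) / b\<^sup>2) (at_left 2)"
    using b by (intro tendsto_intros sqrt_semicircle_tendsto arcsin_half_tendsto arctan_semicircle_tendsto r0; simp)+
  have "(\<integral>t. indicator {-2..2} t * sqrt (4 - t\<^sup>2) * ?h t \<partial>lborel) =
    ((0 + 2 * (pi / 2)) - (r * (pi / 2) - pi / 2) / b\<^sup>2) - ((0 + 2 * (- (pi / 2))) - (r * (- (pi / 2)) - (- (pi / 2))) / b\<^sup>2)"
    by (rule semicircle_FTC(2)[OF dF _ _ l])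
      (use p in \<open>auto intro!: continuous_intros simp: less_imp_neq[symmetric] less_imp_le\<close>)
  also have "\<dots> = 2 * pi * (1 - (r - 1) / (2 * b\<^sup>2))"
    using b by (simp add: field_simps)
  also have "(r - 1) / (2 * b\<^sup>2) = 1 - g\<^sup>2"
  proof -
    have r1: "r - 1 = 2 * g\<^sup>2 / (1 - g\<^sup>2)" using g2 by (simp add: r field_simps)
    have "2 * g\<^sup>2 / d / (2 * (g / d)\<^sup>2) = d" if "d > 0" for d
      using g that by (simp add: field_simps power2_eq_square)
    from this[OF g2] show ?thesis by (simp only: r1 b_def)
  qed
  finally have I: "(\<integral>t. indicator {-2..2} t * sqrt (4 - t\<^sup>2) * ?h t \<partial>lborel) = 2 * pi * g\<^sup>2" by simp
  have "k_transform semicircle b =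
     (\<integral>t. (indicator {-2..2} t * sqrt (4 - t\<^sup>2) / (2 * pi)) *\<^sub>R ?h t \<partial>lborel)"
    unfolding k_transform_def semicircle_def
    by (rule integral_density) (use semicircle_density_nonneg in auto)
  also have "\<dots> = (\<integral>t. indicator {-2..2} t * sqrt (4 - t\<^sup>2) * ?h t / (2 * pi) \<partial>lborel)"
    by (intro Bochner_Integration.integral_cong refl) simp
  also have "\<dots> = g\<^sup>2" unfolding integral_divide_zero I by simp
  finally show ?thesis by (simp add: b_def)
qed

section \<open>Free convolution with the semicircle law\<close>

text \<open>The preimages of w = -(y m)^2 are -m, i b and i b' for the three measures.
  Multiplicativity reads b' = m b (1 - g^2) / g^2 with g = y m, and b = g / (1 - g^2) turns this
  into b' = 1 / y. The bounds on y m ensure that b and b' exist.\<close>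

lemma free_mult_conv_semicircle_imag:
  assumes \<phi>: "real_distribution \<phi>" "AE t in \<phi>. t \<ge> 0" "\<phi> \<noteq> return borel 0"
    and conv: "is_free_mult_conv \<phi> semicircle \<mu>"
    and m: "m > 0" and y: "y > 0" and ym: "y * m < 1" "(y * m)\<^sup>2 \<le> k_transform \<mu> 1"
    and eq: "m_transform \<phi> (- of_real m) = - of_real ((y * m)\<^sup>2)"
  shows "k_transform \<mu> (1 / y) = (y * m)\<^sup>2"
proof -
  define g where "g = y * m"
  have g: "0 < g" "g < 1" "g\<^sup>2 \<le> k_transform \<mu> 1" using m y ym by (simp_all add: g_def)
  have g2: "1 - g\<^sup>2 > 0" using g by (simp add: power_less_one_iff)
  have \<mu>: "real_distribution \<mu>" "symmetric_measure \<mu>" "\<mu> \<noteq> return borel 0"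
    and S: "\<And>w. w \<in> S_domain half_plane \<phi> \<inter> S_domain sector semicircle \<inter> S_domain sector \<mu> \<Longrightarrow>
        S_transform sector \<mu> w = S_transform half_plane \<phi> w * S_transform sector semicircle w"
    using conv by (auto simp: is_free_mult_conv_def)
  define w where "w = - complex_of_real (g\<^sup>2)"
  \<comment> \<open>At this point b' is only some preimage; that it is 1 / y is the conclusion to be
    drawn from multiplicativity.\<close>
  obtain b' where b': "b' > 0" "k_transform \<mu> b' = g\<^sup>2"
    using k_transform_surj[OF \<mu>(1) _ g(3)] g by auto
  define b where "b = g / (1 - g\<^sup>2)"
  have b: "b > 0" using g g2 by (simp add: b_def)
  note sc = real_distribution_semicircle symmetric_semicircle semicircle_neq_return
  have sec: "\<i> * of_real c \<in> sector" if "c > 0" for c using that by (simp add: sector_def)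
  have hp: "- complex_of_real m \<in> half_plane" using m by (simp add: half_plane_def)
  have w\<phi>: "m_transform \<phi> (- of_real m) = w" using eq by (simp add: w_def g_def)
  have kb: "k_transform semicircle b = g\<^sup>2"
    unfolding b_def by (rule k_transform_semicircle[OF g(1,2)])
  have wsc: "m_transform semicircle (\<i> * of_real b) = w"
    using m_transform_imag[OF sc(1,2), of b] b kb by (simp add: w_def)
  have w\<mu>: "m_transform \<mu> (\<i> * of_real b') = w"
    using m_transform_imag[OF \<mu>(1,2), of b'] b' by (simp add: w_def)
  have "w \<in> S_domain half_plane \<phi>" unfolding S_domain_def w\<phi>[symmetric] using hp by (rule imageI)
  moreover have "w \<in> S_domain sector semicircle"
    unfolding S_domain_def wsc[symmetric] using sec[OF b] by (rule imageI)
  moreover have "w \<in> S_domain sector \<mu>"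
    unfolding S_domain_def w\<mu>[symmetric] using sec[OF b'(1)] by (rule imageI)
  ultimately have St: "S_transform sector \<mu> w = S_transform half_plane \<phi> w * S_transform sector semicircle w"
    using S by blast
  have i\<phi>: "inv_into half_plane (m_transform \<phi>) w = - of_real m"
    unfolding w\<phi>[symmetric] by (rule inv_into_f_f[OF inj_on_m_transform_half_plane[OF \<phi>] hp])
  have isc: "inv_into sector (m_transform semicircle) w = \<i> * of_real b"
    unfolding wsc[symmetric] by (rule inv_into_f_f[OF inj_on_m_transform_sector[OF sc] sec[OF b]])
  have i\<mu>: "inv_into sector (m_transform \<mu>) w = \<i> * of_real b'"
    unfolding w\<mu>[symmetric] by (rule inv_into_f_f[OF inj_on_m_transform_sector[OF \<mu>] sec[OF b'(1)]])
  have w1: "1 + inverse w = of_real (- ((1 - g\<^sup>2) / g\<^sup>2))"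
    using g by (simp add: w_def field_simps)
  \<comment> \<open>One factor 1 + 1 / w can be cancelled since g < 1; the other one, from the
    product of two S-transforms, remains.\<close>
  have w1': "1 + inverse w \<noteq> 0"
    unfolding w1 using g g2 by (simp del: of_real_minus of_real_divide)
  have "(1 + inverse w) * (\<i> * of_real b') = (1 + inverse w) * (- of_real m * ((1 + inverse w) * (\<i> * of_real b)))"
    using St by (simp add: S_transform_def i\<phi> isc i\<mu> mult.assoc)
  then have "\<i> * of_real b' = - of_real m * ((1 + inverse w) * (\<i> * of_real b))"
    using w1' by (simp only: mult_cancel_left) simp
  then have "\<i> * complex_of_real b' = \<i> * of_real (m * ((1 - g\<^sup>2) / g\<^sup>2) * b)"
    unfolding w1 by (simp add: mult_ac)
  then have "b' = m * ((1 - g\<^sup>2) / g\<^sup>2) * b"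
    by (simp only: mult_cancel_left of_real_eq_iff) simp
  also have "\<dots> = m / g" using g g2 by (simp add: b_def power2_eq_square)
  also have "\<dots> = 1 / y" using m y by (simp add: g_def)
  finally show ?thesis using b' by (simp add: g_def)
qed

section \<open>Cauchy-Stieltjes transforms on the imaginary axis and size-biasing\<close>

text \<open>The general relation is m(1 / z) = -1 - z G(z), and the reciprocal of i y is -i /
  y.\<close>

lemma m_transform_cauchy_stieltjes:
  assumes \<mu>: "real_distribution \<mu>" and y: "y > 0"
  shows "m_transform \<mu> (\<i> * of_real (- (1 / y))) = - 1 - \<i> * of_real y * cauchy_stieltjes \<mu> (\<i> * of_real y)"
proof -
  interpret real_distribution \<mu> by fact
  have nz: "of_real t - \<i> * of_real y \<noteq> 0" for t using y by (simp add: complex_eq_iff)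
  have b: "cmod (1 / (of_real t - \<i> * of_real y)) \<le> 1 / y" for t
  proof -
    have "y \<le> cmod (of_real t - \<i> * of_real y)"
      using abs_Im_le_cmod[of "of_real t - \<i> * of_real y"] y by simp
    then show ?thesis using y by (simp add: norm_divide frac_le)
  qed
  have int: "integrable \<mu> (\<lambda>t. 1 / (of_real t - \<i> * of_real y))"
    by (rule integrable_bounded_by[OF _ b]) simp
  have e: "\<i> * of_real (- (1 / y)) * of_real t / (1 - \<i> * of_real (- (1 / y)) * of_real t) =
      - 1 - \<i> * of_real y * (1 / (of_real t - \<i> * of_real y))" for t
  proof -
    have y': "complex_of_real y \<noteq> 0" using y by simp
    define d where "d = of_real t - \<i> * of_real y"
    have d: "d \<noteq> 0" using nz by (simp add: d_def)
    have n: "\<i> * of_real (- (1 / y)) * of_real t = - (\<i> * of_real t / of_real y)" by simp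
    have "1 - \<i> * of_real (- (1 / y)) * of_real t = \<i> * d / of_real y"
      using y' by (simp add: d_def field_simps)
    then have "\<i> * of_real (- (1 / y)) * of_real t / (1 - \<i> * of_real (- (1 / y)) * of_real t) =
        - (\<i> * of_real t / of_real y) / (\<i> * d / of_real y)"
      unfolding n by simp
    also have "\<dots> = - (of_real t / d)" using y' by simp
    also have "\<dots> = - ((d + \<i> * of_real y) / d)" by (simp add: d_def)
    also have "\<dots> = - 1 - \<i> * of_real y * (1 / d)"
      using d by (simp add: add_divide_distrib)
    finally show ?thesis by (simp only: d_def)
  qed
  have "m_transform \<mu> (\<i> * of_real (- (1 / y))) =
      (\<integral>t. - 1 \<partial>\<mu>) - (\<integral>t. \<i> * of_real y * (1 / (of_real t - \<i> * of_real y)) \<partial>\<mu>)"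
    unfolding m_transform_def e
    by (intro Bochner_Integration.integral_diff integrable_mult_right int) simp
  then show ?thesis
    unfolding cauchy_stieltjes_def integral_mult_right_zero using prob_space by simp
qed

text \<open>By symmetry the real part of the transform vanishes. The value is read off from
  \<open>k_transform\<close> at 1 / y, where symmetrisation has already been carried out.\<close>

lemma cauchy_stieltjes_symmetric_imag:
  assumes \<mu>: "real_distribution \<mu>" "symmetric_measure \<mu>" and y: "y > 0"
  shows "cauchy_stieltjes \<mu> (\<i> * of_real y) = \<i> * of_real (y * (\<integral>t. 1 / (y\<^sup>2 + t\<^sup>2) \<partial>\<mu>))"
proof -
  interpret real_distribution \<mu> by fact
  have y': "complex_of_real y \<noteq> 0" using y by simp
  have p: "y\<^sup>2 + t\<^sup>2 > 0" for t using y by (simp add: add_pos_nonneg)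
  have c: "complex_of_real (k_transform \<mu> (1 / y)) = 1 - of_real (y\<^sup>2 * (\<integral>t. 1 / (y\<^sup>2 + t\<^sup>2) \<partial>\<mu>))"
  proof -
    have int: "integrable \<mu> (\<lambda>t. 1 / (y\<^sup>2 + t\<^sup>2))"
      by (rule integrable_bounded_by[where B = "1 / y\<^sup>2"]) (use y p in \<open>auto simp: frac_le\<close>)
    have "k_transform \<mu> (1 / y) = (\<integral>t. 1 - y\<^sup>2 * (1 / (y\<^sup>2 + t\<^sup>2)) \<partial>\<mu>)"
      unfolding k_transform_def
    proof (intro Bochner_Integration.integral_cong refl)
      fix t
      have "1 + (1 / y)\<^sup>2 * t\<^sup>2 = (y\<^sup>2 + t\<^sup>2) / y\<^sup>2" using y by (simp add: power_divide field_simps)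
      then show "(1 / y)\<^sup>2 * t\<^sup>2 / (1 + (1 / y)\<^sup>2 * t\<^sup>2) = 1 - y\<^sup>2 * (1 / (y\<^sup>2 + t\<^sup>2))"
        using y p[of t] by (simp add: power_divide field_simps)
    qed
    also have "\<dots> = (\<integral>t. 1 \<partial>\<mu>) - (\<integral>t. y\<^sup>2 * (1 / (y\<^sup>2 + t\<^sup>2)) \<partial>\<mu>)"
      by (intro Bochner_Integration.integral_diff integrable_mult_right int) simp
    also have "\<dots> = 1 - y\<^sup>2 * (\<integral>t. 1 / (y\<^sup>2 + t\<^sup>2) \<partial>\<mu>)"
      unfolding integral_mult_right_zero using prob_space by simp
    finally show ?thesis by simp
  qed
  have mk: "m_transform \<mu> (\<i> * of_real (- (1 / y))) = - of_real (k_transform \<mu> (1 / y))"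
    using m_transform_imag[OF \<mu>, of "- (1 / y)"] y by (simp add: k_transform_def)
  have "\<i> * of_real y * cauchy_stieltjes \<mu> (\<i> * of_real y) = - 1 - m_transform \<mu> (\<i> * of_real (- (1 / y)))"
    unfolding m_transform_cauchy_stieltjes[OF \<mu>(1) y] by simp
  also have "\<dots> = - of_real (y\<^sup>2 * (\<integral>t. 1 / (y\<^sup>2 + t\<^sup>2) \<partial>\<mu>))"
    unfolding mk c by simp
  also have "\<dots> = \<i> * of_real y * (\<i> * of_real (y * (\<integral>t. 1 / (y\<^sup>2 + t\<^sup>2) \<partial>\<mu>)))"
    by (simp add: complex_eq_iff power2_eq_square)
  finally show ?thesis using y' by (simp only: mult_cancel_left) simp
qed

lemma real_distribution_size_biasing:
  assumes \<phi>: "real_distribution \<phi>" "AE t in \<phi>. t \<ge> 0" "integrable \<phi> (\<lambda>t. t)" "(\<integral>t. t \<partial>\<phi>) = 1"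
  shows "real_distribution (size_biasing \<phi>)"
proof -
  interpret real_distribution \<phi> by fact
  have "emeasure (size_biasing \<phi>) (space (size_biasing \<phi>)) = (\<integral>\<^sup>+t. ennreal t \<partial>\<phi>)"
    by (simp add: size_biasing_def emeasure_density)
  also have "\<dots> = 1" using nn_integral_eq_integral[OF \<phi>(3,2)] \<phi>(4) by simp
  finally have "prob_space (size_biasing \<phi>)" by (rule prob_spaceI)
  then show ?thesis
    by (intro real_distribution.intro real_distribution_axioms.intro) (simp_all add: size_biasing_def)
qed

text \<open>The factor t in the numerator of the m-transform is the density of the
  size-biasing.\<close>

lemma m_transform_size_biasing:
  assumes \<phi>: "real_distribution \<phi>" "AE t in \<phi>. t \<ge> 0" and m: "m > 0"
  shows "m_transform \<phi> (- of_real m) = - of_real (m * (\<integral>t. 1 / (1 + \<bar>t\<bar> * m) \<partial>size_biasing \<phi>))"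
proof -
  interpret real_distribution \<phi> by fact
  have "(\<integral>t. 1 / (1 + \<bar>t\<bar> * m) \<partial>size_biasing \<phi>) = (\<integral>t. t *\<^sub>R (1 / (1 + \<bar>t\<bar> * m)) \<partial>\<phi>)"
    unfolding size_biasing_def by (rule integral_density) (use \<phi>(2) in auto)
  then have "- (m * (\<integral>t. 1 / (1 + \<bar>t\<bar> * m) \<partial>size_biasing \<phi>)) = (\<integral>t. - m * (t *\<^sub>R (1 / (1 + \<bar>t\<bar> * m))) \<partial>\<phi>)"
    by (simp only: integral_mult_right_zero minus_mult_left)
  then have "complex_of_real (- (m * (\<integral>t. 1 / (1 + \<bar>t\<bar> * m) \<partial>size_biasing \<phi>))) =
     (\<integral>t. complex_of_real (- m * (t *\<^sub>R (1 / (1 + \<bar>t\<bar> * m)))) \<partial>\<phi>)"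
    by (simp only: integral_complex_of_real)
  also have "\<dots> = m_transform \<phi> (- of_real m)"
    unfolding m_transform_def
  proof (rule integral_cong_AE)
    show "AE t in \<phi>. complex_of_real (- m * (t *\<^sub>R (1 / (1 + \<bar>t\<bar> * m)))) =
        - complex_of_real m * complex_of_real t / (1 - - complex_of_real m * complex_of_real t)"
      using \<phi>(2)
    proof eventually_elim
      case (elim t)
      then show ?case by (simp add: mult.commute)
    qed
  qed auto
  finally show ?thesis by simp
qed

theorem proposition1p7:
  fixes P :: "'a measure" and D :: "'a \<Rightarrow> real"
    and W :: "'w measure" and \<Lambda> :: "nat \<Rightarrow> complex mat" and X :: "nat \<Rightarrow> 'w \<Rightarrow> complex mat"
    and \<nu>D \<nu> \<mu>MP \<mu>t \<mu> :: "real measure"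
  assumes "prob_space P"
    and "D \<in> borel_measurable P"
    and "AE \<omega> in P. 0 \<le> D \<omega>"
    and "integrable P D"
    and "prob_space.expectation P D = 1"
    and "\<nu>D = distr P borel D"
    and "\<nu> = size_biasing \<nu>D"
    and "marchenko_pastur_limit W \<Lambda> X \<nu> \<mu>MP"
    and "real_distribution \<mu>t"
    and "symmetric_measure \<mu>t"
    and "distr \<mu>t borel (\<lambda>x. x\<^sup>2) = \<mu>MP"
    and "is_free_mult_conv \<nu>D semicircle \<mu>"
  shows "\<forall>z. Im z > 0 \<longrightarrow>
           cauchy_stieltjes \<mu> z = - inverse z * (1 + (cauchy_stieltjes \<mu>t z)\<^sup>2)"
proof -
  interpret P: prob_space P by fact
  have \<nu>D: "real_distribution \<nu>D"
    unfolding assms(6) by (rule P.real_distribution_distr) fact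
  have nn: "AE t in \<nu>D. t \<ge> 0"
    unfolding assms(6) using assms(2,3) by (subst AE_distr_iff) auto
  have intD: "integrable \<nu>D (\<lambda>t. t)" and mean: "(\<integral>t. t \<partial>\<nu>D) = 1"
    unfolding assms(6) using assms(2,4,5) by (simp_all add: integrable_distr_eq integral_distr)
  have ne: "\<nu>D \<noteq> return borel 0"
  proof
    assume "\<nu>D = return borel 0"
    then have "(\<integral>t. t \<partial>return borel (0::real)) = 1" using mean by simp
    then show False by (subst (asm) integral_return) auto
  qed
  have \<nu>: "real_distribution \<nu>"
    unfolding assms(7) by (rule real_distribution_size_biasing[OF \<nu>D nn intD mean])
  have \<mu>: "real_distribution \<mu>" "symmetric_measure \<mu>" "\<mu> \<noteq> return borel 0"
    using assms(12) by (auto simp: is_free_mult_conv_def)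
  interpret \<mu>t: real_distribution \<mu>t by fact
  define k where "k = k_transform \<mu> 1"
  have k: "k > 0" unfolding k_def by (rule k_transform_pos[OF \<mu>(1,3)])
  \<comment> \<open>For y > 1 the bound y m <= 1 / y gives y m < 1, and y > 1 / sqrt k gives (y m)^2
    <= k; these are the two conditions for applying multiplicativity.\<close>
  define Y where "Y = max 1 (1 / sqrt k)"
  define H where "H z = cauchy_stieltjes \<mu> z + inverse z * (1 + (cauchy_stieltjes \<mu>t z)\<^sup>2)" for z
  have H0: "H (\<i> * of_real y) = 0" if yY: "y > Y" for y
  proof -
    have y: "y > 1" "1 / sqrt k < y" using yY by (auto simp: Y_def)
    define m where "m = (\<integral>t. 1 / (y\<^sup>2 + \<bar>t\<bar>) \<partial>\<mu>MP)"
    have y2: "y\<^sup>2 > 0" using y by simp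
    have m: "m > 0" and meq: "y\<^sup>2 * m = (\<integral>t. 1 / (1 + \<bar>t\<bar> * m) \<partial>\<nu>)"
      unfolding m_def by (rule marchenko_pastur_equation[OF assms(8) \<nu> y2])+
    have mt: "m = (\<integral>t. 1 / (y\<^sup>2 + t\<^sup>2) \<partial>\<mu>t)"
      unfolding m_def assms(11)[symmetric] by (subst integral_distr) auto
    have "m \<le> 1 / y\<^sup>2"
    proof -
      have b: "1 / (y\<^sup>2 + t\<^sup>2) \<le> 1 / y\<^sup>2" for t using y2 by (intro divide_left_mono mult_pos_pos add_pos_nonneg) auto
      have "integrable \<mu>t (\<lambda>t. 1 / (y\<^sup>2 + t\<^sup>2))"
        by (rule \<mu>t.integrable_bounded_by[where B = "1 / y\<^sup>2"]) (use b in auto)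
      then show ?thesis unfolding mt by (rule \<mu>t.integral_le_const) (use b in auto)
    qed
    then have ym: "y * m \<le> 1 / y" using y by (simp add: field_simps power2_eq_square)
    have "1 < y * sqrt k" using y k by (simp add: field_simps)
    then have yk: "(1 / y)\<^sup>2 \<le> k"
      using y k real_sqrt_le_iff
      by (smt (verit) divide_le_eq mult.commute power_mono real_sqrt_pow2 zero_le_divide_1_iff)
    have ym2: "(y * m)\<^sup>2 \<le> k"
      by (rule order_trans[OF power_mono[OF ym] yk]) (use y m in simp)
    have "1 / y < 1" using y by simp
    with ym have ym1: "y * m < 1" by linarith
    \<comment> \<open>The fixed-point equation replaces the integral over \<nu> by
      \<open>y\<^sup>2 * m\<close>, and multiplication by m completes the square.\<close>
    have "m_transform \<nu>D (- of_real m) = - of_real ((y * m)\<^sup>2)"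
      using m_transform_size_biasing[OF \<nu>D nn m] meq
      by (simp add: assms(7)[symmetric] power_mult_distrib power2_eq_square mult_ac)
    from free_mult_conv_semicircle_imag[OF \<nu>D nn ne assms(12) m _ ym1 ym2[unfolded k_def] this]
    have kt: "k_transform \<mu> (1 / y) = (y * m)\<^sup>2" using y by simp
    have y0: "y > 0" "complex_of_real y \<noteq> 0" using y by auto
    \<comment> \<open>Multiplicativity gave the value at i / y, whereas the relation to the
      Cauchy-Stieltjes transform needs -i / y; evenness of \<open>k_transform\<close> links the
      two.\<close>
    have "m_transform \<mu> (\<i> * of_real (- (1 / y))) = - of_real ((y * m)\<^sup>2)"
      using m_transform_imag[OF \<mu>(1,2), of "- (1 / y)"] y kt by (simp add: k_transform_def)
    then have G: "\<i> * of_real y * cauchy_stieltjes \<mu> (\<i> * of_real y) = of_real ((y * m)\<^sup>2) - 1"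
      using m_transform_cauchy_stieltjes[OF \<mu>(1) y0(1)] by (simp add: algebra_simps)
    have Gt: "cauchy_stieltjes \<mu>t (\<i> * of_real y) = \<i> * of_real (y * m)"
      using cauchy_stieltjes_symmetric_imag[OF assms(9,10) y0(1)] unfolding mt .
    define c where "c = \<i> * complex_of_real y"
    have c: "c \<noteq> 0" using y0 by (simp add: c_def)
    have "(cauchy_stieltjes \<mu>t c)\<^sup>2 = - of_real ((y * m)\<^sup>2)"
      using Gt by (simp add: c_def power_mult_distrib)
    moreover have "c * H c = c * cauchy_stieltjes \<mu> c + (c * inverse c) * (1 + (cauchy_stieltjes \<mu>t c)\<^sup>2)"
      by (simp only: H_def distrib_left mult.assoc)
    ultimately have "c * H c = 0" using c G by (simp add: c_def[symmetric])
    then show ?thesis using c by (simp add: c_def)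
  qed
  have hol: "H holomorphic_on {z. Im z > 0}"
    unfolding H_def
    by (intro holomorphic_intros cauchy_stieltjes_holomorphic \<mu>(1) assms(9)) auto
  have "H z = 0" if z: "Im z > 0" for z
  proof (rule analytic_continuation[OF hol])
    show "open {z. Im z > 0}" by (rule open_halfspace_Im_gt)
    show "connected {z. Im z > 0}" by (intro convex_connected convex_halfspace_Im_gt)
    \<comment> \<open>The zeros on this ray accumulate at i (Y + 1), an interior point of the upper
      half-plane, so the identity theorem applies.\<close>
    let ?U = "(\<lambda>y. \<i> * of_real y) ` {Y<..}"
    have Y: "Y > 0" by (simp add: Y_def)
    show "?U \<subseteq> {z. Im z > 0}" using Y by auto
    show "\<i> * of_real (Y + 1) \<in> {z. Im z > 0}" using Y by simp
    show "\<i> * of_real (Y + 1) islimpt ?U"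
      unfolding islimpt_approachable
    proof (intro allI impI)
      fix e :: real assume e: "e > 0"
      show "\<exists>x'\<in>?U. x' \<noteq> \<i> * of_real (Y + 1) \<and> dist x' (\<i> * of_real (Y + 1)) < e"
        using e
        by (intro bexI[of _ "\<i> * of_real (Y + 1 + e / 2)"])
          (auto simp: dist_norm norm_mult right_diff_distrib[symmetric] simp flip: of_real_diff of_real_add)
    qed
    show "H z = 0" if "z \<in> ?U" for z using that H0 by auto
    show "z \<in> {z. Im z > 0}" using z by simp
  qed
  then show ?thesis
    by (auto simp: H_def eq_neg_iff_add_eq_0)
qed

end
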